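(* Let $f:(\mathbb{R}^2,a)\to(\mathbb{R}^3,b)$ be a frontal of corank $1$, and let $\lambda$ be a Jacobian of $f$ and $\eta$ a kernel field of $f$. Then the following conditions are equivalent to each other: (1) $f$ is $\mathcal{A}$-equivalent to the cuspidal edge, i.e. to the tangent surface of a curve of type $(1,2,3)$. (1') $f$ is $\mathcal{A}$-equivalent to the germ $(t_1,t_2)\mapsto(t_1,\,t_2^2,\,t_2^3)$ at the origin. (2) $f$ is a front and $(\eta\lambda)(a)\neq 0$. (3) $(\eta\lambda)(a)\neq 0$ and $\mathrm{ord}_a^\eta(f_3)=3$ for an adapted system of coordinates $(x_1,x_2,x_3)$ of $(\mathbb{R}^3,b)$, where $f_3=x_3\circ f$.
   Context: All manifolds, maps and germs are $C^\infty$. Two map-germs $f:(\mathbb{R}^n,a)\to(\mathbb{R}^m,b)$ and $f':(\mathbb{R}^n,a')\to(\mathbb{R}^m,b')$ are $\mathcal{A}$-equivalent if $\tau\circ f=f'\circ\sigma$ for some diffeomorphism-germs $\sigma:(\mathbb{R}^n,a)\to(\mathbb{R}^n,a')$, $\tau:(\mathbb{R}^m,b)\to(\mathbb{R}^m,b')$. $\mathcal{E}_a$ is the $\mathbb{R}$-algebra of smooth function-germs on $(\mathbb{R}^n,a)$ and $\mathcal{V}_a$ the $\mathcal{E}_a$-module of germs of vector fields. Frontals. Let $n\le m$. A germ $f:(\mathbb{R}^n,a)\to(\mathbb{R}^m,b)$ is a frontal if there is a smooth germ $\widetilde f:(\mathbb{R}^n,a)\to\mathrm{Gr}(n,T\mathbb{R}^m)$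 (the bundle of $n$-planes in tangent spaces of $\mathbb{R}^m$) lifting $f$ with $T_tf(T_t\mathbb{R}^n)\subset\widetilde f(t)\subset T_{f(t)}\mathbb{R}^m$ for all $t$ near $a$; $\widetilde f$ is called a Legendre lift of $f$. A frontal is a front if it has a Legendre lift that is an immersion. $f$ is of corank $k$ if $\dim_{\mathbb R}\mathrm{Ker}(T_af)=k$. Jacobian and kernel field. The Jacobi ideal $J_f\subset\mathcal{E}_a$ is generated by all $n\times n$ minors of the Jacobi matrix of $f$. For a frontal it is principal; a generator $\lambda$ of $J_f$ is called a Jacobian of $f$. Put $\mathcal{N}_f=\{\eta\in\mathcal{V}_a\mid \eta f_i\in J_f,\ 1\le i\le m\}$. For a frontal $f$ of corank $1$, a kernel field is an $\eta\in\mathcal{N}_f$ whose class generates the $\mathcal{E}_a$-module $\mathcal{N}_f/\lambda\mathcal{V}_a$. Adapted coordinates. Local coordinates $(x_1,\dots,x_m)$ of $\mathbb{R}^m$ centered at $b$ are adapted to $f$ if $\widetilde f(a)=\langle(\partial/\partial x_1)_b,\dots,(\partial/\partial x_n)_b\rangle_{\mathbb R}$ for a Legendre lift $\widetilde f$ of $f$. Vanishing order. $\mathrm{ord}_a^\eta(h)=\inf\{i\in\mathbb{N}\cup\{0\}\mid(\eta^ih)(a)\ne0\}$ for $h\in\mathcal{E}_a$. Tangent surfaces. A curve-germ $\gamma:(\mathbb{R},0)\to\mathbb{R}^m$ is of type $(\ell_1,\dots,\ell_m)$, $1\le\ell_1<\ell_2<\cdots<\ell_m$, if in some affine coordinates centered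 at $\gamma(0)$ it has the form $\gamma(t)=(t^{\ell_1}+\cdots,\dots,t^{\ell_m}+\cdots)$, dots being higher order terms. Its tangent surface is the germ at $(0,0)$ of $\mathrm{Tan}(\gamma)(t,u)=\gamma(t)+u\,\gamma'(t)/t^{\ell_1-1}$. It is known that for type $(1,2,3)$ its $\mathcal{A}$-equivalence class depends only on the type. *)

theory Defs
  imports "HOL-Analysis.Analysis" "HOL-Library.Extended_Nat"
begin

section \<open>Smooth map-germs\<close>

text \<open>
  A germ at a point \<open>a\<close> is represented by a total function whose values away from \<open>a\<close> are
  irrelevant; two representatives give the same germ if they agree eventually in \<open>nhds a\<close>.
\<close>

primrec Ck_on :: "nat \<Rightarrow> 'a::real_normed_vector set \<Rightarrow> ('a \<Rightarrow> 'b::real_normed_vector) \<Rightarrow> bool" where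
  "Ck_on 0 S f \<longleftrightarrow> continuous_on S f"
| "Ck_on (Suc k) S f \<longleftrightarrow> (\<forall>x\<in>S. f differentiable (at x)) \<and>
     (\<forall>v. Ck_on k S (\<lambda>x. frechet_derivative f (at x) v))"

definition smooth_germ :: "'a::real_normed_vector \<Rightarrow> ('a \<Rightarrow> 'b::real_normed_vector) \<Rightarrow> bool" where
  "smooth_germ a f \<longleftrightarrow> (\<exists>U. open U \<and> a \<in> U \<and> (\<forall>k. Ck_on k U f))"

definition diffeo_germ ::
    "('a::real_normed_vector \<Rightarrow> 'b::real_normed_vector) \<Rightarrow> 'a \<Rightarrow> 'b \<Rightarrow> bool" where
  "diffeo_germ \<sigma> a b \<longleftrightarrow> smooth_germ a \<sigma> \<and> \<sigma> a = b \<and>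
     (\<exists>\<rho>. smooth_germ b \<rho> \<and> \<rho> b = a \<and>
        (\<forall>\<^sub>F x in nhds a. \<rho> (\<sigma> x) = x) \<and> (\<forall>\<^sub>F y in nhds b. \<sigma> (\<rho> y) = y))"

text \<open>The target base points are \<open>f a\<close> and \<open>f' a'\<close>.\<close>

definition A_equivalent ::
    "(real^'n \<Rightarrow> real^'m) \<Rightarrow> real^'n \<Rightarrow> (real^'n \<Rightarrow> real^'m) \<Rightarrow> real^'n \<Rightarrow> bool" where
  "A_equivalent f a f' a' \<longleftrightarrow> (\<exists>\<sigma> \<tau>. diffeo_germ \<sigma> a a' \<and> diffeo_germ \<tau> (f a) (f' a') \<and>
     (\<forall>\<^sub>F t in nhds a. \<tau> (f t) = f' (\<sigma> t)))"

section \<open>Frontals and fronts\<close>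

definition Gr :: "nat \<Rightarrow> (real^'m) set set" where
  "Gr k = {W. subspace W \<and> dim W = k}"

text \<open>
  \<open>Gr k\<close> carries the usual atlas of graph charts: the chart centred at \<open>W\<^sub>0\<close> sends a plane \<open>W\<close>
  transverse to the orthogonal complement of \<open>W\<^sub>0\<close> to the linear map from \<open>W\<^sub>0\<close> to that complement
  of which \<open>W\<close> is the graph. This linear map is written as the matrix \<open>A\<close> obtained by
  extending it by zero; it is uniquely determined by \<open>W\<^sub>0\<close> and \<open>W\<close>.
\<close>

definition gr_chart :: "(real^'m) set \<Rightarrow> (real^'m) set \<Rightarrow> real^'m^'m \<Rightarrow> bool" where
  "gr_chart W\<^sub>0 W A \<longleftrightarrow> (\<forall>x\<in>W\<^sub>0. A *v x \<in> orthogonal_comp W\<^sub>0) \<and>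
     (\<forall>x\<in>orthogonal_comp W\<^sub>0. A *v x = 0) \<and> W = {x + A *v x | x. x \<in> W\<^sub>0}"

text \<open>
  \<open>A\<close> is the (smooth) expression of the plane-valued map \<open>P\<close> in the chart centred at \<open>P a\<close>.
\<close>

definition smooth_gr_expr ::
    "real^'n \<Rightarrow> (real^'n \<Rightarrow> (real^'m) set) \<Rightarrow> (real^'n \<Rightarrow> real^'m^'m) \<Rightarrow> bool" where
  "smooth_gr_expr a P A \<longleftrightarrow>
     smooth_germ a A \<and> (\<forall>\<^sub>F t in nhds a. gr_chart (P a) (P t) (A t))"

text \<open>
  The tangent bundle of \<open>real^'m\<close> is trivial, so a lift of \<open>f\<close> to the bundle of \<open>n\<close>-planes is
  \<open>t \<mapsto> (f t, P t)\<close> and is given by its second component \<open>P\<close>.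
\<close>

definition legendre_lift ::
    "real^'n \<Rightarrow> (real^'n \<Rightarrow> real^'m) \<Rightarrow> (real^'n \<Rightarrow> (real^'m) set) \<Rightarrow> bool" where
  "legendre_lift a f P \<longleftrightarrow> (\<forall>\<^sub>F t in nhds a. P t \<in> Gr CARD('n)) \<and> (\<exists>A. smooth_gr_expr a P A) \<and>
     (\<forall>\<^sub>F t in nhds a. range (frechet_derivative f (at t)) \<subseteq> P t)"

definition frontal :: "real^'n \<Rightarrow> (real^'n \<Rightarrow> real^'m) \<Rightarrow> bool" where
  "frontal a f \<longleftrightarrow> smooth_germ a f \<and> (\<exists>P. legendre_lift a f P)"

definition immersive_lift ::
    "real^'n \<Rightarrow> (real^'n \<Rightarrow> real^'m) \<Rightarrow> (real^'n \<Rightarrow> (real^'m) set) \<Rightarrow> bool" where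
  "immersive_lift a f P \<longleftrightarrow>
     (\<exists>A. smooth_gr_expr a P A \<and> inj (frechet_derivative (\<lambda>t. (f t, A t)) (at a)))"

definition front :: "real^'n \<Rightarrow> (real^'n \<Rightarrow> real^'m) \<Rightarrow> bool" where
  "front a f \<longleftrightarrow> smooth_germ a f \<and> (\<exists>P. legendre_lift a f P \<and> immersive_lift a f P)"

definition corank :: "real^'n \<Rightarrow> (real^'n \<Rightarrow> real^'m) \<Rightarrow> nat" where
  "corank a f = dim {v. frechet_derivative f (at a) v = 0}"

section \<open>Jacobians and kernel fields\<close>

text \<open>The set \<open>G\<close> of generators is meant to be finite.\<close>

definition germ_ideal :: "real^'n \<Rightarrow> (real^'n \<Rightarrow> real) set \<Rightarrow> (real^'n \<Rightarrow> real) set" where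
  "germ_ideal a G = {h. \<exists>c. (\<forall>g\<in>G. smooth_germ a (c g)) \<and>
     (\<forall>\<^sub>F t in nhds a. h t = (\<Sum>g\<in>G. c g t * g t))}"

text \<open>The minor of the Jacobi matrix with rows \<open>s i\<close>, in the order given by \<open>s\<close>.\<close>

definition jacobi_minor :: "(real^'n \<Rightarrow> real^'m) \<Rightarrow> ('n \<Rightarrow> 'm) \<Rightarrow> real^'n \<Rightarrow> real" where
  "jacobi_minor f s t = det (\<chi> i j. matrix (frechet_derivative f (at t)) $ s i $ j)"

definition jacobi_ideal :: "real^'n \<Rightarrow> (real^'n \<Rightarrow> real^'m) \<Rightarrow> (real^'n \<Rightarrow> real) set" where
  "jacobi_ideal a f = germ_ideal a (jacobi_minor f ` {s. inj s})"

definition is_jacobian :: "real^'n \<Rightarrow> (real^'n \<Rightarrow> real^'m) \<Rightarrow> (real^'n \<Rightarrow> real) \<Rightarrow> bool" where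
  "is_jacobian a f l \<longleftrightarrow> smooth_germ a l \<and> jacobi_ideal a f = germ_ideal a {l}"

definition vf_apply :: "(real^'n \<Rightarrow> real^'n) \<Rightarrow> (real^'n \<Rightarrow> real) \<Rightarrow> real^'n \<Rightarrow> real" where
  "vf_apply \<eta> h t = frechet_derivative h (at t) (\<eta> t)"

definition kernel_module ::
    "real^'n \<Rightarrow> (real^'n \<Rightarrow> real^'m) \<Rightarrow> (real^'n \<Rightarrow> real^'n) set" where
  "kernel_module a f =
     {\<eta>. smooth_germ a \<eta> \<and> (\<forall>i. vf_apply \<eta> (\<lambda>t. f t $ i) \<in> jacobi_ideal a f)}"

text \<open>
  \<open>\<eta>\<close> generates the quotient of \<^term>\<open>kernel_module a f\<close> by the multiples of the Jacobian \<open>l\<close>.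
\<close>

definition kernel_field ::
    "real^'n \<Rightarrow> (real^'n \<Rightarrow> real^'m) \<Rightarrow> (real^'n \<Rightarrow> real) \<Rightarrow> (real^'n \<Rightarrow> real^'n) \<Rightarrow> bool" where
  "kernel_field a f l \<eta> \<longleftrightarrow> \<eta> \<in> kernel_module a f \<and>
     (\<forall>\<xi>\<in>kernel_module a f. \<exists>c \<zeta>. smooth_germ a c \<and> smooth_germ a \<zeta> \<and>
        (\<forall>\<^sub>F t in nhds a. \<xi> t = c t *\<^sub>R \<eta> t + l t *\<^sub>R \<zeta> t))"

definition vf_ord :: "real^'n \<Rightarrow> (real^'n \<Rightarrow> real^'n) \<Rightarrow> (real^'n \<Rightarrow> real) \<Rightarrow> enat" where
  "vf_ord a \<eta> h = (INF i\<in>{i. (vf_apply \<eta> ^^ i) h a \<noteq> 0}. enat i)"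

section \<open>Adapted coordinates for surfaces in 3-space\<close>

definition coord_vector :: "(real^'m \<Rightarrow> real^'m) \<Rightarrow> real^'m \<Rightarrow> 'm \<Rightarrow> real^'m" where
  "coord_vector x b i = inv (frechet_derivative x (at b)) (axis i 1)"

definition adapted_coordinates ::
    "real^2 \<Rightarrow> (real^2 \<Rightarrow> real^3) \<Rightarrow> (real^3 \<Rightarrow> real^3) \<Rightarrow> bool" where
  "adapted_coordinates a f x \<longleftrightarrow> diffeo_germ x (f a) 0 \<and>
     (\<exists>P. legendre_lift a f P \<and> P a = span {coord_vector x (f a) 1, coord_vector x (f a) 2})"

section \<open>Tangent surfaces of curves in 3-space\<close>

definition leading_power :: "nat \<Rightarrow> (real \<Rightarrow> real) \<Rightarrow> bool" where
  "leading_power l h \<longleftrightarrow>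
     (\<exists>g. smooth_germ 0 g \<and> (\<forall>\<^sub>F t in nhds 0. h t = t ^ l + t ^ (l + 1) * g t))"

text \<open>The invertible matrix \<open>M\<close> gives the affine coordinates \<open>M *v (y - \<gamma> 0)\<close> centred at \<open>\<gamma> 0\<close>.\<close>

definition curve_of_type :: "nat \<Rightarrow> nat \<Rightarrow> nat \<Rightarrow> (real \<Rightarrow> real^3) \<Rightarrow> bool" where
  "curve_of_type l\<^sub>1 l\<^sub>2 l\<^sub>3 \<gamma> \<longleftrightarrow> 1 \<le> l\<^sub>1 \<and> l\<^sub>1 < l\<^sub>2 \<and> l\<^sub>2 < l\<^sub>3 \<and> smooth_germ 0 \<gamma> \<and>
     (\<exists>M::real^3^3. invertible M \<and>
        leading_power l\<^sub>1 (\<lambda>t. (M *v (\<gamma> t - \<gamma> 0)) $ 1) \<and>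
        leading_power l\<^sub>2 (\<lambda>t. (M *v (\<gamma> t - \<gamma> 0)) $ 2) \<and>
        leading_power l\<^sub>3 (\<lambda>t. (M *v (\<gamma> t - \<gamma> 0)) $ 3))"

text \<open>
  The quotient \<open>\<gamma>'(t) / t ^ (l\<^sub>1 - 1)\<close> extends smoothly to \<open>t = 0\<close>; the limit
  supplies its value there (which is \<open>\<gamma>'(0)\<close> if \<open>l\<^sub>1 = 1\<close>).
\<close>

definition tangent_direction :: "nat \<Rightarrow> (real \<Rightarrow> real^3) \<Rightarrow> real \<Rightarrow> real^3" where
  "tangent_direction l\<^sub>1 \<gamma> t =
     (let q = (\<lambda>s. (1 / s ^ (l\<^sub>1 - 1)) *\<^sub>R vector_derivative \<gamma> (at s))
      in if t = 0 then Lim (at 0) q else q t)"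

definition tangent_surface :: "nat \<Rightarrow> (real \<Rightarrow> real^3) \<Rightarrow> real^2 \<Rightarrow> real^3" where
  "tangent_surface l\<^sub>1 \<gamma> p = \<gamma> (p $ 1) + (p $ 2) *\<^sub>R tangent_direction l\<^sub>1 \<gamma> (p $ 1)"

end

theory Submission
  imports Defs
begin

text \<open>
  Why the conditions are equivalent. Let \<open>f\<close> be a frontal of corank 1 and choose target coordinates
  in which the limiting tangent plane at \<open>a\<close> is horizontal and the image of the differential at
  \<open>a\<close> is the first axis. The Legendre lift then amounts to two functions \<open>A1\<close>, \<open>A2\<close>, vanishing at \<open>a\<close>,
  with \<open>df3 = A1 df1 + A2 df2\<close>. Let \<open>X\<close> be the Hamiltonian field of \<open>f1\<close>; it kills \<open>f1\<close>, satisfies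
  \<open>X f3 = A2 (X f2)\<close>, and all \<open>2\<times>2\<close> minors of \<open>f\<close> are multiples of \<open>X f2\<close>. Hence \<open>(\<eta> l)(a) \<noteq> 0\<close> forces
  \<open>X (X f2) (a) \<noteq> 0\<close>. Symmetry of second derivatives gives \<open>(X A1)(a) = 0\<close>, so the lift can be an
  immersion only if \<open>(X A2)(a) \<noteq> 0\<close> (\<open>front_cuspidal_edge\<close>).

  These data determine the germ (\<open>cuspidal_edge_criterion\<close>). Take \<open>s = f1\<close> and \<open>z = X f2\<close> as source
  coordinates. A Morse lemma with parameter makes \<open>f2\<close> equal to \<open>k(s) \<plusminus> w\<^sup>2\<close>, and then
  \<open>\<partial>f3/\<partial>w = \<plusminus> 2 w A2\<close>, so that the part of \<open>f3\<close> that is odd in \<open>w\<close> is \<open>w\<^sup>3\<close> times a function that is even in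
  \<open>w\<close> and nonzero at the origin. If even functions of \<open>w\<close> are smooth functions of \<open>w\<^sup>2\<close>, then
  \<open>f3 = E(s, w\<^sup>2) + w\<^sup>3 U(s, w\<^sup>2)\<close> with \<open>U(0, 0) \<noteq> 0\<close>, and a triangular diffeomorphism of the target
  removes \<open>k\<close>, \<open>E\<close> and \<open>U\<close>, leaving \<open>(s, w\<^sup>2, w\<^sup>3)\<close>.

  The analytic core is therefore Whitney's theorem on even functions, with a parameter
  (\<open>whitney_even\<close>). The target is a full neighbourhood, so \<open>y \<mapsto> g(s, \<surd>y)\<close> has to be continued smoothly
  to \<open>y < 0\<close>. Following Seeley, the continuation is \<open>\<Sum>n. c n * g(s, b n * \<surd>(-y))\<close>; it fits to infinite
  order as soon as \<open>\<Sum>n. c n * b n ^ (2 m) = (-1) ^ m\<close> for all \<open>m\<close>. Such coefficients come from the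
  vanishing of a two-sided theta series (\<open>alternating_moments\<close>). The dilations \<open>b n\<close> are unbounded;
  substituting \<open>\<delta> sin w\<close> for \<open>w\<close> first makes \<open>g\<close> periodic, hence all its derivatives bounded.

  The remaining implications are computations. For a cuspidal edge \<open>\<tau> \<circ> f = (s1, s2\<^sup>2, s2\<^sup>3)\<close> the Jacobi
  ideal is generated by \<open>s2\<close>, and the target chart \<open>\<tau>\<close> is adapted and realises order three
  (\<open>cuspidal_edge_invariants\<close>). Conversely, if the lift failed to be an immersion, then
  \<open>\<eta> f3\<close> would be a sum of products \<open>y \<omega>\<close> with \<open>y(a) = \<omega>(a) = (\<eta> \<omega>)(a) = 0\<close>, and the order of \<open>f3\<close> would
  not be three (\<open>adapted_order_three_front\<close>). Tangent surfaces of curves of type (1,2,3) meet the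
  criterion with an explicit field \<open>X\<close> (\<open>tangent_surface_cuspidal_edge\<close>), which ties in condition (1).
\<close>

section \<open>Smooth maps on open sets\<close>

abbreviation der :: "('a::real_normed_vector \<Rightarrow> 'b::real_normed_vector) \<Rightarrow> 'a \<Rightarrow> 'a \<Rightarrow> 'b" where
  "der f x \<equiv> frechet_derivative f (at x)"

definition smooth_on :: "'a::real_normed_vector set \<Rightarrow> ('a \<Rightarrow> 'b::real_normed_vector) \<Rightarrow> bool" where
  "smooth_on U f \<longleftrightarrow> (\<forall>k. Ck_on k U f)"

text \<open>
  Openness of \<open>U\<close> is essential: derivatives at a point of \<open>U\<close> are two-sided and see a whole
  neighbourhood of it.
\<close>

lemma Ck_on_cong:
  assumes "open U" "\<And>x. x \<in> U \<Longrightarrow> f x = g x" "Ck_on k U f"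
  shows "Ck_on k U g"
  using assms(2,3)
proof (induction k arbitrary: f g)
  case 0
  then show ?case by (simp cong: continuous_on_cong)
next
  case (Suc k)
  have d: "(f has_derivative der f x) (at x)" if "x \<in> U" for x
    using Suc.prems(2) that by (auto simp: frechet_derivative_works)
  have d': "(g has_derivative der f x) (at x)" if "x \<in> U" for x
    using d[OF that] \<open>open U\<close> that Suc.prems(1) by (rule has_derivative_transform_within_open)
  have eq: "der f x = der g x" if "x \<in> U" for x
    using d'[OF that] by (rule frechet_derivative_at)
  have "Ck_on k U (\<lambda>x. der f x v)" for v
    using Suc.prems(2) by simp
  then have "Ck_on k U (\<lambda>x. der g x v)" for v
    by (rule Suc.IH[rotated]) (simp add: eq)
  moreover have "g differentiable (at x)" if "x \<in> U" for x
    using d'[OF that] unfolding differentiable_def by blast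
  ultimately show ?case by simp
qed

lemma Ck_on_SucI:
  assumes "open U" "\<And>x. x \<in> U \<Longrightarrow> (f has_derivative f' x) (at x)"
    and "\<And>v. Ck_on k U (\<lambda>x. f' x v)"
  shows "Ck_on (Suc k) U f"
proof -
  have "f' x = der f x" if "x \<in> U" for x
    using assms(2)[OF that] by (rule frechet_derivative_at)
  then have "Ck_on k U (\<lambda>x. der f x v)" for v
    by - (rule Ck_on_cong[OF assms(1) _ assms(3)[of v]], simp)
  moreover have "f differentiable (at x)" if "x \<in> U" for x
    using assms(2)[OF that] unfolding differentiable_def by blast
  ultimately show ?thesis by simp
qed

lemma Ck_on_SucD:
  assumes "Ck_on (Suc k) U f" "x \<in> U"
  shows "(f has_derivative der f x) (at x)"
  using assms by (auto simp: frechet_derivative_works)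

lemma Ck_on_imp_continuous_on: "Ck_on k U f \<Longrightarrow> continuous_on U f"
  by (cases k) (simp_all add: continuous_at_imp_continuous_on differentiable_imp_continuous_within)

lemma Ck_on_mono_Suc: "Ck_on (Suc k) U f \<Longrightarrow> Ck_on k U f"
proof (induction k arbitrary: f)
  case 0
  then show ?case by (simp only: Ck_on.simps(1)) (rule Ck_on_imp_continuous_on)
next
  case (Suc k)
  then show ?case by (auto simp del: Ck_on.simps(1))
qed

lemma Ck_on_subset: "Ck_on k U f \<Longrightarrow> V \<subseteq> U \<Longrightarrow> Ck_on k V f"
  by (induction k arbitrary: f) (auto intro: continuous_on_subset)

lemma Ck_on_const: "open U \<Longrightarrow> Ck_on k U (\<lambda>x. c)"
proof (induction k arbitrary: c)
  case (Suc k)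
  show ?case by (rule Ck_on_SucI[OF Suc.prems has_derivative_const Suc.IH[OF Suc.prems]])
qed auto

lemma Ck_on_linear_comp:
  assumes "open U" "bounded_linear L" "Ck_on k U f"
  shows "Ck_on k U (\<lambda>x. L (f x))"
  using assms(3)
proof (induction k arbitrary: f)
  case 0
  then show ?case by (simp add: bounded_linear.continuous_on[OF assms(2)])
next
  case (Suc k)
  show ?case
    by (rule Ck_on_SucI[OF \<open>open U\<close> bounded_linear.has_derivative[OF assms(2) Ck_on_SucD[OF Suc.prems]]])
      (use Suc in auto)
qed

lemma Ck_on_id: "open U \<Longrightarrow> Ck_on k U (\<lambda>x. x)"
proof (cases k)
  case (Suc n)
  assume "open U"
  then show ?thesis
    unfolding Suc by (intro Ck_on_SucI[OF _ has_derivative_ident Ck_on_const])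
qed simp

lemma Ck_on_add:
  assumes "open U" "Ck_on k U f" "Ck_on k U g"
  shows "Ck_on k U (\<lambda>x. f x + g x)"
  using assms(2,3)
proof (induction k arbitrary: f g)
  case (Suc k)
  show ?case
    by (rule Ck_on_SucI[OF \<open>open U\<close> has_derivative_add[OF Ck_on_SucD[OF Suc.prems(1)] Ck_on_SucD[OF Suc.prems(2)]]])
      (use Suc in auto)
qed (auto intro: continuous_intros)

lemma Ck_on_sum:
  assumes "open U" "\<And>i. i \<in> I \<Longrightarrow> Ck_on k U (f i)"
  shows "Ck_on k U (\<lambda>x. \<Sum>i\<in>I. f i x)"
  using assms(2)
  by (induction I rule: infinite_finite_induct) (auto intro: Ck_on_const Ck_on_add assms(1))

lemma Ck_on_Pair:
  assumes "open U" "Ck_on k U f" "Ck_on k U g"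
  shows "Ck_on k U (\<lambda>x. (f x, g x))"
  using assms(2,3)
proof (induction k arbitrary: f g)
  case (Suc k)
  show ?case
    by (rule Ck_on_SucI[OF \<open>open U\<close> has_derivative_Pair[OF Ck_on_SucD[OF Suc.prems(1)] Ck_on_SucD[OF Suc.prems(2)]]])
      (use Suc in auto)
qed (auto intro: continuous_intros)

lemma Ck_on_scaleR:
  fixes f :: "'a::real_normed_vector \<Rightarrow> real" and g :: "'a \<Rightarrow> 'b::real_normed_vector"
  assumes "open U" "Ck_on k U f" "Ck_on k U g"
  shows "Ck_on k U (\<lambda>x. f x *\<^sub>R g x)"
  using assms(2,3)
proof (induction k arbitrary: f g)
  case (Suc k)
  show ?case
  proof (rule Ck_on_SucI[OF \<open>open U\<close> has_derivative_scaleR[OF Ck_on_SucD[OF Suc.prems(1)] Ck_on_SucD[OF Suc.prems(2)]]])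
    fix v
    show "Ck_on k U (\<lambda>x. f x *\<^sub>R der g x v + der f x v *\<^sub>R g x)"
      using Suc Ck_on_mono_Suc[OF Suc.prems(1)] Ck_on_mono_Suc[OF Suc.prems(2)]
      by (intro Ck_on_add[OF \<open>open U\<close>] Suc.IH) auto
  qed auto
qed (auto intro: continuous_intros)

text \<open>
  The direction in which the outer map is differentiated moves with the point. Expanding it in the
  basis leaves derivatives of the outer map in constant directions, to which the induction
  applies.
\<close>

lemma Ck_on_compose:
  fixes f :: "'a::real_normed_vector \<Rightarrow> 'b::euclidean_space" and g :: "'b \<Rightarrow> 'c::real_normed_vector"
  assumes "open U" "open V" "f ` U \<subseteq> V" "Ck_on k U f" "Ck_on k V g"
  shows "Ck_on k U (\<lambda>x. g (f x))"
  using assms(4,5)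
proof (induction k arbitrary: g)
  case 0
  then show ?case using assms(3) by (auto intro: continuous_on_compose2)
next
  case (Suc k)
  have g: "(g has_derivative der g (f x)) (at (f x))" if "x \<in> U" for x
    by (rule Ck_on_SucD[OF Suc.prems(2)]) (use assms(3) that in blast)
  show ?case
  proof (rule Ck_on_SucI[OF \<open>open U\<close>])
    fix x assume x: "x \<in> U"
    show "((\<lambda>x. g (f x)) has_derivative
        (\<lambda>v. \<Sum>i\<in>Basis. (der f x v \<bullet> i) *\<^sub>R der g (f x) i)) (at x)"
    proof -
      have lin: "linear (der g (f x))"
        using g[OF x] has_derivative_linear by blast
      have "(\<Sum>i\<in>Basis. (w \<bullet> i) *\<^sub>R der g (f x) i) = der g (f x) w" for w
        by (subst (2) euclidean_representation[symmetric]) (simp add: linear_sum[OF lin] linear_scale[OF lin] del: euclidean_representation)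
      then show ?thesis
        using has_derivative_compose[OF Ck_on_SucD[OF Suc.prems(1) x] g[OF x]] by simp
    qed
  next
    fix v
    show "Ck_on k U (\<lambda>x. \<Sum>i\<in>Basis. (der f x v \<bullet> i) *\<^sub>R der g (f x) i)"
      using Suc.prems Ck_on_mono_Suc[OF Suc.prems(1)]
      by (intro Ck_on_sum Ck_on_scaleR \<open>open U\<close> Suc.IH Ck_on_linear_comp[OF _ bounded_linear_inner_left]) auto
  qed
qed

lemma Ck_on_inverse:
  fixes f :: "'a::real_normed_vector \<Rightarrow> real"
  assumes "open U" "\<And>x. x \<in> U \<Longrightarrow> f x \<noteq> 0" "Ck_on k U f"
  shows "Ck_on k U (\<lambda>x. inverse (f x))"
  using assms(3)
proof (induction k)
  case 0
  then show ?case using assms by (auto intro!: continuous_intros)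
next
  case (Suc k)
  have *: "Ck_on k U (\<lambda>x. inverse (f x))" using Suc Ck_on_mono_Suc by blast
  show ?case
  proof (rule Ck_on_SucI[OF \<open>open U\<close>])
    show "((\<lambda>x. inverse (f x)) has_derivative (\<lambda>v. (inverse (f x) * inverse (f x)) *\<^sub>R (- der f x v))) (at x)"
      if "x \<in> U" for x
      using Deriv.has_derivative_inverse[OF _ Ck_on_SucD[OF Suc.prems that]] assms(2)[OF that]
      by (simp add: algebra_simps)
    show "Ck_on k U (\<lambda>x. (inverse (f x) * inverse (f x)) *\<^sub>R (- der f x v))" for v
      using Suc.prems * Ck_on_scaleR[OF \<open>open U\<close> * *]
      by (intro Ck_on_scaleR \<open>open U\<close> Ck_on_linear_comp[OF _ bounded_linear_minus[OF bounded_linear_ident]]) auto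
  qed
qed

lemma Ck_on_sqrt:
  fixes f :: "'a::real_normed_vector \<Rightarrow> real"
  assumes "open U" "\<And>x. x \<in> U \<Longrightarrow> f x > 0" "Ck_on k U f"
  shows "Ck_on k U (\<lambda>x. sqrt (f x))"
  using assms(3)
proof (induction k)
  case 0
  then show ?case using assms by (auto intro!: continuous_intros)
next
  case (Suc k)
  have *: "Ck_on k U (\<lambda>x. sqrt (f x))" using Suc Ck_on_mono_Suc by blast
  show ?case
  proof (rule Ck_on_SucI[OF \<open>open U\<close>])
    show "((\<lambda>x. sqrt (f x)) has_derivative (\<lambda>v. (inverse (2 * sqrt (f x))) *\<^sub>R der f x v)) (at x)"
      if "x \<in> U" for x
      by (rule has_derivative_eq_rhs[OF has_derivative_real_sqrt[OF _ Ck_on_SucD[OF Suc.prems that]]])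
        (use assms(2)[OF that] in \<open>auto simp: field_simps\<close>)
    have "Ck_on k U (\<lambda>x. 2 * sqrt (f x))"
      by (rule Ck_on_linear_comp[OF \<open>open U\<close> bounded_linear_mult_right *])
    then show "Ck_on k U (\<lambda>x. (inverse (2 * sqrt (f x))) *\<^sub>R der f x v)" for v
      using Suc.prems assms(2)
      by (intro Ck_on_scaleR \<open>open U\<close> Ck_on_inverse) (force simp del: Ck_on.simps(1))+
  qed
qed

text \<open>
  Each of the two functions is the derivative of the other, so they are treated in one induction.
\<close>

lemma Ck_on_sin_cos:
  fixes f :: "'a::real_normed_vector \<Rightarrow> real"
  assumes "open U" "Ck_on k U f"
  shows "Ck_on k U (\<lambda>x. sin (f x)) \<and> Ck_on k U (\<lambda>x. cos (f x))"
  using assms(2)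
proof (induction k)
  case 0
  then show ?case by (auto intro!: continuous_intros)
next
  case (Suc k)
  have *: "Ck_on k U (\<lambda>x. sin (f x))" "Ck_on k U (\<lambda>x. cos (f x))" using Suc Ck_on_mono_Suc by blast+
  have "Ck_on (Suc k) U (\<lambda>x. sin (f x))"
  proof (rule Ck_on_SucI[where f' = "\<lambda>x v. cos (f x) *\<^sub>R der f x v", OF \<open>open U\<close>])
    show "Ck_on k U (\<lambda>x. cos (f x) *\<^sub>R der f x v)" for v
      using Suc.prems * by (intro Ck_on_scaleR \<open>open U\<close>) auto
  qed (auto intro!: derivative_eq_intros Ck_on_SucD[OF Suc.prems])
  moreover have "Ck_on (Suc k) U (\<lambda>x. cos (f x))"
  proof (rule Ck_on_SucI[where f' = "\<lambda>x v. sin (f x) *\<^sub>R (- der f x v)", OF \<open>open U\<close>])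
    show "Ck_on k U (\<lambda>x. sin (f x) *\<^sub>R (- der f x v))" for v
      using Suc.prems *
      by (intro Ck_on_scaleR \<open>open U\<close> Ck_on_linear_comp[OF _ bounded_linear_minus[OF bounded_linear_ident]]) auto
  qed (auto intro!: derivative_eq_intros Ck_on_SucD[OF Suc.prems])
  ultimately show ?case by blast
qed

lemma smooth_onD: "smooth_on U f \<Longrightarrow> x \<in> U \<Longrightarrow> (f has_derivative der f x) (at x)"
  unfolding smooth_on_def using Ck_on_SucD by blast

lemma smooth_on_frechet: "smooth_on U f \<Longrightarrow> smooth_on U (\<lambda>x. der f x v)"
  unfolding smooth_on_def using Ck_on.simps(2) by blast

lemma smooth_on_continuous: "smooth_on U f \<Longrightarrow> continuous_on U f"
  unfolding smooth_on_def using Ck_on_imp_continuous_on by blast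

lemma smooth_on_cong: "smooth_on U f \<Longrightarrow> open U \<Longrightarrow> (\<And>x. x \<in> U \<Longrightarrow> f x = g x) \<Longrightarrow> smooth_on U g"
  unfolding smooth_on_def using Ck_on_cong by blast

lemma smooth_on_subset: "smooth_on U f \<Longrightarrow> V \<subseteq> U \<Longrightarrow> smooth_on V f"
  unfolding smooth_on_def using Ck_on_subset by blast

named_theorems smooth_intros

lemma smooth_on_const [smooth_intros]: "open U \<Longrightarrow> smooth_on U (\<lambda>x. c)"
  unfolding smooth_on_def using Ck_on_const by blast

lemma smooth_on_id [smooth_intros]: "open U \<Longrightarrow> smooth_on U (\<lambda>x. x)"
  unfolding smooth_on_def using Ck_on_id by blast

lemma smooth_on_linear_comp:
  "bounded_linear L \<Longrightarrow> open U \<Longrightarrow> smooth_on U f \<Longrightarrow> smooth_on U (\<lambda>x. L (f x))"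
  unfolding smooth_on_def using Ck_on_linear_comp by blast

lemmas smooth_on_fst [smooth_intros] = smooth_on_linear_comp[OF bounded_linear_fst]
lemmas smooth_on_snd [smooth_intros] = smooth_on_linear_comp[OF bounded_linear_snd]
lemmas smooth_on_minus [smooth_intros] = smooth_on_linear_comp[OF bounded_linear_minus[OF bounded_linear_ident]]
lemma smooth_on_add [smooth_intros]: "open U \<Longrightarrow> smooth_on U f \<Longrightarrow> smooth_on U g \<Longrightarrow> smooth_on U (\<lambda>x. f x + g x)"
  unfolding smooth_on_def using Ck_on_add by blast

lemma smooth_on_diff [smooth_intros]: "open U \<Longrightarrow> smooth_on U f \<Longrightarrow> smooth_on U g \<Longrightarrow> smooth_on U (\<lambda>x. f x - g x)"
  using smooth_on_add[OF _ _ smooth_on_minus, of U f g] by simp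

lemma smooth_on_sum [smooth_intros]: "open U \<Longrightarrow> (\<And>i. i \<in> I \<Longrightarrow> smooth_on U (f i)) \<Longrightarrow> smooth_on U (\<lambda>x. \<Sum>i\<in>I. f i x)"
  unfolding smooth_on_def by (blast intro: Ck_on_sum)

lemma smooth_on_Pair [smooth_intros]: "open U \<Longrightarrow> smooth_on U f \<Longrightarrow> smooth_on U g \<Longrightarrow> smooth_on U (\<lambda>x. (f x, g x))"
  unfolding smooth_on_def using Ck_on_Pair by blast

lemma smooth_on_scaleR [smooth_intros]: "open U \<Longrightarrow> smooth_on U f \<Longrightarrow> smooth_on U g \<Longrightarrow> smooth_on U (\<lambda>x. f x *\<^sub>R g x)"
  unfolding smooth_on_def using Ck_on_scaleR by blast

lemma smooth_on_mult [smooth_intros]: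
  fixes f g :: "'a::real_normed_vector \<Rightarrow> real"
  shows "open U \<Longrightarrow> smooth_on U f \<Longrightarrow> smooth_on U g \<Longrightarrow> smooth_on U (\<lambda>x. f x * g x)"
  using smooth_on_scaleR[of U f g] by simp

lemma smooth_on_power [smooth_intros]:
  fixes f :: "'a::real_normed_vector \<Rightarrow> real"
  shows "open U \<Longrightarrow> smooth_on U f \<Longrightarrow> smooth_on U (\<lambda>x. f x ^ n)"
  by (induction n) (auto intro: smooth_on_const smooth_on_mult)

lemma smooth_on_inverse [smooth_intros]:
  fixes f :: "'a::real_normed_vector \<Rightarrow> real"
  shows "open U \<Longrightarrow> (\<And>x. x \<in> U \<Longrightarrow> f x \<noteq> 0) \<Longrightarrow> smooth_on U f \<Longrightarrow> smooth_on U (\<lambda>x. inverse (f x))"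
  unfolding smooth_on_def using Ck_on_inverse by blast

lemma smooth_on_sqrt [smooth_intros]:
  "open U \<Longrightarrow> (\<And>x. x \<in> U \<Longrightarrow> f x > 0) \<Longrightarrow> smooth_on U f \<Longrightarrow> smooth_on U (\<lambda>x. sqrt (f x))"
  unfolding smooth_on_def using Ck_on_sqrt by blast

lemma smooth_on_sin [smooth_intros]:
  fixes f :: "'a::real_normed_vector \<Rightarrow> real"
  shows "open U \<Longrightarrow> smooth_on U f \<Longrightarrow> smooth_on U (\<lambda>x. sin (f x))"
  unfolding smooth_on_def using Ck_on_sin_cos by blast

lemma smooth_on_compose:
  fixes f :: "'a::real_normed_vector \<Rightarrow> 'b::euclidean_space"
  shows "smooth_on V g \<Longrightarrow> open U \<Longrightarrow> open V \<Longrightarrow> smooth_on U f \<Longrightarrow> f ` U \<subseteq> V \<Longrightarrow> smooth_on U (\<lambda>x. g (f x))"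
  unfolding smooth_on_def using Ck_on_compose by blast

lemma smooth_on_vec_lambda [smooth_intros]:
  fixes f :: "'n::finite \<Rightarrow> 'a::real_normed_vector \<Rightarrow> real"
  assumes "open U" "\<And>i. smooth_on U (f i)"
  shows "smooth_on U (\<lambda>x. \<chi> i. f i x)"
proof -
  have "(\<lambda>x. \<chi> i. f i x) = (\<lambda>x. \<Sum>i\<in>UNIV. f i x *\<^sub>R (axis i 1 :: real^'n))"
    by (intro ext, subst basis_expansion[symmetric]) (simp add: scalar_mult_eq_scaleR)
  moreover have "smooth_on U (\<lambda>x. \<Sum>i\<in>UNIV. f i x *\<^sub>R (axis i 1 :: real^'n))"
    by (intro smooth_intros assms)
  ultimately show ?thesis by simp
qed

lemma smooth_on_vector2 [smooth_intros]:
  fixes f g :: "'a::real_normed_vector \<Rightarrow> real"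
  assumes "open U" "smooth_on U f" "smooth_on U g"
  shows "smooth_on U (\<lambda>x. vector [f x, g x] :: real^2)"
proof -
  have "(\<lambda>x. vector [f x, g x] :: real^2) = (\<lambda>x. \<chi> i. if i = 1 then f x else g x)"
    by (auto simp: vec_eq_iff forall_2)
  moreover have "smooth_on U (\<lambda>x. \<chi> i::2. if i = 1 then f x else g x)"
  proof (rule smooth_on_vec_lambda)
    show "smooth_on U (\<lambda>x. if i = 1 then f x else g x)" for i :: 2
      by (cases "i = 1") (use assms in simp_all)
  qed fact
  ultimately show ?thesis by simp
qed

lemma smooth_on_vector3 [smooth_intros]:
  fixes f g h :: "'a::real_normed_vector \<Rightarrow> real"
  assumes "open U" "smooth_on U f" "smooth_on U g" "smooth_on U h"
  shows "smooth_on U (\<lambda>x. vector [f x, g x, h x] :: real^3)"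
proof -
  have "(\<lambda>x. vector [f x, g x, h x] :: real^3) = (\<lambda>x. \<chi> i. if i = 1 then f x else if i = 2 then g x else h x)"
    by (auto simp: vec_eq_iff forall_3)
  moreover have "smooth_on U (\<lambda>x. \<chi> i::3. if i = 1 then f x else if i = 2 then g x else h x)"
  proof (rule smooth_on_vec_lambda)
    show "smooth_on U (\<lambda>x. if i = 1 then f x else if i = 2 then g x else h x)" for i :: 3
      by (cases "i = 1"; cases "i = 2") (use assms in simp_all)
  qed fact
  ultimately show ?thesis by simp
qed

section \<open>Smooth germs, diffeomorphism germs and A-equivalence\<close>

lemma smooth_germ_iff: "smooth_germ a f \<longleftrightarrow> (\<exists>U. open U \<and> a \<in> U \<and> smooth_on U f)"
  by (simp add: smooth_germ_def smooth_on_def)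

lemma smooth_germI: "smooth_on U f \<Longrightarrow> open U \<Longrightarrow> a \<in> U \<Longrightarrow> smooth_germ a f"
  unfolding smooth_germ_iff by blast

lemma smooth_germE:
  assumes "smooth_germ a f" obtains U where "open U" "a \<in> U" "smooth_on U f"
  using assms unfolding smooth_germ_iff by blast

text \<open>
  Transfers a closure property from open sets to germs by passing to a common neighbourhood.
\<close>

lemma smooth_germ_lift2:
  assumes "\<And>U. open U \<Longrightarrow> smooth_on U f \<Longrightarrow> smooth_on U g \<Longrightarrow> smooth_on U h"
    and "smooth_germ a f" "smooth_germ a g"
  shows "smooth_germ a h"
proof -
  obtain U V where "open U" "a \<in> U" "smooth_on U f" "open V" "a \<in> V" "smooth_on V g"
    using assms(2,3) by (meson smooth_germE)
  then show ?thesis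
    by (intro smooth_germI[of "U \<inter> V"] assms(1)) (auto intro: smooth_on_subset)
qed

lemma smooth_germ_lift1:
  assumes "\<And>U. open U \<Longrightarrow> smooth_on U f \<Longrightarrow> smooth_on U h" and "smooth_germ a f"
  shows "smooth_germ a h"
  using assms smooth_germ_lift2 by blast

named_theorems germ_intros

lemma smooth_germ_const [germ_intros]: "smooth_germ a (\<lambda>x. c)"
  by (rule smooth_germI[of UNIV]) (auto intro: smooth_intros)

lemma smooth_germ_id [germ_intros]: "smooth_germ a (\<lambda>x. x)"
  by (rule smooth_germI[of UNIV]) (auto intro: smooth_intros)

lemma smooth_germ_linear_comp: "bounded_linear L \<Longrightarrow> smooth_germ a f \<Longrightarrow> smooth_germ a (\<lambda>x. L (f x))"
  by (erule smooth_germ_lift1[rotated]) (rule smooth_on_linear_comp)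

lemmas smooth_germ_fst [germ_intros] = smooth_germ_linear_comp[OF bounded_linear_fst]
lemmas smooth_germ_snd [germ_intros] = smooth_germ_linear_comp[OF bounded_linear_snd]
lemmas smooth_germ_minus [germ_intros] = smooth_germ_linear_comp[OF bounded_linear_minus[OF bounded_linear_ident]]
lemmas smooth_germ_vec_nth [germ_intros] = smooth_germ_linear_comp[OF bounded_linear_vec_nth]
lemmas smooth_germ_inner_left [germ_intros] = smooth_germ_linear_comp[OF bounded_linear_inner_left]
lemmas smooth_germ_inner_right [germ_intros] = smooth_germ_linear_comp[OF bounded_linear_inner_right]

lemma smooth_germ_add [germ_intros]: "smooth_germ a f \<Longrightarrow> smooth_germ a g \<Longrightarrow> smooth_germ a (\<lambda>x. f x + g x)"
  by (rule smooth_germ_lift2) (rule smooth_on_add)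

lemma smooth_germ_diff [germ_intros]: "smooth_germ a f \<Longrightarrow> smooth_germ a g \<Longrightarrow> smooth_germ a (\<lambda>x. f x - g x)"
  by (rule smooth_germ_lift2) (rule smooth_on_diff)

lemma smooth_germ_scaleR [germ_intros]:
  "smooth_germ a f \<Longrightarrow> smooth_germ a g \<Longrightarrow> smooth_germ a (\<lambda>x. f x *\<^sub>R g x)"
  by (rule smooth_germ_lift2) (rule smooth_on_scaleR)

lemma smooth_germ_mult [germ_intros]:
  fixes f g :: "'a::real_normed_vector \<Rightarrow> real"
  shows "smooth_germ a f \<Longrightarrow> smooth_germ a g \<Longrightarrow> smooth_germ a (\<lambda>x. f x * g x)"
  by (rule smooth_germ_lift2) (rule smooth_on_mult)

lemma smooth_germ_power [germ_intros]:
  fixes f :: "'a::real_normed_vector \<Rightarrow> real"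
  shows "smooth_germ a f \<Longrightarrow> smooth_germ a (\<lambda>x. f x ^ n)"
  by (erule smooth_germ_lift1[rotated]) (rule smooth_on_power)

lemma smooth_germ_Pair [germ_intros]:
  "smooth_germ a f \<Longrightarrow> smooth_germ a g \<Longrightarrow> smooth_germ a (\<lambda>x. (f x, g x))"
  by (rule smooth_germ_lift2) (rule smooth_on_Pair)

lemma smooth_germ_vector2 [germ_intros]:
  fixes f g :: "'a::real_normed_vector \<Rightarrow> real"
  shows "smooth_germ a f \<Longrightarrow> smooth_germ a g \<Longrightarrow> smooth_germ a (\<lambda>x. vector [f x, g x] :: real^2)"
  by (rule smooth_germ_lift2) (rule smooth_on_vector2)

lemma smooth_germ_vector3 [germ_intros]:
  fixes f g h :: "'a::real_normed_vector \<Rightarrow> real"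
  assumes "smooth_germ a f" "smooth_germ a g" "smooth_germ a h"
  shows "smooth_germ a (\<lambda>x. vector [f x, g x, h x] :: real^3)"
proof (rule smooth_germ_lift2[OF _ smooth_germ_Pair[OF assms(1,2)] assms(3)])
  fix U assume "open U" "smooth_on U (\<lambda>x. (f x, g x))" "smooth_on U h"
  then show "smooth_on U (\<lambda>x. vector [f x, g x, h x] :: real^3)"
    using smooth_on_fst[of U "\<lambda>x. (f x, g x)"] smooth_on_snd[of U "\<lambda>x. (f x, g x)"]
    by (intro smooth_on_vector3) auto
qed

lemma smooth_germ_sum [germ_intros]:
  assumes "\<And>i. i \<in> I \<Longrightarrow> smooth_germ a (f i)"
  shows "smooth_germ a (\<lambda>x. \<Sum>i\<in>I. f i x)"
  using assms by (induction I rule: infinite_finite_induct) (auto intro: germ_intros)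

lemma smooth_germ_compose:
  fixes f :: "'a::real_normed_vector \<Rightarrow> 'b::euclidean_space"
  assumes "smooth_germ b g" "f a = b" "smooth_germ a f"
  shows "smooth_germ a (\<lambda>x. g (f x))"
proof -
  obtain U V where U: "open U" "a \<in> U" "smooth_on U f" and V: "open V" "b \<in> V" "smooth_on V g"
    using assms by (meson smooth_germE)
  have o: "open (U \<inter> f -` V)"
    using continuous_open_preimage[OF smooth_on_continuous] U V by blast
  have "smooth_on (U \<inter> f -` V) (\<lambda>x. g (f x))"
    by (rule smooth_on_compose[OF V(3) o V(1) smooth_on_subset[OF U(3)]]) auto
  then show ?thesis
    using o U V assms(2) by (intro smooth_germI[of "U \<inter> f -` V"]) auto
qed

lemma smooth_germ_inverse [germ_intros]:
  fixes f :: "'a::real_normed_vector \<Rightarrow> real"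
  assumes "smooth_germ a f" "f a \<noteq> 0"
  shows "smooth_germ a (\<lambda>x. inverse (f x))"
  by (rule smooth_germ_compose[OF _ refl assms(1)], rule smooth_germI[of "-{0}"])
    (use assms(2) in \<open>auto intro!: smooth_intros\<close>)

lemma smooth_germ_sqrt [germ_intros]:
  fixes f :: "'a::real_normed_vector \<Rightarrow> real"
  assumes "smooth_germ a f" "f a > 0"
  shows "smooth_germ a (\<lambda>x. sqrt (f x))"
  by (rule smooth_germ_compose[OF _ refl assms(1)], rule smooth_germI[of "{0<..}"])
    (use assms(2) in \<open>auto intro!: smooth_intros\<close>)

lemma smooth_germ_divide [germ_intros]:
  fixes f g :: "'a::real_normed_vector \<Rightarrow> real"
  shows "smooth_germ a f \<Longrightarrow> smooth_germ a g \<Longrightarrow> g a \<noteq> 0 \<Longrightarrow> smooth_germ a (\<lambda>x. f x / g x)"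
  unfolding divide_inverse by (intro germ_intros)

lemma smooth_germ_frechet [germ_intros]:
  "smooth_germ a f \<Longrightarrow> smooth_germ a (\<lambda>x. der f x v)"
  by (erule smooth_germ_lift1[rotated]) (rule smooth_on_frechet)

lemma smooth_germ_eventually_derivative:
  assumes "smooth_germ a f"
  shows "\<forall>\<^sub>F x in nhds a. (f has_derivative der f x) (at x)"
  using assms unfolding smooth_germ_iff eventually_nhds by (meson smooth_onD)

lemma smooth_germ_derivative:
  "smooth_germ a f \<Longrightarrow> (f has_derivative der f a) (at a)"
  using smooth_germ_eventually_derivative eventually_nhds_x_imp_x by blast

lemma smooth_germ_isCont: "smooth_germ a f \<Longrightarrow> isCont f a"
  using smooth_germ_derivative has_derivative_continuous by blast

lemma smooth_germ_tendsto: "smooth_germ a f \<Longrightarrow> (f \<longlongrightarrow> f a) (nhds a)"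
  using smooth_germ_isCont isCont_def tendsto_nhds_iff by blast

lemma smooth_germ_eventually_smooth:
  assumes "smooth_germ a f" shows "\<forall>\<^sub>F x in nhds a. smooth_germ x f"
  using assms unfolding smooth_germ_iff eventually_nhds by blast

lemma frechet_derivative_germ_cong:
  assumes "\<forall>\<^sub>F x in nhds a. f x = g x"
  shows "der f a = der g a"
proof -
  have "(f has_derivative D) (at a) \<longleftrightarrow> (g has_derivative D) (at a)" for D
  proof -
    obtain U where U: "open U" "a \<in> U" "\<And>x. x \<in> U \<Longrightarrow> f x = g x"
      using assms unfolding eventually_nhds by blast
    then show ?thesis
      by (metis has_derivative_transform_within_open)
  qed
  then show ?thesis unfolding frechet_derivative_def by simp
qed

lemma eventually_frechet_derivative_cong:
  assumes "\<forall>\<^sub>F x in nhds a. f x = g x"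
  shows "\<forall>\<^sub>F x in nhds a. der f x = der g x"
proof -
  have "\<forall>\<^sub>F x in nhds a. \<forall>\<^sub>F y in nhds x. f y = g y"
    using assms by (simp only: eventually_eventually)
  then show ?thesis
    by (rule eventually_mono) (rule frechet_derivative_germ_cong)
qed

lemma smooth_germ_cong:
  assumes "smooth_germ a f" "\<forall>\<^sub>F x in nhds a. f x = g x"
  shows "smooth_germ a g"
proof -
  obtain U where U: "open U" "a \<in> U" "smooth_on U f"
    using smooth_germE[OF assms(1)] .
  obtain V where V: "open V" "a \<in> V" "\<And>x. x \<in> V \<Longrightarrow> f x = g x"
    using assms(2) unfolding eventually_nhds by blast
  have "smooth_on (U \<inter> V) g"
    by (rule smooth_on_cong[OF smooth_on_subset[OF U(3)]]) (use U V in auto)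
  then show ?thesis
    using U V by (intro smooth_germI[of "U \<inter> V"]) auto
qed

lemma frechet_linear: "smooth_germ a f \<Longrightarrow> linear (der f a)"
  using smooth_germ_derivative has_derivative_linear by blast

text \<open>
  For a variable direction \<open>X x\<close> smoothness follows by expanding \<open>X x\<close> in the basis.
\<close>

lemma smooth_germ_frechet_field [germ_intros]:
  fixes f :: "'a::euclidean_space \<Rightarrow> 'b::real_normed_vector"
  assumes "smooth_germ a f" "smooth_germ a X"
  shows "smooth_germ a (\<lambda>x. der f x (X x))"
proof (rule smooth_germ_cong)
  show "smooth_germ a (\<lambda>x. \<Sum>i\<in>Basis. (X x \<bullet> i) *\<^sub>R der f x i)"
    by (intro germ_intros assms)
  show "\<forall>\<^sub>F x in nhds a. (\<Sum>i\<in>Basis. (X x \<bullet> i) *\<^sub>R der f x i) = der f x (X x)"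
    using smooth_germ_eventually_smooth[OF assms(1)]
  proof (rule eventually_mono)
    fix x assume "smooth_germ x f"
    then have lin: "linear (der f x)" by (rule frechet_linear)
    show "(\<Sum>i\<in>Basis. (X x \<bullet> i) *\<^sub>R der f x i) = der f x (X x)"
      by (subst (3) euclidean_representation[symmetric]) (simp add: linear_sum[OF lin] linear_scale[OF lin] del: euclidean_representation)
  qed
qed

lemma frechet_derivative_compose:
  assumes "smooth_germ a f" "smooth_germ (f a) g"
  shows "der (\<lambda>x. g (f x)) a v = der g (f a) (der f a v)"
  using frechet_derivative_at[OF has_derivative_compose[OF smooth_germ_derivative[OF assms(1)] smooth_germ_derivative[OF assms(2)]]]
  by metis

lemma eventually_compose_germ:
  assumes "\<forall>\<^sub>F y in nhds b. P y" "smooth_germ a f" "f a = b"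
  shows "\<forall>\<^sub>F x in nhds a. P (f x)"
  using smooth_germ_tendsto[OF assms(2)] assms(1,3) by (simp add: filterlim_iff)

lemma diffeo_germ_smooth: "diffeo_germ \<sigma> a b \<Longrightarrow> smooth_germ a \<sigma>"
  and diffeo_germ_base: "diffeo_germ \<sigma> a b \<Longrightarrow> \<sigma> a = b"
  by (auto simp: diffeo_germ_def)

lemma diffeo_germE:
  assumes "diffeo_germ \<sigma> a b"
  obtains \<rho> where "diffeo_germ \<rho> b a" "\<forall>\<^sub>F x in nhds a. \<rho> (\<sigma> x) = x" "\<forall>\<^sub>F y in nhds b. \<sigma> (\<rho> y) = y"
  using assms unfolding diffeo_germ_def by blast

lemma diffeo_germ_compose:
  fixes \<sigma> :: "'a::real_normed_vector \<Rightarrow> 'b::euclidean_space" and \<tau> :: "'b \<Rightarrow> 'c::real_normed_vector"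
  assumes "diffeo_germ \<sigma> a b" "diffeo_germ \<tau> b c"
  shows "diffeo_germ (\<lambda>x. \<tau> (\<sigma> x)) a c"
proof -
  obtain \<rho> where \<rho>: "smooth_germ b \<rho>" "\<rho> b = a" "\<forall>\<^sub>F x in nhds a. \<rho> (\<sigma> x) = x" "\<forall>\<^sub>F y in nhds b. \<sigma> (\<rho> y) = y"
    using assms(1) unfolding diffeo_germ_def by blast
  obtain \<pi> where \<pi>: "smooth_germ c \<pi>" "\<pi> c = b" "\<forall>\<^sub>F x in nhds b. \<pi> (\<tau> x) = x" "\<forall>\<^sub>F y in nhds c. \<tau> (\<pi> y) = y"
    using assms(2) unfolding diffeo_germ_def by blast
  note s = diffeo_germ_smooth[OF assms(1)] diffeo_germ_base[OF assms(1)]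
    diffeo_germ_smooth[OF assms(2)] diffeo_germ_base[OF assms(2)]
  show ?thesis unfolding diffeo_germ_def
  proof (intro conjI exI[of _ "\<lambda>y. \<rho> (\<pi> y)"])
    show "smooth_germ a (\<lambda>x. \<tau> (\<sigma> x))" using smooth_germ_compose[OF s(3) s(2) s(1)] .
    show "smooth_germ c (\<lambda>x. \<rho> (\<pi> x))" using smooth_germ_compose[OF \<rho>(1) \<pi>(2) \<pi>(1)] .
    show "\<forall>\<^sub>F x in nhds a. \<rho> (\<pi> (\<tau> (\<sigma> x))) = x"
      using eventually_compose_germ[OF \<pi>(3) s(1,2)] \<rho>(3) by eventually_elim simp
    show "\<forall>\<^sub>F x in nhds c. \<tau> (\<sigma> (\<rho> (\<pi> x))) = x"
      using eventually_compose_germ[OF \<rho>(4) \<pi>(1,2)] \<pi>(4) by eventually_elim simp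
  qed (use s \<rho> \<pi> in auto)
qed

lemma diffeo_germ_derivative_inverse:
  assumes "diffeo_germ \<sigma> a b" "diffeo_germ \<rho> b a" "\<forall>\<^sub>F x in nhds a. \<rho> (\<sigma> x) = x"
  shows "der \<rho> b (der \<sigma> a v) = v"
proof -
  have "der (\<lambda>x. \<rho> (\<sigma> x)) a = der (\<lambda>x. x) a"
    using assms(3) by (rule frechet_derivative_germ_cong)
  then show ?thesis
    using frechet_derivative_compose[of a \<sigma> \<rho> v] diffeo_germ_smooth[OF assms(1)] diffeo_germ_smooth[OF assms(2)]
      diffeo_germ_base[OF assms(1)]
    by simp
qed

lemma diffeo_germ_derivative_bij:
  assumes "diffeo_germ \<sigma> a b" shows "bij (der \<sigma> a)"
proof -
  obtain \<rho> where \<rho>: "diffeo_germ \<rho> b a" "\<forall>\<^sub>F x in nhds a. \<rho> (\<sigma> x) = x" "\<forall>\<^sub>F y in nhds b. \<sigma> (\<rho> y) = y"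
    using diffeo_germE[OF assms] .
  show ?thesis
    using diffeo_germ_derivative_inverse[OF assms \<rho>(1,2)] diffeo_germ_derivative_inverse[OF \<rho>(1) assms \<rho>(3)]
    by (intro o_bij[of "der \<rho> b"]) (auto simp: fun_eq_iff)
qed

lemma diffeo_germ_linear:
  assumes "linear L" "linear M" "\<And>x. M (L x) = x" "\<And>y. L (M y) = y"
  fixes c :: "'a::euclidean_space" and d :: "'b::euclidean_space"
  assumes "L c = d"
  shows "diffeo_germ L c d"
proof -
  have "smooth_germ x L" "smooth_germ y M" for x y
    using smooth_germ_linear_comp[OF _ smooth_germ_id] assms(1,2) linear_conv_bounded_linear by blast+
  then show ?thesis using assms unfolding diffeo_germ_def by (intro conjI exI[of _ M]) auto
qed

lemma diffeo_germ_translation: "diffeo_germ (\<lambda>x. x - c) a (a - c)"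
  unfolding diffeo_germ_def
  by (intro conjI exI[of _ "\<lambda>x. x + c"] smooth_germ_add smooth_germ_diff smooth_germ_id smooth_germ_const) auto

lemma A_equivalent_trans:
  fixes f :: "real^'n \<Rightarrow> real^'m"
  assumes "A_equivalent f a g b" "A_equivalent g b h c"
  shows "A_equivalent f a h c"
proof -
  obtain \<sigma> \<tau> where s: "diffeo_germ \<sigma> a b" "diffeo_germ \<tau> (f a) (g b)" "\<forall>\<^sub>F t in nhds a. \<tau> (f t) = g (\<sigma> t)"
    using assms(1) unfolding A_equivalent_def by blast
  obtain \<sigma>' \<tau>' where s': "diffeo_germ \<sigma>' b c" "diffeo_germ \<tau>' (g b) (h c)" "\<forall>\<^sub>F t in nhds b. \<tau>' (g t) = h (\<sigma>' t)"
    using assms(2) unfolding A_equivalent_def by blast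
  have "\<forall>\<^sub>F t in nhds a. \<tau>' (\<tau> (f t)) = h (\<sigma>' (\<sigma> t))"
    using s(3) eventually_compose_germ[OF s'(3) diffeo_germ_smooth[OF s(1)] diffeo_germ_base[OF s(1)]]
    by eventually_elim simp
  then show ?thesis
    unfolding A_equivalent_def using diffeo_germ_compose[OF s(1) s'(1)] diffeo_germ_compose[OF s(2) s'(2)] by blast
qed

text \<open>
  The inverse of \<open>\<tau>\<close> undoes \<open>\<tau>\<close> only near \<open>f a\<close>; the values of \<open>f\<close> stay there because \<open>f\<close> is
  continuous.
\<close>

lemma A_equivalent_sym:
  fixes f :: "real^'n \<Rightarrow> real^'m"
  assumes "A_equivalent f a g b" "smooth_germ a f"
  shows "A_equivalent g b f a"
proof -
  obtain \<sigma> \<tau> where s: "diffeo_germ \<sigma> a b" "diffeo_germ \<tau> (f a) (g b)" "\<forall>\<^sub>F t in nhds a. \<tau> (f t) = g (\<sigma> t)"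
    using assms(1) unfolding A_equivalent_def by blast
  obtain \<rho> where \<rho>: "diffeo_germ \<rho> b a" "\<forall>\<^sub>F x in nhds a. \<rho> (\<sigma> x) = x" "\<forall>\<^sub>F y in nhds b. \<sigma> (\<rho> y) = y"
    using diffeo_germE[OF s(1)] .
  obtain \<pi> where \<pi>: "diffeo_germ \<pi> (g b) (f a)" "\<forall>\<^sub>F x in nhds (f a). \<pi> (\<tau> x) = x"
    using diffeo_germE[OF s(2)] .
  have "\<forall>\<^sub>F t in nhds a. \<pi> (\<tau> (f t)) = f t"
    using eventually_compose_germ[OF \<pi>(2) assms(2) refl] .
  then have "\<forall>\<^sub>F t in nhds a. \<pi> (g (\<sigma> t)) = f t"
    using s(3) by eventually_elim simp
  then have "\<forall>\<^sub>F t in nhds b. \<pi> (g (\<sigma> (\<rho> t))) = f (\<rho> t)"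
    using eventually_compose_germ diffeo_germ_smooth[OF \<rho>(1)] diffeo_germ_base[OF \<rho>(1)] by blast
  then have "\<forall>\<^sub>F t in nhds b. \<pi> (g t) = f (\<rho> t)"
    using \<rho>(3) by eventually_elim simp
  then show ?thesis
    unfolding A_equivalent_def using \<rho>(1) \<pi>(1) by blast
qed

section \<open>The smooth inverse function theorem in the plane\<close>

lemma linear_prod_expand:
  assumes "linear (L :: real \<times> real \<Rightarrow> 'b::real_vector)"
  shows "L v = fst v *\<^sub>R L (1, 0) + snd v *\<^sub>R L (0, 1)"
proof -
  have "v = fst v *\<^sub>R (1, 0) + snd v *\<^sub>R (0, 1)" by (cases v) simp
  then show ?thesis by (metis linear_add[OF assms] linear_scale[OF assms])
qed

lemma inv_plane_linear:
  fixes L :: "real \<times> real \<Rightarrow> real \<times> real"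
  assumes L: "linear L" "bij L"
  defines "d \<equiv> fst (L (1,0)) * snd (L (0,1)) - fst (L (0,1)) * snd (L (1,0))"
  shows "d \<noteq> 0"
    and "inv L v = ((snd (L (0,1)) * fst v - fst (L (0,1)) * snd v) / d,
                    (fst (L (1,0)) * snd v - snd (L (1,0)) * fst v) / d)"
proof -
  obtain a c b e where L10: "L (1,0) = (a, c)" and L01: "L (0,1) = (b, e)"
    by (metis surj_pair)
  have L_eq: "L v = (fst v * a + snd v * b, fst v * c + snd v * e)" for v
    using linear_prod_expand[OF L(1), of v] by (simp add: L10 L01)
  have d_eq: "d = a * e - b * c" by (simp add: d_def L10 L01)
  have inj: "L v = L w \<Longrightarrow> v = w" for v w using L(2) by (metis bij_pointE)
  show d: "d \<noteq> 0"
  proof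
    assume "d = 0"
    then have "L (e, - c) = L (0, 0)" "L (- b, a) = L (0, 0)"
      unfolding L_eq d_eq by (simp_all add: algebra_simps)
    then have "(e, - c) = (0, 0)" "(- b, a) = (0, 0)"
      using inj by blast+
    then have "L (1,0) = L (0,0)" unfolding L_eq by simp
    then have "(1::real, 0::real) = (0, 0)" by (rule inj)
    then show False by simp
  qed
  show "inv L v = ((snd (L (0,1)) * fst v - fst (L (0,1)) * snd v) / d,
                    (fst (L (1,0)) * snd v - snd (L (1,0)) * fst v) / d)"
  proof -
    let ?w = "((e * fst v - b * snd v) / d, (a * snd v - c * fst v) / d)"
    have "((e * fst v - b * snd v) / d) * a + ((a * snd v - c * fst v) / d) * b = ((a * e - b * c) * fst v) / d"
      "((e * fst v - b * snd v) / d) * c + ((a * snd v - c * fst v) / d) * e = ((a * e - b * c) * snd v) / d"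
      by (simp_all add: algebra_simps diff_divide_distrib add_divide_distrib)
    then have "L ?w = v"
      using d unfolding L_eq by (simp add: d_eq[symmetric])
    then show ?thesis using L(2) unfolding L10 L01 by (metis bij_inv_eq_iff fst_conv snd_conv)
  qed
qed

text \<open>
  The library theorem provides a differentiable inverse \<open>g\<close>. By Cramer's rule its derivative is a
  rational expression in the partial derivatives of \<open>F\<close> at \<open>g y\<close>, so \<open>g\<close> gains one degree of
  differentiability at a time.
\<close>

theorem inverse_function_smooth:
  fixes F :: "real \<times> real \<Rightarrow> real \<times> real"
  assumes F: "smooth_germ p F" and inj: "inj (der F p)"
  shows "diffeo_germ F p (F p)"
proof -
  obtain U where U: "open U" "p \<in> U" "smooth_on U F" using smooth_germE[OF F] .
  define F' where "F' x = Blinfun (der F x)" for x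
  have bl: "bounded_linear (der F x)" if "x \<in> U" for x
    using smooth_onD[OF U(3) that] has_derivative_bounded_linear by blast
  have F': "blinfun_apply (F' x) = der F x" if "x \<in> U" for x
    unfolding F'_def using bounded_linear_Blinfun_apply[OF bl[OF that]] .
  have lin: "linear (der F p)"
    using smooth_onD[OF U(3,2)] has_derivative_linear by blast
  obtain M where M: "linear M" "M \<circ> der F p = id"
    using linear_injective_left_inverse[OF lin inj] by blast
  have "bounded_linear M" using M(1) linear_conv_bounded_linear by blast
  have M': "Blinfun M o\<^sub>L F' p = id_blinfun"
    using M(2) by (intro blinfun_eqI)
      (simp add: bounded_linear_Blinfun_apply[OF \<open>bounded_linear M\<close>] F'[OF U(2)] fun_eq_iff del: split_paired_All)
  have cont: "continuous_on U F'"
  proof (rule continuous_on_blinfun_componentwise)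
    fix i :: "real \<times> real"
    have "continuous_on U (\<lambda>x. der F x i)"
      by (intro smooth_on_continuous smooth_on_frechet U)
    then show "continuous_on U (\<lambda>x. blinfun_apply (F' x) i)"
      by (rule continuous_on_eq) (simp add: F')
  qed
  have der: "(F has_derivative blinfun_apply (F' x)) (at x)" if "x \<in> U" for x
    using smooth_onD[OF U(3) that] F'[OF that] by simp
  obtain U' V g g' where V: "open U'" "U' \<subseteq> U" "p \<in> U'" "open V" "F p \<in> V" "homeomorphism U' V F g"
    and g: "\<And>y. y \<in> V \<Longrightarrow> (g has_derivative (g' y)) (at y)"
    "\<And>y. y \<in> V \<Longrightarrow> g' y = inv (blinfun_apply (F' (g y)))"
    "\<And>y. y \<in> V \<Longrightarrow> bij (blinfun_apply (F' (g y)))"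
    using inverse_function_theorem[OF U(1) der cont U(2) M'] by blast
  have gU: "g y \<in> U" if "y \<in> V" for y
    using V(2,6) that by (auto simp: homeomorphism_def)
  let ?D = "\<lambda>y. der F (g y)"
  define det where "det y = fst (?D y (1,0)) * snd (?D y (0,1)) - fst (?D y (0,1)) * snd (?D y (1,0))" for y
  define h where "h v y = ((snd (?D y (0,1)) * fst v - fst (?D y (0,1)) * snd v) * inverse (det y),
                    (fst (?D y (1,0)) * snd v - snd (?D y (1,0)) * fst v) * inverse (det y))" for v y
  have D: "det y \<noteq> 0" "g' y v = h v y" if y: "y \<in> V" for y v
  proof -
    have l: "linear (?D y)" using bl[OF gU[OF y]] bounded_linear.linear by blast
    have b: "bij (?D y)" using g(3)[OF y] F'[OF gU[OF y]] by simp
    show "det y \<noteq> 0" unfolding det_def by (rule inv_plane_linear(1)[OF l b])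
    show "g' y v = h v y"
      unfolding g(2)[OF y] F'[OF gU[OF y]] inv_plane_linear(2)[OF l b] h_def det_def divide_inverse ..
  qed
  have "Ck_on k V g" for k
  proof (induction k)
    case 0
    then show ?case using V(6) by (simp add: homeomorphism_def)
  next
    case (Suc k)
    have DF: "Ck_on k V (\<lambda>y. der F (g y) w)" for w
      using smooth_on_frechet[OF U(3)] gU
      by (intro Ck_on_compose[OF V(4) U(1) _ Suc]) (auto simp: smooth_on_def)
    note c = Ck_on_linear_comp[OF V(4) bounded_linear_fst DF] Ck_on_linear_comp[OF V(4) bounded_linear_snd DF]
    have mult: "Ck_on k V (\<lambda>y. a y * b y)" if "Ck_on k V a" "Ck_on k V b" for a b :: "real \<times> real \<Rightarrow> real"
      using Ck_on_scaleR[OF V(4) that] by simp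
    have diff: "Ck_on k V (\<lambda>y. a y - b y)" if "Ck_on k V a" "Ck_on k V b" for a b :: "real \<times> real \<Rightarrow> real"
      using Ck_on_add[OF V(4) that(1) Ck_on_linear_comp[OF V(4) bounded_linear_minus[OF bounded_linear_ident] that(2)]]
      by simp
    have det: "Ck_on k V (\<lambda>y. inverse (det y))"
      by (rule Ck_on_inverse[OF V(4) D(1)], simp, unfold det_def) (intro diff mult c)
    have "Ck_on k V (h v)" for v
      unfolding h_def by (intro Ck_on_Pair V(4) mult diff det c Ck_on_const)
    then have g': "Ck_on k V (\<lambda>y. g' y v)" for v
      by (rule Ck_on_cong[OF V(4), rotated]) (simp add: D)
    show ?case
      by (rule Ck_on_SucI[OF V(4) g(1) g'])
  qed
  then have sg: "smooth_germ (F p) g"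
    using V by (intro smooth_germI[of V]) (auto simp: smooth_on_def)
  have "\<forall>\<^sub>F x in nhds p. g (F x) = x" "\<forall>\<^sub>F y in nhds (F p). F (g y) = y"
    using V unfolding eventually_nhds homeomorphism_def by blast+
  moreover have "g (F p) = p" using V by (auto simp: homeomorphism_def)
  ultimately show ?thesis
    unfolding diffeo_germ_def using F sg by blast
qed

section \<open>Dilation integrals and Hadamard quotients\<close>

abbreviation ds :: "(real \<times> real \<Rightarrow> real) \<Rightarrow> real \<times> real \<Rightarrow> real" where
  "ds g p \<equiv> der g p (1, 0)"

abbreviation dw :: "(real \<times> real \<Rightarrow> real) \<Rightarrow> real \<times> real \<Rightarrow> real" where
  "dw g p \<equiv> der g p (0, 1)"

text \<open>
  Hadamard's integral along the segment from \<open>(s, 0)\<close> to \<open>(s, w)\<close>, weighted by \<open>t ^ j\<close>: it is the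
  quotient by \<open>w ^ (j + 1)\<close> of the primitive of \<open>w ^ j * g\<close> in the second variable that vanishes
  for \<open>w = 0\<close>, extended smoothly over \<open>w = 0\<close>.
\<close>

definition dil_int :: "nat \<Rightarrow> (real \<times> real \<Rightarrow> real) \<Rightarrow> real \<times> real \<Rightarrow> real" where
  "dil_int j g p = integral {0..1} (\<lambda>t. t ^ j * g (fst p, t * snd p))"

definition fibre_star :: "(real \<times> real) set \<Rightarrow> bool" where
  "fibre_star U \<longleftrightarrow> open U \<and> convex U \<and> (\<forall>p\<in>U. (fst p, 0) \<in> U)"

lemma fibre_star_dilate:
  assumes "fibre_star U" "p \<in> U" "0 \<le> t" "t \<le> 1"
  shows "(fst p, t * snd p) \<in> U"
proof -
  have "(1 - t) *\<^sub>R (fst p, 0) + t *\<^sub>R p \<in> U"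
    using assms unfolding fibre_star_def by (intro convexD) auto
  also have "(1 - t) *\<^sub>R (fst p, 0) + t *\<^sub>R p = (fst p, t * snd p)"
    by (cases p) (simp add: algebra_simps)
  finally show ?thesis .
qed

lemma has_derivative_plane:
  fixes g :: "real \<times> real \<Rightarrow> real"
  assumes "(g has_derivative der g p) (at p)"
  shows "(g has_derivative (\<lambda>v. fst v * ds g p + snd v * dw g p)) (at p)"
proof -
  have lin: "linear (der g p)" using assms has_derivative_linear by blast
  have "der g p v = fst v * ds g p + snd v * dw g p" for v
  proof -
    have "v = fst v *\<^sub>R (1, 0) + snd v *\<^sub>R (0, 1)" by (cases v) simp
    then show ?thesis by (metis linear_add[OF lin] linear_scale[OF lin] real_scaleR_def)
  qed
  then have "der g p = (\<lambda>v. fst v * ds g p + snd v * dw g p)"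
    by (rule ext)
  with assms show ?thesis by (rule has_derivative_eq_rhs)
qed

lemma plane_derivativeD:
  fixes g :: "real \<times> real \<Rightarrow> real"
  assumes "(g has_derivative (\<lambda>v. fst v * a + snd v * b)) (at p)"
  shows "ds g p = a" "dw g p = b"
  by (simp_all add: frechet_derivative_at[OF assms, symmetric])

lemma continuous_on_dilation:
  assumes U: "fibre_star U" and g: "continuous_on U g"
  shows "continuous_on (U \<times> {0..1}) (\<lambda>(p, t). g (fst p, t * snd p))"
  unfolding split_beta
  by (rule continuous_on_compose2[OF g]) (auto intro!: continuous_intros fibre_star_dilate[OF U])

lemma dilation_integrable:
  assumes U: "fibre_star U" and g: "continuous_on U g" and p: "p \<in> U"
  shows "(\<lambda>t. t ^ j * g (fst p, t * snd p)) integrable_on {0..1}"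
  by (intro integrable_continuous_interval continuous_intros continuous_on_compose2[OF g])
    (auto intro!: fibre_star_dilate[OF U p])

text \<open>
  The partial derivatives of a dilation integral are again dilation integrals, of the partial
  derivatives of \<open>g\<close>; a derivative in \<open>w\<close> raises the weight by one. Smoothness follows by
  induction from this formula alone.
\<close>

lemma has_derivative_dil_int:
  assumes U: "fibre_star U" and g: "smooth_on U g" and p: "p \<in> U"
  shows "(dil_int j g has_derivative
    (\<lambda>v. fst v * dil_int j (ds g) p + snd v * dil_int (Suc j) (dw g) p)) (at p)"
proof -
  define fx :: "real \<times> real \<Rightarrow> real \<Rightarrow> (real \<times> real) \<Rightarrow>\<^sub>L real" where
    "fx q t = (t ^ j * ds g (fst q, t * snd q)) *\<^sub>R fst_blinfun
      + (t ^ Suc j * dw g (fst q, t * snd q)) *\<^sub>R snd_blinfun" for q t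
  have oU: "open U" using U by (simp add: fibre_star_def)
  have cds: "continuous_on U (ds g)" "continuous_on U (dw g)" "continuous_on U g"
    by (intro smooth_on_continuous smooth_on_frechet g)+
  have cfx: "continuous_on (U \<times> {0..1}) (\<lambda>(q, t). fx q t)"
    using continuous_on_dilation[OF U cds(1)] continuous_on_dilation[OF U cds(2)]
    unfolding fx_def split_beta by (intro continuous_intros)
  have "((\<lambda>q. integral (cbox 0 1) (\<lambda>t. t ^ j * g (fst q, t * snd q))) has_derivative
      blinfun_apply (integral (cbox 0 1) (fx p))) (at p within U)"
  proof (rule leibniz_rule)
    show "convex U" using U by (simp add: fibre_star_def)
    show "continuous_on (U \<times> cbox 0 1) (\<lambda>(q, t). fx q t)" using cfx by simp
    fix q assume q: "q \<in> U"
    show "(\<lambda>t. t ^ j * g (fst q, t * snd q)) integrable_on cbox 0 1"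
      using dilation_integrable[OF U cds(3) q] by simp
    fix t :: real assume t: "t \<in> cbox 0 1"
    let ?q = "(fst q, t * snd q)"
    have q': "?q \<in> U" using t by (intro fibre_star_dilate[OF U q]) auto
    have d: "((\<lambda>q. (fst q, t * snd q)) has_derivative (\<lambda>v. (fst v, t * snd v))) (at q within U)"
      by (auto intro!: derivative_eq_intros)
    have "((\<lambda>q. g (fst q, t * snd q)) has_derivative (\<lambda>v. fst v * ds g ?q + (t * snd v) * dw g ?q)) (at q within U)"
      using has_derivative_compose[OF d has_derivative_plane[OF smooth_onD[OF g q']]] by simp
    from has_derivative_mult_right[OF this, of "t ^ j"]
    show "((\<lambda>q. t ^ j * g (fst q, t * snd q)) has_derivative blinfun_apply (fx q t)) (at q within U)"
      by (rule has_derivative_eq_rhs) (auto simp: fx_def blinfun.add_left blinfun.scaleR_left algebra_simps)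
  qed (rule p)
  then have D: "(dil_int j g has_derivative blinfun_apply (integral {0..1} (fx p))) (at p)"
    using at_within_open[OF p oU] by (simp add: dil_int_def[abs_def])
  have "continuous_on {0..1} (\<lambda>t. (\<lambda>(q, t). fx q t) (p, t))"
    by (rule continuous_on_compose2[OF cfx]) (use p in \<open>auto intro!: continuous_intros\<close>)
  then have int: "fx p integrable_on {0..1}"
    by (intro integrable_continuous_interval) simp
  have "blinfun_apply (integral {0..1} (fx p)) v = fst v * dil_int j (ds g) p + snd v * dil_int (Suc j) (dw g) p" for v
  proof -
    have "blinfun_apply (integral {0..1} (fx p)) v = integral {0..1} (\<lambda>t. blinfun_apply (fx p t) v)"
      using integral_linear[OF int blinfun.bounded_linear_left[of v]] by (simp add: o_def)
    also have "\<dots> = integral {0..1} (\<lambda>t. fst v * (t ^ j * ds g (fst p, t * snd p)) + snd v * (t ^ Suc j * dw g (fst p, t * snd p)))"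
      by (simp add: fx_def blinfun.add_left blinfun.scaleR_left algebra_simps)
    also have "\<dots> = fst v * dil_int j (ds g) p + snd v * dil_int (Suc j) (dw g) p"
      unfolding dil_int_def
      using dilation_integrable[OF U cds(1) p, of j] dilation_integrable[OF U cds(2) p, of "Suc j"]
      by (subst integral_add) (auto intro: integrable_on_mult_right simp del: power_Suc)
    finally show ?thesis .
  qed
  then have "blinfun_apply (integral {0..1} (fx p)) = (\<lambda>v. fst v * dil_int j (ds g) p + snd v * dil_int (Suc j) (dw g) p)"
    by (rule ext)
  with D show ?thesis by simp
qed

lemma smooth_on_dil_int:
  assumes U: "fibre_star U" and g: "smooth_on U g"
  shows "smooth_on U (dil_int j g)"
proof -
  have oU: "open U" using U by (simp add: fibre_star_def)
  have "Ck_on k U (dil_int j g)" for k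
    using g
  proof (induction k arbitrary: j g)
    case 0
    show ?case
      using has_derivative_continuous[OF has_derivative_dil_int[OF U 0]]
      by (auto intro!: continuous_at_imp_continuous_on)
  next
    case (Suc k)
    show ?case
    proof (rule Ck_on_SucI[OF oU has_derivative_dil_int[OF U Suc.prems]])
      fix v :: "real \<times> real"
      have "Ck_on k U (dil_int j (ds g))" "Ck_on k U (dil_int (Suc j) (dw g))"
        by (intro Suc.IH smooth_on_frechet Suc.prems)+
      then show "Ck_on k U (\<lambda>x. fst v * dil_int j (ds g) x + snd v * dil_int (Suc j) (dw g) x)"
        by (intro Ck_on_add[OF oU] Ck_on_linear_comp[OF oU bounded_linear_mult_right])
    qed
  qed
  then show ?thesis by (simp add: smooth_on_def)
qed

text \<open>
  The fundamental theorem of calculus on the segment, in the form in which all divisions by powers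
  of \<open>w\<close> are carried out below.
\<close>

lemma fibre_integration:
  assumes U: "fibre_star U" and h: "smooth_on U h" and k: "continuous_on U k"
    and dw: "\<And>q. q \<in> U \<Longrightarrow> dw h q = snd q ^ j * k q" and p: "p \<in> U"
  shows "h p = h (fst p, 0) + snd p ^ Suc j * dil_int j k p"
proof -
  let ?q = "\<lambda>t. (fst p, t * snd p)"
  have "((\<lambda>t. h (?q t)) has_vector_derivative (snd p ^ Suc j * (t ^ j * k (?q t)))) (at t within {0..1})"
    if t: "t \<in> {0..1}" for t
  proof -
    have q: "?q t \<in> U" using fibre_star_dilate[OF U p] t by auto
    have d: "(?q has_derivative (\<lambda>x. (0, x * snd p))) (at t within {0..1})"
      by (auto intro!: derivative_eq_intros)
    show ?thesis
      using has_derivative_compose[OF d has_derivative_plane[OF smooth_onD[OF h q]]] dw[OF q]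
      by (simp add: has_vector_derivative_def algebra_simps power_mult_distrib)
  qed
  then have "((\<lambda>t. snd p ^ Suc j * (t ^ j * k (?q t))) has_integral (h (?q 1) - h (?q 0))) {0..1}"
    by (intro fundamental_theorem_of_calculus) auto
  moreover have "((\<lambda>t. snd p ^ Suc j * (t ^ j * k (?q t))) has_integral (snd p ^ Suc j * dil_int j k p)) {0..1}"
    unfolding dil_int_def
    by (intro has_integral_mult_right integrable_integral dilation_integrable[OF U k p])
  ultimately have "h (?q 1) - h (?q 0) = snd p ^ Suc j * dil_int j k p"
    by (rule has_integral_unique)
  then show ?thesis by (simp add: algebra_simps)
qed

lemma dil_int_axis: "dil_int j g (s, 0) = g (s, 0) / (real j + 1)"
proof -
  have "((\<lambda>t. t ^ Suc j / real (Suc j)) has_real_derivative t ^ j) (at t within {0..1})" for t :: real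
    by (rule DERIV_cong[OF DERIV_cdivide[OF DERIV_power[OF DERIV_ident]]]) simp
  then have "((\<lambda>t. t ^ j) has_integral (1 ^ Suc j / real (Suc j) - 0 ^ Suc j / real (Suc j))) {0..1::real}"
    by (intro fundamental_theorem_of_calculus) (simp_all add: has_real_derivative_iff_has_vector_derivative)
  then have "((\<lambda>t. t ^ j) has_integral (1 / (real j + 1))) {0..1::real}"
    by (simp add: add.commute)
  from has_integral_mult_left[OF this, of "g (s, 0)"] show ?thesis
    by (simp add: dil_int_def integral_unique del: integral_mult_left)
qed

lemma fibre_star_ball: "fibre_star (ball (0, 0) r)"
  unfolding fibre_star_def
proof (intro conjI ballI)
  fix p :: "real \<times> real" assume "p \<in> ball (0, 0) r"
  moreover have "dist (0, 0) (fst p, 0::real) \<le> dist (0, 0) p"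
    by (cases p) (simp add: dist_Pair_Pair)
  ultimately show "(fst p, 0::real) \<in> ball (0, 0) r"
    unfolding mem_ball by (rule le_less_trans[rotated])
qed auto

lemma smooth_germ_ball:
  assumes "smooth_germ (0, 0) (g :: real \<times> real \<Rightarrow> 'b::real_normed_vector)"
  obtains r where "r > 0" "smooth_on (ball (0, 0) r) g"
proof -
  obtain U where U: "open U" "(0, 0) \<in> U" "smooth_on U g" using smooth_germE[OF assms] .
  obtain r where "r > 0" "ball (0, 0) r \<subseteq> U" using openE[OF U(1,2)] .
  then show ?thesis using that smooth_on_subset[OF U(3)] by blast
qed

lemma smooth_germ_dil_int [germ_intros]:
  assumes "smooth_germ (0, 0) g"
  shows "smooth_germ (0, 0) (dil_int j g)"
proof -
  obtain r where "r > 0" "smooth_on (ball (0, 0) r) g" using smooth_germ_ball[OF assms] .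
  then show ?thesis
    by (intro smooth_germI[OF smooth_on_dil_int[OF fibre_star_ball]]) auto
qed

section \<open>Functions with bounded derivatives\<close>

text \<open>
  Boundedness of \<open>g\<close> and of all its iterated partial derivatives. Coinduction fits because only
  closure under the two partial derivatives is ever used.
\<close>

coinductive bsmooth :: "(real \<times> real) set \<Rightarrow> (real \<times> real \<Rightarrow> real) \<Rightarrow> bool" for U where
  "smooth_on U g \<Longrightarrow> (\<And>p. p \<in> U \<Longrightarrow> \<bar>g p\<bar> \<le> B) \<Longrightarrow> bsmooth U (ds g) \<Longrightarrow> bsmooth U (dw g) \<Longrightarrow> bsmooth U g"

lemma bsmoothD:
  assumes "bsmooth U g"
  shows "smooth_on U g" "\<exists>B. \<forall>p\<in>U. \<bar>g p\<bar> \<le> B" "bsmooth U (ds g)" "bsmooth U (dw g)"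
  using assms by (cases, blast)+

text \<open>
  Averaging over dilates does not increase bounds, and by the derivative formula the partial
  derivatives are again such averages.
\<close>

lemma bsmooth_dil_int:
  assumes U: "fibre_star U" and g: "bsmooth U g"
  shows "bsmooth U (\<lambda>p. c * dil_int j g p)"
proof -
  have oU: "open U" using U by (simp add: fibre_star_def)
  have *: "bsmooth U h" if "\<exists>j g. bsmooth U g \<and> (\<forall>p\<in>U. h p = c * dil_int j g p)" for h
    using that
  proof (coinduction arbitrary: h)
    case bsmooth
    then obtain j' g' where g': "bsmooth U g'" and h: "\<And>p. p \<in> U \<Longrightarrow> h p = c * dil_int j' g' p" by blast
    obtain B where B: "\<And>p. p \<in> U \<Longrightarrow> \<bar>g' p\<bar> \<le> B" using bsmoothD(2)[OF g'(1)] by blast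
    have sm: "smooth_on U (\<lambda>p. c * dil_int j' g' p)"
      by (intro smooth_intros oU smooth_on_dil_int[OF U] bsmoothD(1)[OF g'])
    have D: "(h has_derivative (\<lambda>v. fst v * (c * dil_int j' (ds g') p) + snd v * (c * dil_int (Suc j') (dw g') p))) (at p)"
      if p: "p \<in> U" for p
    proof -
      have "((\<lambda>p. c * dil_int j' g' p) has_derivative (\<lambda>v. fst v * (c * dil_int j' (ds g') p) + snd v * (c * dil_int (Suc j') (dw g') p))) (at p)"
        by (rule has_derivative_eq_rhs[OF has_derivative_mult_right[OF has_derivative_dil_int[OF U bsmoothD(1)[OF g'] p]]])
          (simp add: fun_eq_iff algebra_simps)
      then show ?thesis
        by (rule has_derivative_transform_within_open[OF _ oU p]) (simp add: h)
    qed
    have "\<bar>h p\<bar> \<le> \<bar>c\<bar> * B" if p: "p \<in> U" for p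
    proof -
      have "norm (dil_int j' g' p) \<le> B * Henstock_Kurzweil_Integration.content (cbox 0 (1::real))"
        unfolding dil_int_def
      proof (rule has_integral_bound)
        show "0 \<le> B" using B[OF p] by linarith
        show "((\<lambda>t. t ^ j' * g' (fst p, t * snd p)) has_integral integral {0..1} (\<lambda>t. t ^ j' * g' (fst p, t * snd p))) (cbox 0 1)"
          using dilation_integrable[OF U smooth_on_continuous[OF bsmoothD(1)[OF g']] p] by (simp add: integrable_integral)
        fix t :: real assume "t \<in> cbox 0 1"
        then have t: "0 \<le> t" "t \<le> 1" by auto
        have "\<bar>t ^ j'\<bar> * \<bar>g' (fst p, t * snd p)\<bar> \<le> 1 * B"
          using t by (intro mult_mono B fibre_star_dilate[OF U p]) (auto simp: power_le_one)
        then show "norm (t ^ j' * g' (fst p, t * snd p)) \<le> B" by (simp add: abs_mult)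
      qed
      then show ?thesis using h[OF p] by (simp add: abs_mult mult_left_mono)
    qed
    moreover have "smooth_on U h" by (rule smooth_on_cong[OF sm oU]) (simp add: h)
    moreover have "\<forall>p\<in>U. ds h p = c * dil_int j' (ds g') p" "\<forall>p\<in>U. dw h p = c * dil_int (Suc j') (dw g') p"
      using plane_derivativeD[OF D] by auto
    then have "\<exists>j g. bsmooth U g \<and> (\<forall>p\<in>U. ds h p = c * dil_int j g p)"
      "\<exists>j g. bsmooth U g \<and> (\<forall>p\<in>U. dw h p = c * dil_int j g p)"
      using bsmoothD(3,4)[OF g'] by blast+
    ultimately show ?case by blast
  qed
  show ?thesis by (rule *) (use g in blast)
qed

section \<open>Series of dilates\<close>

definition strip :: "(real \<times> real) set \<Rightarrow> bool" where
  "strip U \<longleftrightarrow> open U \<and> convex U \<and> (\<forall>p\<in>U. \<forall>w. (fst p, w) \<in> U)"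

lemma strip_fibre_star: "strip U \<Longrightarrow> fibre_star U"
  by (auto simp: strip_def fibre_star_def)

text \<open>
  Differentiation along the fibre reverses the parity (\<open>e = 1\<close> even, \<open>e = - 1\<close> odd),
  differentiation along the base keeps it.
\<close>

lemma reflection_derivs:
  assumes U: "strip U" and g: "smooth_on U g" and p: "p \<in> U"
    and par: "\<And>q. q \<in> U \<Longrightarrow> g (fst q, - snd q) = e * g q"
  shows "ds g (fst p, - snd p) = e * ds g p" "dw g (fst p, - snd p) = - e * dw g p"
proof -
  let ?r = "(fst p, - snd p)"
  have r: "?r \<in> U" using U p by (simp add: strip_def)
  have oU: "open U" using U by (simp add: strip_def)
  have d: "((\<lambda>q. (fst q, - snd q)) has_derivative (\<lambda>v. (fst v, - snd v))) (at p)"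
    by (auto intro!: derivative_eq_intros)
  have 1: "((\<lambda>q. g (fst q, - snd q)) has_derivative (\<lambda>v. fst v * ds g ?r + snd v * (- dw g ?r))) (at p)"
    using has_derivative_compose[OF d has_derivative_plane[OF smooth_onD[OF g r]]] by simp
  have "((\<lambda>q. e * g q) has_derivative (\<lambda>v. fst v * (e * ds g p) + snd v * (e * dw g p))) (at p)"
    by (rule has_derivative_eq_rhs[OF has_derivative_mult_right[OF has_derivative_plane[OF smooth_onD[OF g p]]]])
      (simp add: fun_eq_iff algebra_simps)
  then have 2: "((\<lambda>q. g (fst q, - snd q)) has_derivative (\<lambda>v. fst v * (e * ds g p) + snd v * (e * dw g p))) (at p)"
    by (rule has_derivative_transform_within_open[OF _ oU p]) (simp add: par)
  have "ds g ?r = e * ds g p" "- dw g ?r = e * dw g p"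
    using plane_derivativeD[OF 1] plane_derivativeD[OF 2] by simp_all
  then show "ds g (fst p, - snd p) = e * ds g p" "dw g (fst p, - snd p) = - e * dw g p"
    by simp_all
qed

text \<open>
  On a monomial \<open>w ^ m\<close> the operator acts as multiplication by the moment \<open>\<Sum>n. c n * b n ^ m\<close>.
\<close>

definition dil_series :: "(nat \<Rightarrow> real) \<Rightarrow> (nat \<Rightarrow> real) \<Rightarrow> (real \<times> real \<Rightarrow> real) \<Rightarrow> real \<times> real \<Rightarrow> real" where
  "dil_series c b g p = (\<Sum>n. c n * g (fst p, b n * snd p))"

text \<open>
  Decay of \<open>c\<close> that survives multiplication by every power of \<open>b\<close>, as termwise differentiation
  requires.
\<close>

definition rapid :: "(nat \<Rightarrow> real) \<Rightarrow> (nat \<Rightarrow> real) \<Rightarrow> bool" where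
  "rapid c b \<longleftrightarrow> (\<forall>m. summable (\<lambda>n. \<bar>c n * b n ^ m\<bar>))"

lemma rapid_mult:
  assumes "rapid c b" shows "rapid (\<lambda>n. c n * b n) b"
  unfolding rapid_def
proof
  fix m
  show "summable (\<lambda>n. \<bar>c n * b n * b n ^ m\<bar>)"
    using assms[unfolded rapid_def, rule_format, of "Suc m"] by (simp only: power_Suc mult.assoc)
qed

lemma rapid_summable:
  assumes "rapid c b" shows "summable (\<lambda>n. \<bar>c n\<bar>)"
  using assms[unfolded rapid_def, rule_format, of 0] by simp

lemma rapid_uminus: "rapid c b \<Longrightarrow> rapid (\<lambda>n. - c n) b"
  by (simp add: rapid_def)

lemma rapid_bound:
  assumes "rapid c b" "\<And>n. \<bar>x n\<bar> \<le> B"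
  shows "summable (\<lambda>n. c n * x n)"
proof (rule summable_rabs_cancel, rule summable_comparison_test')
  have "summable (\<lambda>n. \<bar>c n\<bar>)" using assms(1) by (rule rapid_summable)
  then show "summable (\<lambda>n. \<bar>c n\<bar> * B)" by (rule summable_mult2)
  show "norm \<bar>c n * x n\<bar> \<le> \<bar>c n\<bar> * B" for n using assms(2)[of n] by (simp add: abs_mult mult_left_mono)
qed

lemma dil_series_uniform:
  assumes U: "strip U" and c: "rapid c b" and B: "\<And>p. p \<in> U \<Longrightarrow> \<bar>g p\<bar> \<le> B"
  shows "uniform_limit U (\<lambda>n p. \<Sum>i<n. c i * g (fst p, b i * snd p)) (dil_series c b g) sequentially"
  unfolding dil_series_def[abs_def]
proof (rule Weierstrass_m_test)
  have "summable (\<lambda>n. \<bar>c n\<bar>)" using c by (rule rapid_summable)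
  then show "summable (\<lambda>n. \<bar>c n\<bar> * B)" by (rule summable_mult2)
  fix n p assume "p \<in> U"
  then have "\<bar>g (fst p, b n * snd p)\<bar> \<le> B" using U by (intro B) (auto simp: strip_def)
  then show "norm (c n * g (fst p, b n * snd p)) \<le> \<bar>c n\<bar> * B" by (simp add: abs_mult mult_left_mono)
qed

text \<open>
  Differentiation in \<open>w\<close> replaces \<open>c\<close> by \<open>c * b\<close>, which is again rapidly decreasing; hence sums of
  dilates are smooth by the same induction as dilation integrals.
\<close>

lemma has_derivative_dil_series:
  assumes U: "strip U" and c: "rapid c b" and g: "bsmooth U g" and p: "p \<in> U"
  shows "(dil_series c b g has_derivative
    (\<lambda>v. fst v * dil_series c b (ds g) p + snd v * dil_series (\<lambda>n. c n * b n) b (dw g) p)) (at p)"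
proof -
  have oU: "open U" and cU: "convex U" using U by (auto simp: strip_def)
  obtain B where B: "\<And>p. p \<in> U \<Longrightarrow> \<bar>g p\<bar> \<le> B" using bsmoothD(2)[OF g] by blast
  obtain Bs where Bs: "\<And>p. p \<in> U \<Longrightarrow> \<bar>ds g p\<bar> \<le> Bs" using bsmoothD(2)[OF bsmoothD(3)[OF g]] by blast
  obtain Bw where Bw: "\<And>p. p \<in> U \<Longrightarrow> \<bar>dw g p\<bar> \<le> Bw" using bsmoothD(2)[OF bsmoothD(4)[OF g]] by blast
  let ?f = "\<lambda>n p. c n * g (fst p, b n * snd p)"
  let ?f' = "\<lambda>n p v. fst v * (c n * ds g (fst p, b n * snd p)) + snd v * (c n * b n * dw g (fst p, b n * snd p))"
  let ?g' = "\<lambda>p v. fst v * dil_series c b (ds g) p + snd v * dil_series (\<lambda>n. c n * b n) b (dw g) p"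
  have sums: "(\<lambda>n. ?f n q) sums dil_series c b g q" if "q \<in> U" for q
    unfolding dil_series_def
    by (intro summable_sums rapid_bound[OF c]) (use that U in \<open>auto intro!: B simp: strip_def\<close>)
  have "\<exists>h. \<forall>q\<in>U. (\<lambda>n. ?f n q) sums h q \<and> (h has_derivative ?g' q) (at q within U)"
  proof (rule has_derivative_series[where f = ?f and f' = ?f' and g' = ?g', OF cU _ _ p sums[OF p]])
    fix n q assume q: "q \<in> U"
    let ?q = "(fst q, b n * snd q)"
    have q': "?q \<in> U" using q U by (auto simp: strip_def)
    have d: "((\<lambda>q. (fst q, b n * snd q)) has_derivative (\<lambda>v. (fst v, b n * snd v))) (at q within U)"
      by (auto intro!: derivative_eq_intros)
    have "((\<lambda>q. g (fst q, b n * snd q)) has_derivative (\<lambda>v. fst v * ds g ?q + (b n * snd v) * dw g ?q)) (at q within U)"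
      using has_derivative_compose[OF d has_derivative_plane[OF smooth_onD[OF bsmoothD(1)[OF g] q']]] by simp
    from has_derivative_mult_right[OF this, of "c n"]
    show "(?f n has_derivative ?f' n q) (at q within U)"
      by (rule has_derivative_eq_rhs) (simp add: fun_eq_iff algebra_simps)
  next
    fix e :: real assume "e > 0"
    then have e2: "e / 2 > 0" by simp
    have "\<forall>\<^sub>F n in sequentially. \<forall>q\<in>U. dist (\<Sum>i<n. c i * ds g (fst q, b i * snd q)) (dil_series c b (ds g) q) < e / 2"
      using uniform_limitD[OF dil_series_uniform[OF U c Bs] e2] by simp
    moreover have "\<forall>\<^sub>F n in sequentially. \<forall>q\<in>U. dist (\<Sum>i<n. c i * b i * dw g (fst q, b i * snd q)) (dil_series (\<lambda>n. c n * b n) b (dw g) q) < e / 2"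
      using uniform_limitD[OF dil_series_uniform[OF U rapid_mult[OF c] Bw] e2] by simp
    ultimately show "\<forall>\<^sub>F n in sequentially. \<forall>q\<in>U. \<forall>h. norm ((\<Sum>i<n. ?f' i q h) - ?g' q h) \<le> e * norm h"
    proof eventually_elim
      case (elim n)
      show ?case
      proof (intro ballI allI)
        fix q h assume q: "q \<in> U"
        let ?A = "(\<Sum>i<n. c i * ds g (fst q, b i * snd q)) - dil_series c b (ds g) q"
        let ?B = "(\<Sum>i<n. c i * b i * dw g (fst q, b i * snd q)) - dil_series (\<lambda>n. c n * b n) b (dw g) q"
        have AB: "\<bar>?A\<bar> \<le> e / 2" "\<bar>?B\<bar> \<le> e / 2"
          using elim q by (auto simp: dist_real_def less_imp_le)
        have eq: "(\<Sum>i<n. ?f' i q h) - ?g' q h = fst h * ?A + snd h * ?B"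
          by (simp add: sum.distrib sum_distrib_left algebra_simps)
        have h: "\<bar>fst h\<bar> \<le> norm h" "\<bar>snd h\<bar> \<le> norm h"
          using norm_fst_le[of "fst h" "snd h"] norm_snd_le[of "snd h" "fst h"] by auto
        have tri: "\<bar>x * A + y * B\<bar> \<le> N * d + N * d"
          if "\<bar>A\<bar> \<le> d" "\<bar>B\<bar> \<le> d" "\<bar>x\<bar> \<le> N" "\<bar>y\<bar> \<le> N" for x y A B N d :: real
          using that by (intro order_trans[OF abs_triangle_ineq] add_mono) (auto simp: abs_mult intro!: mult_mono)
        have "norm ((\<Sum>i<n. ?f' i q h) - ?g' q h) \<le> norm h * (e / 2) + norm h * (e / 2)"
          unfolding eq real_norm_def by (rule tri[OF AB h])
        then show "norm ((\<Sum>i<n. ?f' i q h) - ?g' q h) \<le> e * norm h" by (simp add: algebra_simps)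
      qed
    qed
  qed
  then obtain h where h: "\<And>q. q \<in> U \<Longrightarrow> (\<lambda>n. ?f n q) sums h q" "\<And>q. q \<in> U \<Longrightarrow> (h has_derivative ?g' q) (at q within U)"
    by blast
  have eq: "h q = dil_series c b g q" if "q \<in> U" for q
    using sums_unique2[OF h(1) sums] that by blast
  have "(h has_derivative ?g' p) (at p)"
    using h(2)[OF p] at_within_open[OF p oU] by simp
  then show ?thesis
    by (rule has_derivative_transform_within_open[OF _ oU p]) (rule eq)
qed

lemma smooth_on_dil_series:
  assumes U: "strip U" and c: "rapid c b" and g: "bsmooth U g"
  shows "smooth_on U (dil_series c b g)"
proof -
  have oU: "open U" using U by (simp add: strip_def)
  have "Ck_on k U (dil_series c b g)" for k
    using c g
  proof (induction k arbitrary: c g)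
    case 0
    show ?case
      using has_derivative_continuous[OF has_derivative_dil_series[OF U 0]]
      by (auto intro!: continuous_at_imp_continuous_on)
  next
    case (Suc k)
    show ?case
    proof (rule Ck_on_SucI[OF oU has_derivative_dil_series[OF U Suc.prems]])
      fix v :: "real \<times> real"
      have "Ck_on k U (dil_series c b (ds g))" "Ck_on k U (dil_series (\<lambda>n. c n * b n) b (dw g))"
        by (intro Suc.IH bsmoothD(3,4)[OF Suc.prems(2)] rapid_mult Suc.prems)+
      then show "Ck_on k U (\<lambda>x. fst v * dil_series c b (ds g) x + snd v * dil_series (\<lambda>n. c n * b n) b (dw g) x)"
        by (intro Ck_on_add[OF oU] Ck_on_linear_comp[OF oU bounded_linear_mult_right])
    qed
  qed
  then show ?thesis by (simp add: smooth_on_def)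
qed

lemma dil_series_derivs:
  assumes "strip U" "rapid c b" "bsmooth U g" "p \<in> U"
  shows "ds (dil_series c b g) p = dil_series c b (ds g) p"
    "dw (dil_series c b g) p = dil_series (\<lambda>n. c n * b n) b (dw g) p"
  using plane_derivativeD[OF has_derivative_dil_series[OF assms]] by auto

section \<open>Gluing two even functions along a line\<close>

text \<open>
  The function of \<open>(s, y)\<close> that equals \<open>g(s, \<surd>y)\<close> for \<open>y \<ge> 0\<close> and \<open>h(s, \<surd>(-y))\<close> for \<open>y \<le> 0\<close>,
  provided that \<open>g\<close> and \<open>h\<close> agree on \<open>w = 0\<close>. The formula without case distinction makes
  continuity obvious.
\<close>

definition glue :: "(real \<times> real \<Rightarrow> real) \<Rightarrow> (real \<times> real \<Rightarrow> real) \<Rightarrow> real \<times> real \<Rightarrow> real" where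
  "glue g h p = g (fst p, sqrt (max 0 (snd p))) + h (fst p, sqrt (max 0 (- snd p))) - g (fst p, 0)"

lemma glue_square: "g (s, 0) = h (s, 0) \<Longrightarrow> glue g h (s, w\<^sup>2) = g (s, \<bar>w\<bar>)"
  by (simp add: glue_def)

lemma continuous_on_glue:
  assumes U: "strip U" and "continuous_on U g" "continuous_on U h"
  shows "continuous_on U (glue g h)"
  unfolding glue_def
  by (intro continuous_intros continuous_on_compose2[OF assms(2)] continuous_on_compose2[OF assms(3)])
    (use U in \<open>auto simp: strip_def\<close>)

text \<open>
  At a point of the axis the factor \<open>snd p\<close> compensates for the lack of differentiability of \<open>F\<close>.
\<close>

lemma has_derivative_snd_mult:
  fixes F :: "real \<times> real \<Rightarrow> real"
  assumes "isCont F (s, 0)"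
  shows "((\<lambda>p. snd p * F p) has_derivative (\<lambda>v. snd v * F (s, 0))) (at (s, 0))"
  unfolding has_derivative_iff_norm
proof
  show "bounded_linear (\<lambda>v::real \<times> real. snd v * F (s, 0))"
    by (intro bounded_linear_intros)
  have "((\<lambda>p. \<bar>F p - F (s, 0)\<bar>) \<longlongrightarrow> 0) (at (s, 0))"
    using assms unfolding isCont_def by (intro tendsto_rabs_zero LIM_zero)
  then show "((\<lambda>p. norm (snd p * F p - snd (s, 0) * F (s, 0) - snd (p - (s, 0)) * F (s, 0)) / norm (p - (s, 0))) \<longlongrightarrow> 0) (at (s, 0))"
  proof (rule tendsto_sandwich[OF _ _ tendsto_const, rotated 2])
    show "\<forall>\<^sub>F p in at (s, 0). norm (snd p * F p - snd (s, 0) * F (s, 0) - snd (p - (s, 0)) * F (s, 0)) / norm (p - (s, 0)) \<le> \<bar>F p - F (s, 0)\<bar>"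
    proof (rule always_eventually, rule allI)
      fix p :: "real \<times> real"
      have "norm (snd p * F p - snd (s, 0) * F (s, 0) - snd (p - (s, 0)) * F (s, 0)) = \<bar>snd (p - (s, 0))\<bar> * \<bar>F p - F (s, 0)\<bar>"
        by (simp add: abs_mult[symmetric] algebra_simps)
      also have "\<dots> \<le> norm (p - (s, 0)) * \<bar>F p - F (s, 0)\<bar>"
        using norm_snd_le[of "snd (p - (s, 0))" "fst (p - (s, 0))"]
        by (intro mult_right_mono) (simp_all only: prod.collapse real_norm_def abs_ge_zero)
      finally show "norm (snd p * F p - snd (s, 0) * F (s, 0) - snd (p - (s, 0)) * F (s, 0)) / norm (p - (s, 0)) \<le> \<bar>F p - F (s, 0)\<bar>"
        by (cases "p = (s, 0)") (auto simp: divide_simps mult.commute)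
    qed
  qed auto
qed

lemma dil_int_cmult: "dil_int j (\<lambda>q. c * k q) p = c * dil_int j k p"
proof -
  have "(\<lambda>t. t ^ j * (c * k (fst p, t * snd p))) = (\<lambda>t. c * (t ^ j * k (fst p, t * snd p)))"
    by (simp add: fun_eq_iff)
  then show ?thesis unfolding dil_int_def by (simp only: integral_mult_right)
qed

lemma has_derivative_sqrt_fibre:
  assumes U: "strip U" and g: "smooth_on U g" and p: "p \<in> U" and e: "e * snd p > 0"
    and dw: "\<And>q. q \<in> U \<Longrightarrow> dw g q = 2 * snd q * g2 q"
  shows "((\<lambda>p. g (fst p, sqrt (e * snd p))) has_derivative
    (\<lambda>v. fst v * ds g (fst p, sqrt (e * snd p)) + snd v * (e * g2 (fst p, sqrt (e * snd p))))) (at p)"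
proof -
  let ?q = "(fst p, sqrt (e * snd p))"
  have q: "?q \<in> U" using U p by (auto simp: strip_def)
  have d: "((\<lambda>p. (fst p, sqrt (e * snd p))) has_derivative (\<lambda>v. (fst v, e * snd v / (2 * sqrt (e * snd p))))) (at p)"
    using e by (auto intro!: derivative_eq_intros simp: field_simps)
  show ?thesis
    by (rule has_derivative_eq_rhs[OF has_derivative_compose[OF d has_derivative_plane[OF smooth_onD[OF g q]]]])
      (use e dw[OF q] in \<open>auto simp: fun_eq_iff\<close>)
qed

text \<open>
  The derivative of a glued function is glued from the corresponding derivatives: since \<open>y = w\<^sup>2\<close>
  for \<open>y > 0\<close> and \<open>y = - w\<^sup>2\<close> for \<open>y < 0\<close>, differentiation in \<open>y\<close> is \<open>1/(2w) \<partial>/\<partial>w\<close> on \<open>g\<close> and its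
  negative on \<open>h\<close>. The only delicate points are those with \<open>y = 0\<close>, where the glued function is
  \<open>g(s, 0) + y F(s, y)\<close> with a continuous \<open>F\<close> obtained by Hadamard division.
\<close>

lemma has_derivative_glue:
  assumes U: "strip U" and g: "smooth_on U g" "smooth_on U g2" and h: "smooth_on U h" "smooth_on U h2"
    and p: "p \<in> U"
    and dg: "\<And>q. q \<in> U \<Longrightarrow> dw g q = 2 * snd q * g2 q"
    and dh: "\<And>q. q \<in> U \<Longrightarrow> dw h q = - 2 * snd q * h2 q"
    and eq: "\<And>q. q \<in> U \<Longrightarrow> g (fst q, 0) = h (fst q, 0)" "\<And>q. q \<in> U \<Longrightarrow> g2 (fst q, 0) = h2 (fst q, 0)"
  shows "(glue g h has_derivative (\<lambda>v. fst v * glue (ds g) (ds h) p + snd v * glue g2 h2 p)) (at p)"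
proof -
  have oU: "open U" and fU: "fibre_star U" using U strip_fibre_star by (auto simp: strip_def)
  have ax: "(fst q, 0) \<in> U" if "q \<in> U" for q using U that by (auto simp: strip_def)
  have der_ax: "((\<lambda>q. k (fst q, 0)) has_derivative (\<lambda>v. fst v * ds k (fst p, 0))) (at p)" if "smooth_on U k" for k
  proof -
    have d: "((\<lambda>q. (fst q, 0::real)) has_derivative (\<lambda>v. (fst v, 0))) (at p)"
      by (auto intro!: derivative_eq_intros)
    show ?thesis
      using has_derivative_compose[OF d has_derivative_plane[OF smooth_onD[OF that ax[OF p]]]] by simp
  qed
  have ds_ax: "ds g (fst p, 0) = ds h (fst p, 0)"
  proof -
    have "((\<lambda>q. g (fst q, 0)) has_derivative (\<lambda>v. fst v * ds h (fst p, 0))) (at p)"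
      by (rule has_derivative_transform_within_open[OF der_ax[OF h(1)] oU p]) (simp add: eq)
    from fun_cong[OF has_derivative_unique[OF this der_ax[OF g(1)]], of "(1, 0)"] show ?thesis
      by simp
  qed
  consider "snd p > 0" | "snd p < 0" | "snd p = 0" by linarith
  then show ?thesis
  proof cases
    case 1
    have o: "open (U \<inter> {q. snd q > 0})" "p \<in> U \<inter> {q. snd q > 0}"
      using oU p 1 by (auto intro!: open_Int open_Collect_less continuous_intros)
    have "((\<lambda>q. g (fst q, sqrt (1 * snd q))) has_derivative
      (\<lambda>v. fst v * ds g (fst p, sqrt (1 * snd p)) + snd v * (1 * g2 (fst p, sqrt (1 * snd p))))) (at p)"
      by (rule has_derivative_sqrt_fibre[OF U g(1) p _ dg]) (use 1 in auto)
    then have "(glue g h has_derivative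
      (\<lambda>v. fst v * ds g (fst p, sqrt (1 * snd p)) + snd v * (1 * g2 (fst p, sqrt (1 * snd p))))) (at p)"
      by (rule has_derivative_transform_within_open[OF _ o]) (simp add: glue_def eq)
    then show ?thesis
      using 1 by (simp add: glue_def ds_ax eq(2)[OF p])
  next
    case 2
    have o: "open (U \<inter> {q. snd q < 0})" "p \<in> U \<inter> {q. snd q < 0}"
      using oU p 2 by (auto intro!: open_Int open_Collect_less continuous_intros)
    have "((\<lambda>q. h (fst q, sqrt ((-1) * snd q))) has_derivative
      (\<lambda>v. fst v * ds h (fst p, sqrt ((-1) * snd p)) + snd v * ((-1) * - h2 (fst p, sqrt ((-1) * snd p))))) (at p)"
      by (rule has_derivative_sqrt_fibre[OF U h(1) p]) (use 2 dh in auto)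
    then have "(glue g h has_derivative
      (\<lambda>v. fst v * ds h (fst p, sqrt ((-1) * snd p)) + snd v * ((-1) * - h2 (fst p, sqrt ((-1) * snd p))))) (at p)"
      by (rule has_derivative_transform_within_open[OF _ o]) (simp add: glue_def eq)
    then show ?thesis
      using 2 by (simp add: glue_def)
  next
    case 3
    define F where "F = glue (\<lambda>q. 2 * dil_int 1 g2 q) (\<lambda>q. 2 * dil_int 1 h2 q)"
    have gi: "g q = g (fst q, 0) + snd q ^ 2 * (2 * dil_int 1 g2 q)" if "q \<in> U" for q
    proof -
      have "g q = g (fst q, 0) + snd q ^ Suc 1 * dil_int 1 (\<lambda>q. 2 * g2 q) q"
        by (rule fibre_integration[OF fU g(1) _ _ that])
          (auto intro!: smooth_on_continuous smooth_intros oU g simp: dg)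
      also have "dil_int 1 (\<lambda>q. 2 * g2 q) q = 2 * dil_int 1 g2 q"
        by (rule dil_int_cmult)
      finally show ?thesis by (simp add: numeral_2_eq_2)
    qed
    have hi: "h q = h (fst q, 0) - snd q ^ 2 * (2 * dil_int 1 h2 q)" if "q \<in> U" for q
    proof -
      have "h q = h (fst q, 0) + snd q ^ Suc 1 * dil_int 1 (\<lambda>q. (-2) * h2 q) q"
        by (rule fibre_integration[OF fU h(1) _ _ that])
          (auto intro!: smooth_on_continuous smooth_intros smooth_on_minus[OF oU] oU h simp: dh)
      also have "dil_int 1 (\<lambda>q. (-2) * h2 q) q = (-2) * dil_int 1 h2 q"
        by (rule dil_int_cmult)
      finally show ?thesis by (simp add: numeral_2_eq_2)
    qed
    have glue_eq: "g (fst q, 0) + snd q * F q = glue g h q" if q: "q \<in> U" for q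
    proof -
      have 1: "(fst q, sqrt (max 0 (snd q))) \<in> U" "(fst q, sqrt (max 0 (- snd q))) \<in> U"
        using U q by (auto simp: strip_def)
      show ?thesis
        using gi[OF 1(1)] hi[OF 1(2)] eq[OF q]
        by (cases "snd q \<ge> 0") (simp_all add: glue_def F_def dil_int_axis)
    qed
    have "continuous_on U F"
      unfolding F_def using smooth_on_continuous[OF smooth_on_dil_int[OF fU]] g(2) h(2)
      by (intro continuous_on_glue[OF U] continuous_intros) auto
    then have "isCont F p" using oU p continuous_on_eq_continuous_at by blast
    moreover have pe: "p = (fst p, 0)" using 3 by (simp add: prod_eq_iff)
    ultimately have "((\<lambda>p. snd p * F p) has_derivative (\<lambda>v. snd v * F p)) (at p)"
      using has_derivative_snd_mult[of "fst p" F] by simp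
    from has_derivative_add[OF der_ax[OF g(1)] this]
    have "(glue g h has_derivative (\<lambda>v. fst v * ds g (fst p, 0) + snd v * F p)) (at p)"
      by (rule has_derivative_transform_within_open[OF _ oU p]) (rule glue_eq)
    moreover have "F p = glue g2 h2 p"
      using eq(2)[OF p] 3 by (simp add: F_def glue_def dil_int_axis)
    ultimately show ?thesis using 3 by (simp add: glue_def ds_ax)
  qed
qed

text \<open>
  For even \<open>g\<close> this is \<open>1/(2w) \<partial>g/\<partial>w\<close>, that is, the derivative of \<open>g\<close> with respect to \<open>w\<^sup>2\<close>.
\<close>

definition quad_quot :: "(real \<times> real \<Rightarrow> real) \<Rightarrow> real \<times> real \<Rightarrow> real" where
  "quad_quot g p = 1 / 2 * dil_int 0 (dw (dw g)) p"

lemma even_quad_quot: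
  assumes U: "strip U" and g: "bsmooth U g" and ev: "\<And>q. q \<in> U \<Longrightarrow> g (fst q, - snd q) = g q"
  shows "bsmooth U (quad_quot g)"
    and "q \<in> U \<Longrightarrow> quad_quot g (fst q, - snd q) = quad_quot g q"
    and "q \<in> U \<Longrightarrow> ds g (fst q, - snd q) = ds g q"
    and "q \<in> U \<Longrightarrow> dw g q = 2 * snd q * quad_quot g q"
proof -
  have fU: "fibre_star U" using U by (rule strip_fibre_star)
  show "bsmooth U (quad_quot g)"
    unfolding quad_quot_def[abs_def] by (intro bsmooth_dil_int fU bsmoothD g)
  have ev1: "g (fst q, - snd q) = 1 * g q" if "q \<in> U" for q using ev[OF that] by simp
  have d1: "ds g (fst q, - snd q) = 1 * ds g q" "dw g (fst q, - snd q) = - 1 * dw g q" if "q \<in> U" for q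
    by (rule reflection_derivs[where e = 1, OF U bsmoothD(1)[OF g] that], rule ev1, assumption)+
  have d: "ds g (fst q, - snd q) = ds g q" "dw g (fst q, - snd q) = (-1) * dw g q" if "q \<in> U" for q
    using d1[OF that] by simp_all
  then show "q \<in> U \<Longrightarrow> ds g (fst q, - snd q) = ds g q" by blast
  have dd: "dw (dw g) (fst q, - snd q) = dw (dw g) q" if "q \<in> U" for q
  proof -
    have "dw (dw g) (fst q, - snd q) = - (- 1) * dw (dw g) q"
      by (rule reflection_derivs(2)[where e = "- 1", OF U bsmoothD(1)[OF bsmoothD(4)[OF g]] that], rule d(2))
    then show ?thesis by simp
  qed
  have st: "(fst q, t) \<in> U" if "q \<in> U" for q t using U that by (auto simp: strip_def)
  show "q \<in> U \<Longrightarrow> quad_quot g (fst q, - snd q) = quad_quot g q"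
  proof -
    assume q: "q \<in> U"
    have "dw (dw g) (fst q, t * - snd q) = dw (dw g) (fst q, t * snd q)" for t
      using dd[OF st[OF q, of "t * snd q"]] by simp
    then show ?thesis by (simp only: quad_quot_def dil_int_def fst_conv snd_conv)
  qed
  show "dw g q = 2 * snd q * quad_quot g q" if q: "q \<in> U"
  proof -
    have "dw g (fst q, 0) = 0" using d(2)[OF st[OF q], of 0] by simp
    moreover have "dw g q = dw g (fst q, 0) + snd q ^ Suc 0 * dil_int 0 (dw (dw g)) q"
      by (rule fibre_integration[OF fU _ _ _ q])
        (auto intro!: bsmoothD(1) bsmoothD(4) g smooth_on_continuous)
    ultimately show ?thesis by (simp add: quad_quot_def)
  qed
qed

text \<open>
  Differentiating in \<open>y\<close> replaces \<open>g\<close> by \<open>quad_quot g\<close> and \<open>c\<close> by \<open>- c * b\<^sup>2\<close>. The new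
  coefficients have the same alternating moments, so the two halves keep agreeing at \<open>y = 0\<close> and
  the step can be repeated.
\<close>

theorem smooth_on_glue:
  assumes U: "strip U" and g: "bsmooth U g" and ev: "\<And>q. q \<in> U \<Longrightarrow> g (fst q, - snd q) = g q"
    and c: "rapid c b" and mom: "\<And>n. (\<Sum>i. c i * b i ^ (2 * n)) = (- 1) ^ n"
  shows "smooth_on U (glue g (dil_series c b g))"
proof -
  have oU: "open U" using U by (auto simp: strip_def)
  have axis: "dil_series c b g (s, 0) = (\<Sum>i. c i * b i ^ (2 * 0)) * g (s, 0)" if "rapid c b" for c g s
    using suminf_mult2[OF summable_rabs_cancel[OF rapid_summable[OF that]], of "g (s, 0)"]
    by (simp add: dil_series_def)
  have "Ck_on k U (glue g (dil_series c b g))" for k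
    using g ev c mom
  proof (induction k arbitrary: g c)
    case 0
    show ?case
      using smooth_on_continuous[OF bsmoothD(1)[OF 0(1)]] smooth_on_continuous[OF smooth_on_dil_series[OF U 0(3,1)]]
      by (simp add: continuous_on_glue[OF U])
  next
    case (Suc k)
    note g = Suc.prems(1) and ev = Suc.prems(2) and c = Suc.prems(3) and mom = Suc.prems(4)
    have q: "bsmooth U (quad_quot g)"
      "\<And>q. q \<in> U \<Longrightarrow> quad_quot g (fst q, - snd q) = quad_quot g q"
      "\<And>q. q \<in> U \<Longrightarrow> ds g (fst q, - snd q) = ds g q"
      "\<And>q. q \<in> U \<Longrightarrow> dw g q = 2 * snd q * quad_quot g q"
      by (rule even_quad_quot[OF U g], rule ev, assumption+)+
    define c2 where "c2 n = - (c n * b n * b n)" for n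
    have c2: "rapid c2 b"
      unfolding c2_def using rapid_uminus[OF rapid_mult[OF rapid_mult[OF c]]] .
    have mom2: "(\<Sum>i. c2 i * b i ^ (2 * n)) = (- 1) ^ n" for n
    proof -
      have "summable (\<lambda>i. c i * b i ^ (2 * Suc n))"
        by (rule summable_rabs_cancel[OF c[unfolded rapid_def, rule_format]])
      from suminf_minus[OF this] have "(\<Sum>i. c2 i * b i ^ (2 * n)) = - (\<Sum>i. c i * b i ^ (2 * Suc n))"
        by (simp add: c2_def mult.assoc)
      then show ?thesis using mom[of "Suc n"] by simp
    qed
    let ?h = "dil_series c b g" and ?h2 = "dil_series c2 b (quad_quot g)"
    have dh: "dw ?h p = - 2 * snd p * ?h2 p" if p: "p \<in> U" for p
    proof -
      have "dw ?h p = (\<Sum>n. c n * b n * dw g (fst p, b n * snd p))"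
        using dil_series_derivs(2)[OF U c g p] by (simp add: dil_series_def)
      also have "\<dots> = (\<Sum>n. - 2 * snd p * (c2 n * quad_quot g (fst p, b n * snd p)))"
      proof (rule suminf_cong)
        fix n
        have "(fst p, b n * snd p) \<in> U" using U p by (auto simp: strip_def)
        from q(4)[OF this] show "c n * b n * dw g (fst p, b n * snd p) = - 2 * snd p * (c2 n * quad_quot g (fst p, b n * snd p))"
          by (simp add: c2_def)
      qed
      also have "\<dots> = - 2 * snd p * ?h2 p"
        unfolding dil_series_def
      proof (rule suminf_mult)
        obtain B where "\<And>p. p \<in> U \<Longrightarrow> \<bar>quad_quot g p\<bar> \<le> B" using bsmoothD(2)[OF q(1)] by blast
        then show "summable (\<lambda>n. c2 n * quad_quot g (fst p, b n * snd p))"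
          by (intro rapid_bound[OF c2]) (use U p in \<open>auto simp: strip_def\<close>)
      qed
      finally show ?thesis .
    qed
    have D: "(glue g ?h has_derivative (\<lambda>v. fst v * glue (ds g) (ds ?h) p + snd v * glue (quad_quot g) ?h2 p)) (at p)"
      if p: "p \<in> U" for p
      by (rule has_derivative_glue[OF U bsmoothD(1)[OF g] bsmoothD(1)[OF q(1)] smooth_on_dil_series[OF U c g] smooth_on_dil_series[OF U c2 q(1)] p])
        (use q(4) dh axis[OF c, of g] axis[OF c2, of "quad_quot g"] mom[of 0] mom2[of 0] in auto)
    show ?case
    proof (rule Ck_on_SucI[OF oU D])
      fix v :: "real \<times> real"
      have st: "(fst p, t) \<in> U" if "p \<in> U" for p t using U that by (auto simp: strip_def)
      have "Ck_on k U (glue (ds g) (dil_series c b (ds g)))"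
        by (rule Suc.IH) (rule bsmoothD(3)[OF g], rule q(3), assumption, rule c, rule mom)
      then have "Ck_on k U (glue (ds g) (ds ?h))"
        by (rule Ck_on_cong[OF oU, rotated]) (use dil_series_derivs(1)[OF U c g st] in \<open>simp add: glue_def\<close>)
      moreover have "Ck_on k U (glue (quad_quot g) ?h2)"
        by (rule Suc.IH) (rule q(1), rule q(2), assumption, rule c2, rule mom2)
      ultimately show "Ck_on k U (\<lambda>p. fst v * glue (ds g) (ds ?h) p + snd v * glue (quad_quot g) ?h2 p)"
        by (intro Ck_on_add[OF oU] Ck_on_linear_comp[OF oU bounded_linear_mult_right])
    qed
  qed
  then show ?thesis by (simp add: smooth_on_def)
qed

section \<open>Coefficients with alternating moments\<close>

text \<open>
  With \<open>theta_coeff (- 1 - k) = - theta_coeff k\<close> these are the coefficients of a theta series over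
  all integers, \<open>(-1)^k 9^(- k (k + 1) / 2)\<close>.
\<close>

primrec theta_coeff :: "nat \<Rightarrow> real" where
  "theta_coeff 0 = 1"
| "theta_coeff (Suc k) = - theta_coeff k / 9 ^ Suc k"

lemma theta_coeff_bound: "\<bar>theta_coeff k\<bar> \<le> 1 / 9 ^ k"
proof (induction k)
  case (Suc k)
  have "\<bar>theta_coeff k\<bar> \<le> 1"
    using Suc by (rule order_trans) simp
  then show ?case by (simp add: divide_right_mono)
qed simp

lemma theta_coeff_summable: "summable (\<lambda>k. \<bar>theta_coeff k\<bar> * (9 ^ k) ^ n)"
proof (rule summable_ratio_test[of "1 / 9" n])
  fix k :: nat assume k: "k \<ge> n"
  have "(9::real) ^ n \<le> 9 ^ k" using k by (intro power_increasing) auto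
  then have "9 * 9 ^ n * (\<bar>theta_coeff k\<bar> * (9 ^ k) ^ n) \<le> 9 * 9 ^ k * (\<bar>theta_coeff k\<bar> * (9 ^ k) ^ n)"
    by (intro mult_right_mono) auto
  then show "norm (\<bar>theta_coeff (Suc k)\<bar> * (9 ^ Suc k) ^ n) \<le> 1 / 9 * norm (\<bar>theta_coeff k\<bar> * (9 ^ k) ^ n)"
    by (simp add: abs_mult power_mult_distrib divide_simps mult_ac)
qed simp

lemma theta_summable_bounded:
  assumes "\<And>k. \<bar>x k\<bar> \<le> (9 ^ k) ^ n"
  shows "summable (\<lambda>k. \<bar>theta_coeff k * x k\<bar>)" "summable (\<lambda>k. theta_coeff k * x k)"
proof -
  show "summable (\<lambda>k. \<bar>theta_coeff k * x k\<bar>)"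
    by (rule summable_comparison_test'[OF theta_coeff_summable[of n]])
      (simp add: abs_mult assms mult_left_mono)
  then show "summable (\<lambda>k. theta_coeff k * x k)" by (rule summable_rabs_cancel)
qed

lemma theta_summable_negative: "summable (\<lambda>k. theta_coeff k * (1 / 9 ^ Suc k) ^ m)"
proof (rule theta_summable_bounded(2))
  fix k
  have "(1 / 9 ^ Suc k) ^ m \<le> (1::real)"
    by (rule power_le_one) (simp_all add: one_le_power del: power_Suc)
  then show "\<bar>(1 / 9 ^ Suc k) ^ m\<bar> \<le> ((9::real) ^ k) ^ 0"
    by (subst abs_of_nonneg) auto
qed

text \<open>
  The recursion for the coefficients shifts the two-sided series
  \<open>Z n = \<Sum>k. theta_coeff k * 9 ^ (k n)\<close> over the integers into itself:
  \<open>Z (n + 1) = - 9 ^ n * Z n\<close>. As \<open>Z 0 = 0\<close> by antisymmetry, all \<open>Z n\<close> vanish; the two sides of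
  the equation are the halves \<open>k \<ge> 0\<close> and \<open>k < 0\<close> of this sum.
\<close>

lemma theta_bilateral_sum:
  "(\<Sum>k. theta_coeff k * (9 ^ k) ^ n) = (\<Sum>k. theta_coeff k * (1 / 9 ^ Suc k) ^ n)"
proof (induction n)
  case (Suc n)
  have s1: "summable (\<lambda>k. theta_coeff k * (9 ^ k) ^ m)" for m
    by (rule theta_summable_bounded(2)[of _ m]) simp
  note s2 = theta_summable_negative
  let ?P = "\<lambda>n. \<Sum>k. theta_coeff k * (9 ^ k) ^ n" and ?N = "\<lambda>n. \<Sum>k. theta_coeff k * (1 / 9 ^ Suc k) ^ n"
  have "?P (Suc n) = 1 + (\<Sum>k. theta_coeff (Suc k) * (9 ^ Suc k) ^ Suc n)"
    using suminf_split_head[OF s1[of "Suc n"]] by simp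
  also have "(\<lambda>k. theta_coeff (Suc k) * (9 ^ Suc k) ^ Suc n) = (\<lambda>k. - (9 ^ n) * (theta_coeff k * (9 ^ k) ^ n))"
    by (simp add: fun_eq_iff power_mult_distrib)
  also have "suminf \<dots> = - (9 ^ n) * ?P n"
    by (rule suminf_mult[OF s1])
  finally have P: "?P (Suc n) = 1 - 9 ^ n * ?P n" by simp
  have "(\<lambda>k. theta_coeff k * (1 / 9 ^ Suc k) ^ Suc n) = (\<lambda>k. - (9 ^ n) * (theta_coeff (Suc k) * (1 / 9 ^ Suc (Suc k)) ^ n))"
    using power_mult_distrib[of "9::real" 9 n] by (simp add: fun_eq_iff power_mult_distrib divide_simps)
  then have "?N (Suc n) = (\<Sum>k. - (9 ^ n) * (theta_coeff (Suc k) * (1 / 9 ^ Suc (Suc k)) ^ n))" by simp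
  also have "\<dots> = - (9 ^ n) * (\<Sum>k. theta_coeff (Suc k) * (1 / 9 ^ Suc (Suc k)) ^ n)"
    by (rule suminf_mult) (use s2[of n] summable_Suc_iff[of "\<lambda>k. theta_coeff k * (1 / 9 ^ Suc k) ^ n"] in blast)
  also have "(\<Sum>k. theta_coeff (Suc k) * (1 / 9 ^ Suc (Suc k)) ^ n) = ?N n - (1 / 9) ^ n"
    using suminf_split_head[OF s2[of n]] by simp
  also have "- (9 ^ n) * (?N n - (1 / 9) ^ n) = 1 - 9 ^ n * ?N n"
    by (simp add: algebra_simps power_mult_distrib[symmetric])
  finally show ?case using P Suc by simp
qed simp

text \<open>
  Divide the coefficient of index \<open>k\<close> by \<open>1 + 9 ^ k\<close> and let \<open>M n\<close> be the \<open>n\<close>-th moment of the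
  result with respect to the dilations \<open>9 ^ k = (3 ^ k)\<^sup>2\<close>. Then \<open>M (n + 1) + M n\<close> is the
  vanishing theta series, so the moments alternate, and \<open>M 0\<close> is nonzero because its leading term
  dominates. The two halves \<open>k \<ge> 0\<close> and \<open>k < 0\<close> are interleaved into one sequence.
\<close>

lemma alternating_moments:
  obtains c b where "rapid c b" "\<And>n. (\<Sum>i. c i * b i ^ (2 * n)) = (- 1) ^ n"
proof -
  define a where "a k = theta_coeff k / (1 + 9 ^ k)" for k
  define d where "d k = - theta_coeff k / (1 + 1 / 9 ^ Suc k)" for k
  define c0 where "c0 i = (if even i then a (i div 2) else d ((i - 1) div 2))" for i
  define b :: "nat \<Rightarrow> real" where "b i = (if even i then 3 ^ (i div 2) else 1 / 3 ^ Suc ((i - 1) div 2))" for i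
  have a_bd: "\<bar>(3 ^ k) ^ m / (1 + 9 ^ k)\<bar> \<le> ((9::real) ^ k) ^ m" for k m :: nat
  proof -
    have "(3 ^ k) ^ m / (1 + 9 ^ k) \<le> ((9::real) ^ k) ^ m / 1"
      by (intro frac_le power_mono) auto
    then show ?thesis by (subst abs_of_nonneg) auto
  qed
  have d_bd: "\<bar>(1 / 3 ^ Suc k) ^ m / (1 + 1 / 9 ^ Suc k)\<bar> \<le> ((9::real) ^ k) ^ 0" for k m :: nat
  proof -
    have "(1 / 3 ^ Suc k) ^ m / (1 + 1 / 9 ^ Suc k) \<le> (1::real) / 1"
      by (intro frac_le power_le_one) (simp_all add: one_le_power del: power_Suc)
    then show ?thesis by (subst abs_of_nonneg) auto
  qed
  have sa: "summable (\<lambda>k. \<bar>a k * (3 ^ k) ^ m\<bar>)" "summable (\<lambda>k. a k * (3 ^ k) ^ m)" for m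
    using theta_summable_bounded[OF a_bd[of _ m]] by (simp_all add: a_def)
  have sd: "summable (\<lambda>k. \<bar>d k * (1 / 3 ^ Suc k) ^ m\<bar>)" "summable (\<lambda>k. d k * (1 / 3 ^ Suc k) ^ m)" for m
    using theta_summable_bounded[OF d_bd[of _ m]] by (simp_all add: d_def abs_mult summable_minus_iff)
  have c0_eq: "c0 i * b i ^ m = (if even i then a (i div 2) * (3 ^ (i div 2)) ^ m
      else d ((i - 1) div 2) * (1 / 3 ^ Suc ((i - 1) div 2)) ^ m)" for i m
    by (simp add: c0_def b_def)
  have sums: "(\<lambda>i. c0 i * b i ^ m) sums ((\<Sum>k. d k * (1 / 3 ^ Suc k) ^ m) + (\<Sum>k. a k * (3 ^ k) ^ m))" for m
    unfolding c0_eq by (rule sums_if[OF summable_sums[OF sd(2)] summable_sums[OF sa(2)]])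
  have rap0: "rapid c0 b"
    unfolding rapid_def
  proof
    fix m
    have "(\<lambda>i. \<bar>c0 i * b i ^ m\<bar>) = (\<lambda>i. if even i then \<bar>a (i div 2) * (3 ^ (i div 2)) ^ m\<bar>
      else \<bar>d ((i - 1) div 2) * (1 / 3 ^ Suc ((i - 1) div 2)) ^ m\<bar>)"
      unfolding c0_eq by auto
    then show "summable (\<lambda>i. \<bar>c0 i * b i ^ m\<bar>)"
      using sums_if[OF summable_sums[OF sd(1)[of m]] summable_sums[OF sa(1)[of m]]] by (simp add: sums_iff)
  qed
  define M where "M n = (\<Sum>i. c0 i * b i ^ (2 * n))" for n
  have M: "M n = (\<Sum>k. d k * (1 / 3 ^ Suc k) ^ (2 * n)) + (\<Sum>k. a k * (3 ^ k) ^ (2 * n))" for n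
    unfolding M_def using sums[of "2 * n"] by (simp add: sums_iff)
  have Suc: "M (Suc n) = - M n" for n
  proof -
    have "(\<Sum>k. a k * (3 ^ k) ^ (2 * Suc n)) + (\<Sum>k. a k * (3 ^ k) ^ (2 * n))
        = (\<Sum>k. a k * (3 ^ k) ^ (2 * Suc n) + a k * (3 ^ k) ^ (2 * n))"
      by (rule suminf_add[OF sa(2) sa(2)])
    also have "\<dots> = (\<Sum>k. theta_coeff k * (9 ^ k) ^ n)"
    proof (rule suminf_cong)
      fix k :: nat
      have "(3 ^ k) ^ (2 * n) = ((9::real) ^ k) ^ n" for n
      proof -
        have "(3 ^ k) ^ 2 = (9::real) ^ k"
          by (simp add: power2_eq_square power_mult_distrib[symmetric])
        then show ?thesis by (simp only: power_mult)
      qed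
      then show "a k * (3 ^ k) ^ (2 * Suc n) + a k * (3 ^ k) ^ (2 * n) = theta_coeff k * (9 ^ k) ^ n"
        by (simp only: a_def) (simp add: divide_simps add_pos_pos less_imp_neq[symmetric] algebra_simps)
    qed
    finally have A: "(\<Sum>k. a k * (3 ^ k) ^ (2 * Suc n)) + (\<Sum>k. a k * (3 ^ k) ^ (2 * n)) = (\<Sum>k. theta_coeff k * (9 ^ k) ^ n)" .
    have "(\<Sum>k. d k * (1 / 3 ^ Suc k) ^ (2 * Suc n)) + (\<Sum>k. d k * (1 / 3 ^ Suc k) ^ (2 * n))
        = (\<Sum>k. d k * (1 / 3 ^ Suc k) ^ (2 * Suc n) + d k * (1 / 3 ^ Suc k) ^ (2 * n))"
      by (rule suminf_add[OF sd(2) sd(2)])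
    also have "\<dots> = (\<Sum>k. - (theta_coeff k * (1 / 9 ^ Suc k) ^ n))"
    proof (rule suminf_cong)
      fix k :: nat
      define y :: real where "y = 1 / 9 ^ Suc k"
      have y: "(1 / 3 ^ Suc k) ^ (2 * n) = y ^ n" for n
      proof -
        have "(1 / 3 ^ Suc k) ^ 2 = (y::real)"
          by (simp add: y_def power2_eq_square power_mult_distrib[symmetric])
        then show ?thesis by (simp add: power_mult)
      qed
      have "y > 0" by (simp add: y_def)
      then have "- t / (1 + y) * (y * z) + - t / (1 + y) * z = - (t * z)" for t z
        by (simp add: add_pos_pos less_imp_neq[symmetric] divide_simps) (simp add: algebra_simps)
      then show "d k * (1 / 3 ^ Suc k) ^ (2 * Suc n) + d k * (1 / 3 ^ Suc k) ^ (2 * n) = - (theta_coeff k * (1 / 9 ^ Suc k) ^ n)"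
        unfolding d_def y unfolding y_def[symmetric] power_Suc[of y] by blast
    qed
    also have "\<dots> = - (\<Sum>k. theta_coeff k * (1 / 9 ^ Suc k) ^ n)"
      by (rule suminf_minus, rule theta_summable_negative)
    finally show ?thesis
      using A theta_bilateral_sum[of n] unfolding M by linarith
  qed
  have M_pow: "M n = (- 1) ^ n * M 0" for n
    by (induction n) (simp_all add: Suc)
  have "M 0 \<noteq> 0"
  proof -
    define e where "e k = d k + a k" for k
    have e: "M 0 = suminf e" "summable e"
      using suminf_add[OF sd(2)[of 0] sa(2)[of 0]] summable_add[OF sd(2)[of 0] sa(2)[of 0]]
      by (simp_all add: M e_def[abs_def])
    have e0: "e 0 = - 2 / 5" by (simp add: e_def a_def d_def)
    have bd: "\<bar>e k\<bar> \<le> (1 / 9) ^ k" for k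
    proof -
      define x y :: real where "x = 1 / (1 + 9 ^ k)" and "y = 1 / (1 + 1 / 9 ^ Suc k)"
      have xy: "0 \<le> x" "x \<le> 1" "0 \<le> y" "y \<le> 1"
        by (auto simp: x_def y_def divide_simps add_pos_pos)
      have "e k = theta_coeff k * (x - y)"
        by (simp add: e_def a_def d_def x_def y_def right_diff_distrib)
      then have "\<bar>e k\<bar> \<le> \<bar>theta_coeff k\<bar> * 1"
        using xy by (simp only: abs_mult) (intro mult_left_mono, auto)
      then show ?thesis using theta_coeff_bound[of k] by (simp add: power_one_over)
    qed
    have geo: "(\<lambda>k. (1 / 9) ^ Suc k) sums (1 / 8 :: real)"
      using sums_mult[OF geometric_sums[of "1 / 9 :: real"], of "1 / 9"] by simp
    have "\<bar>\<Sum>k. e (Suc k)\<bar> \<le> (\<Sum>k. (1 / 9) ^ Suc k)"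
      using norm_suminf_le[of "\<lambda>k. e (Suc k)" "\<lambda>k. (1 / 9) ^ Suc k"] bd[of "Suc _"] geo
      unfolding real_norm_def sums_iff by blast
    then have "\<bar>\<Sum>k. e (Suc k)\<bar> \<le> 1 / 8" using geo by (simp add: sums_iff)
    then show ?thesis
      using suminf_split_head[OF e(2)] e(1) e0 by (auto simp: abs_le_iff)
  qed
  show ?thesis
  proof (rule that[of "\<lambda>i. c0 i / M 0" b])
    show "rapid (\<lambda>i. c0 i / M 0) b"
      using rap0 by (auto simp: rapid_def abs_mult intro!: summable_divide)
    have "(\<lambda>i. c0 i / M 0 * b i ^ (2 * n)) sums (M n / M 0)" for n
      using sums_divide[OF sums[of "2 * n"], of "M 0"] by (simp add: M)
    then show "(\<Sum>i. c0 i / M 0 * b i ^ (2 * n)) = (- 1) ^ n" for n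
      using \<open>M 0 \<noteq> 0\<close> M_pow[of n] by (simp add: sums_iff)
  qed
qed

section \<open>Whitney's theorem on even functions\<close>

lemma translation_derivative:
  fixes g :: "real \<times> real \<Rightarrow> real"
  assumes V: "open V" "p \<in> V" and g: "smooth_on V g" and tV: "\<And>q. q \<in> V \<Longrightarrow> q + c \<in> V"
    and per: "\<And>q. q \<in> V \<Longrightarrow> g (q + c) = g q"
  shows "der g (p + c) = der g p"
proof -
  have d: "((\<lambda>q. q + c) has_derivative (\<lambda>v. v)) (at p)"
    by (auto intro!: derivative_eq_intros)
  have "((\<lambda>q. g (q + c)) has_derivative der g (p + c)) (at p)"
    using has_derivative_compose[OF d smooth_onD[OF g tV[OF V(2)]]] .
  then have "(g has_derivative der g (p + c)) (at p)"
    by (rule has_derivative_transform_within_open[OF _ V]) (rule per)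
  then show ?thesis using smooth_onD[OF g V(2)] by (rule has_derivative_unique)
qed

lemma periodic_values:
  assumes "\<And>w. f (w + 2 * pi) = f w"
  obtains w' where "0 \<le> w'" "w' \<le> 2 * pi" "f w' = f w"
proof -
  have n: "f (w + 2 * pi * real n) = f w" for w n
  proof (induction n)
    case (Suc n)
    have "f (w + 2 * pi * real (Suc n)) = f ((w + 2 * pi * real n) + 2 * pi)" by (simp add: algebra_simps)
    also have "\<dots> = f w" using assms[of "w + 2 * pi * real n"] Suc by simp
    finally show ?case .
  qed simp
  define k where "k = \<lfloor>w / (2 * pi)\<rfloor>"
  define w' where "w' = w - 2 * pi * of_int k"
  have "of_int k \<le> w / (2 * pi)" "w / (2 * pi) \<le> of_int k + 1" by (auto simp: k_def)
  then have "0 \<le> w'" "w' \<le> 2 * pi" by (auto simp: w'_def field_simps)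
  moreover have "f w' = f w"
  proof (cases "k \<ge> 0")
    case True
    then have "w = w' + 2 * pi * real (nat k)" by (simp add: w'_def)
    then show ?thesis using n by metis
  next
    case False
    then have "w' = w + 2 * pi * real (nat (- k))" by (simp add: w'_def)
    then show ?thesis using n by metis
  qed
  ultimately show ?thesis using that by blast
qed

text \<open>
  A periodic function takes all its values on a compact set, and so do its derivatives. Shrinking
  the base interval from \<open>e\<close> to \<open>d\<close> provides compactness in the other variable.
\<close>

lemma bsmooth_periodic:
  assumes f: "smooth_on ({-e<..<e} \<times> UNIV) f" and de: "d < e"
    and per: "\<And>s w. \<bar>s\<bar> < e \<Longrightarrow> f (s, w + 2 * pi) = f (s, w)"
  shows "bsmooth ({-d<..<d} \<times> UNIV) f"
proof -
  have "smooth_on ({-e<..<e} \<times> UNIV) f \<and> (\<forall>s w. \<bar>s\<bar> < e \<longrightarrow> f (s, w + 2 * pi) = f (s, w))"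
    using f per by blast
  then show ?thesis
  proof (coinduction arbitrary: f)
    case (bsmooth f)
    let ?V = "{-e<..<e} \<times> UNIV :: (real \<times> real) set" and ?U = "{-d<..<d} \<times> UNIV :: (real \<times> real) set"
    from bsmooth have f: "smooth_on ?V f" and per: "\<And>s w. \<bar>s\<bar> < e \<Longrightarrow> f (s, w + 2 * pi) = f (s, w)" by auto
    have "continuous_on ({-d..d} \<times> {0..2 * pi}) f"
      by (rule continuous_on_subset[OF smooth_on_continuous[OF f]]) (use de in auto)
    then have "compact (f ` ({-d..d} \<times> {0..2 * pi}))"
      by (rule compact_continuous_image) (intro compact_Times compact_Icc)
    from compact_imp_bounded[OF this] obtain B where "\<forall>x\<in>f ` ({-d..d} \<times> {0..2 * pi}). norm x \<le> B"
      unfolding bounded_iff by blast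
    then have B: "\<bar>f p\<bar> \<le> B" if "p \<in> {-d..d} \<times> {0..2 * pi}" for p
      using that unfolding real_norm_def by blast
    have bd: "\<bar>f p\<bar> \<le> B" if p: "p \<in> ?U" for p
    proof -
      obtain s w where sw: "p = (s, w)" "\<bar>s\<bar> < d" using p by auto
      have "\<And>w. f (s, w + 2 * pi) = f (s, w)" using per sw(2) de by auto
      then obtain w' where "0 \<le> w'" "w' \<le> 2 * pi" "f (s, w') = f (s, w)"
        by (rule periodic_values[of "\<lambda>w. f (s, w)"])
      moreover have "(s, w') \<in> {-d..d} \<times> {0..2 * pi}" using calculation(1,2) sw(2) by auto
      ultimately show ?thesis using B sw(1) by metis
    qed
    have tr: "der f (s, w + 2 * pi) = der f (s, w)" if s: "\<bar>s\<bar> < e" for s w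
    proof -
      have "der f ((s, w) + (0, 2 * pi)) = der f (s, w)"
        by (rule translation_derivative[of ?V]) (use s f per in \<open>auto intro!: open_Times\<close>)
      then show ?thesis by simp
    qed
    have sm: "smooth_on ?U f" by (rule smooth_on_subset[OF f]) (use de in auto)
    have smV: "smooth_on ?V (\<lambda>p. der f p v)" for v by (rule smooth_on_frechet[OF f])
    have trv: "\<forall>s w. \<bar>s\<bar> < e \<longrightarrow> der f (s, w + 2 * pi) v = der f (s, w) v" for v
      by (simp add: tr)
    have X: "\<exists>h. (\<lambda>p. der f p v) = h \<and> smooth_on ?V h
        \<and> (\<forall>s w. \<bar>s\<bar> < e \<longrightarrow> h (s, w + 2 * pi) = h (s, w))" for v
      using smV[of v] trv[of v] by blast
    show ?case
      by (rule exI[of _ f], rule exI[of _ B], intro conjI disjI1 allI impI refl sm bd X)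
  qed
qed

lemma strip_box: "strip ({-d<..<d} \<times> UNIV)"
  unfolding strip_def by (auto intro!: open_Times convex_Times)

text \<open>
  The substitution \<open>w \<mapsto> (r / 4) sin w\<close> keeps evenness, is defined for all \<open>w\<close>, and makes all
  derivatives bounded, so that arbitrarily large dilations become harmless.
\<close>

lemma even_periodic_extension:
  fixes V :: "real \<times> real \<Rightarrow> real"
  assumes V: "smooth_on (ball (0, 0) r) V" and r: "r > 0"
    and ev: "\<And>s w. (s, w) \<in> ball (0, 0) r \<Longrightarrow> V (s, - w) = V (s, w)"
  obtains E where "smooth_on ({- r / 4<..<r / 4} \<times> UNIV) E"
    "\<And>s w. \<bar>s\<bar> < r / 4 \<Longrightarrow> E (s, w\<^sup>2) = V (s, r / 4 * sin w)"
proof -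
  obtain c b where c: "rapid c b" "\<And>n. (\<Sum>i. c i * b i ^ (2 * n)) = (- 1) ^ n"
    using alternating_moments by blast
  define g where "g p = V (fst p, r / 4 * sin (snd p))" for p
  have inball: "(s, r / 4 * sin w) \<in> ball (0, 0) r" if "\<bar>s\<bar> < r / 2" for s w
  proof -
    have "norm (s, r / 4 * sin w) \<le> \<bar>s\<bar> + \<bar>r / 4 * sin w\<bar>" by (rule order_trans[OF norm_Pair_le]) simp
    also have "\<bar>r / 4 * sin w\<bar> \<le> r / 4" using r by (simp add: abs_mult)
    finally show ?thesis using that r by (simp add: dist_norm norm_minus_commute norm_Pair)
  qed
  let ?U = "{-(r/4)<..<r/4} \<times> UNIV :: (real \<times> real) set" and ?V = "{-(r/2)<..<r/2} \<times> UNIV :: (real \<times> real) set"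
  have oV: "open ?V" by (intro open_Times) auto
  have "smooth_on ?V g"
    unfolding g_def
  proof (rule smooth_on_compose[OF V oV open_ball])
    show "smooth_on ?V (\<lambda>p. (fst p, r / 4 * sin (snd p)))" by (intro smooth_intros oV)
    show "(\<lambda>p. (fst p, r / 4 * sin (snd p))) ` ?V \<subseteq> ball (0, 0) r"
    proof clarify
      fix s w assume "s \<in> {- (r / 2)<..<r / 2}"
      then have "\<bar>s\<bar> < r / 2" by auto
      then show "(fst (s, w), r / 4 * sin (snd (s, w))) \<in> ball (0, 0) r"
        using inball by (simp only: fst_conv snd_conv)
    qed
  qed
  then have g: "bsmooth ?U g"
    by (rule bsmooth_periodic) (use r in \<open>auto simp: g_def\<close>)
  have gev: "g (fst q, - snd q) = g q" if "q \<in> ?U" for q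
    using ev[OF inball[of "fst q" "snd q"]] that r by (auto simp: g_def abs_less_iff)
  \<comment> \<open>The dilations act on the unbounded variable of the periodic function \<open>g\<close>, not on that of \<open>V\<close>.\<close>
  have E: "smooth_on ?U (glue g (dil_series c b g))"
    by (rule smooth_on_glue[OF strip_box g _ c]) (rule gev)
  have ax: "g (s, 0) = dil_series c b g (s, 0)" for s
  proof -
    have "(\<Sum>i. c i * g (s, 0)) = (\<Sum>i. c i) * g (s, 0)"
      by (rule suminf_mult2[symmetric], rule summable_rabs_cancel, rule rapid_summable[OF c(1)])
    then show ?thesis using c(2)[of 0] by (simp add: dil_series_def)
  qed
  have "glue g (dil_series c b g) (s, w\<^sup>2) = V (s, r / 4 * sin w)" if "\<bar>s\<bar> < r / 4" for s w
  proof -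
    have "g (s, \<bar>w\<bar>) = g (s, w)"
    proof (cases "w \<ge> 0")
      case False
      have "(s, w) \<in> ?U" using that by auto
      then show ?thesis using gev[of "(s, w)"] False by simp
    qed simp
    then show ?thesis using glue_square[of g s "dil_series c b g" w, OF ax] by (simp add: g_def)
  qed
  then show ?thesis using that E by auto
qed

text \<open>
  It remains to undo the substitution of the sine. Applied to \<open>w\<^sup>2\<close>, the preceding lemma shows
  that \<open>\<delta>\<^sup>2 sin\<^sup>2 w\<close> is a smooth function of \<open>w\<^sup>2\<close> with derivative \<open>\<delta>\<^sup>2\<close> at the origin; its local
  inverse turns a function of \<open>w\<^sup>2\<close> into one of \<open>\<delta>\<^sup>2 sin\<^sup>2 w\<close>.
\<close>

theorem whitney_even:
  fixes V :: "real \<times> real \<Rightarrow> real"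
  assumes V: "smooth_germ (0, 0) V" and ev: "\<forall>\<^sub>F p in nhds (0, 0). V (fst p, - snd p) = V p"
  obtains E where "smooth_germ (0, 0) E" "\<forall>\<^sub>F p in nhds (0, 0). E (fst p, (snd p)\<^sup>2) = V p"
proof -
  obtain r1 where r1: "r1 > 0" "smooth_on (ball (0, 0) r1) V" using smooth_germ_ball[OF V] .
  obtain r2 where r2: "r2 > 0" "\<And>p. p \<in> ball (0, 0) r2 \<Longrightarrow> V (fst p, - snd p) = V p"
    using ev unfolding eventually_nhds_metric by (auto simp: dist_commute)
  define r where "r = min r1 r2"
  have r: "r > 0" using r1 r2 by (simp add: r_def)
  define \<delta> where "\<delta> = r / 4"
  have \<delta>: "\<delta> > 0" using r by (simp add: \<delta>_def)
  obtain E1 where E1: "smooth_on ({- r / 4<..<r / 4} \<times> UNIV) E1"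
    "\<And>s w. \<bar>s\<bar> < r / 4 \<Longrightarrow> E1 (s, w\<^sup>2) = V (s, r / 4 * sin w)"
    by (rule even_periodic_extension[of r V])
      (use r r1 r2(2)[of "(_, _)"] in \<open>auto simp: r_def intro: smooth_on_subset\<close>)
  obtain E0 where E0: "smooth_on ({- r / 4<..<r / 4} \<times> UNIV) E0"
    "\<And>s w. \<bar>s\<bar> < r / 4 \<Longrightarrow> E0 (s, w\<^sup>2) = (\<lambda>p. (snd p)\<^sup>2) (s, r / 4 * sin w)"
    by (rule even_periodic_extension[of r "\<lambda>p. (snd p)\<^sup>2"])
      (use r in \<open>auto intro!: smooth_intros\<close>)
  have oB: "open ({- r / 4<..<r / 4} \<times> UNIV :: (real \<times> real) set)" "(0, 0) \<in> {- r / 4<..<r / 4} \<times> (UNIV :: real set)"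
    using r by (auto intro!: open_Times)
  have sE: "smooth_germ (0, 0) E1" "smooth_germ (0, 0) E0"
    using smooth_germI[OF E1(1) oB] smooth_germI[OF E0(1) oB] by auto
  have E0s: "E0 (s, w\<^sup>2) = (\<delta> * sin w)\<^sup>2" if "\<bar>s\<bar> < \<delta>" for s w
    using E0(2)[of s w] that by (simp add: \<delta>_def)
  have E00: "E0 (0, 0) = 0" using E0s[of 0 0] \<delta> by simp
  have dE0: "dw E0 (0, 0) = \<delta>\<^sup>2"
  proof -
    have d: "((\<lambda>y. (0::real, y)) has_derivative (\<lambda>v. (0, v))) (at 0)"
      by (auto intro!: derivative_eq_intros)
    have "((\<lambda>y. E0 (0, y)) has_field_derivative dw E0 (0, 0)) (at 0)"
      unfolding has_field_derivative_def
      by (rule has_derivative_eq_rhs[OF has_derivative_compose[OF d has_derivative_plane[OF smooth_germ_derivative[OF sE(2)]]]])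
        (simp add: fun_eq_iff)
    then have "((\<lambda>y. E0 (0, y) / y) \<longlongrightarrow> dw E0 (0, 0)) (at 0)"
      unfolding has_field_derivative_iff by (simp add: E00)
    moreover have "filterlim (\<lambda>w::real. w\<^sup>2) (at 0) (at 0)"
      unfolding filterlim_at
      by (auto intro!: tendsto_eq_intros simp: eventually_at_filter)
    ultimately have "((\<lambda>w. E0 (0, w\<^sup>2) / w\<^sup>2) \<longlongrightarrow> dw E0 (0, 0)) (at 0)"
      by (rule filterlim_compose)
    then have 1: "((\<lambda>w. \<delta>\<^sup>2 * (sin w / w)\<^sup>2) \<longlongrightarrow> dw E0 (0, 0)) (at 0)"
      using \<delta> by (simp add: E0s power_mult_distrib power_divide)
    have "((\<lambda>w::real. sin w / w) \<longlongrightarrow> 1) (at 0)"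
      using DERIV_sin[of "0::real"] unfolding has_field_derivative_iff by simp
    then have "((\<lambda>w. \<delta>\<^sup>2 * (sin w / w)\<^sup>2) \<longlongrightarrow> \<delta>\<^sup>2 * 1\<^sup>2) (at 0)"
      by (intro tendsto_intros)
    with 1 show ?thesis
      using tendsto_unique[OF trivial_limit_at] by fastforce
  qed
  define \<Phi> where "\<Phi> p = (fst p, E0 p)" for p
  have s\<Phi>: "smooth_germ (0, 0) \<Phi>" unfolding \<Phi>_def by (intro germ_intros sE)
  have "(\<Phi> has_derivative (\<lambda>v. (fst v, fst v * ds E0 (0, 0) + snd v * dw E0 (0, 0)))) (at (0, 0))"
    unfolding \<Phi>_def[abs_def]
    by (intro has_derivative_Pair has_derivative_plane smooth_germ_derivative sE) (auto intro!: derivative_eq_intros)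
  then have "der \<Phi> (0, 0) = (\<lambda>v. (fst v, fst v * ds E0 (0, 0) + snd v * dw E0 (0, 0)))"
    by (rule frechet_derivative_at[symmetric])
  then have "inj (der \<Phi> (0, 0))"
    using \<delta> by (auto simp: inj_def dE0)
  from inverse_function_smooth[OF s\<Phi> this] have "diffeo_germ \<Phi> (0, 0) (0, 0)"
    by (simp add: \<Phi>_def E00)
  then obtain \<Psi> where \<Psi>: "diffeo_germ \<Psi> (0, 0) (0, 0)" "\<forall>\<^sub>F p in nhds (0, 0). \<Psi> (\<Phi> p) = p"
    by (rule diffeo_germE)
  define W where "W p = (fst p, (arcsin (snd p / \<delta>))\<^sup>2)" for p :: "real \<times> real"
  have "isCont (\<lambda>p. arcsin (snd p / \<delta>)) (0::real, 0)"
    by (rule isCont_o2[where g = arcsin]) (use \<delta> in \<open>auto intro!: continuous_intros isCont_arcsin\<close>)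
  then have "isCont W (0, 0)"
    unfolding W_def by (intro continuous_intros)
  then have "(W \<longlongrightarrow> (0, 0)) (nhds (0, 0))"
    using tendsto_nhds_iff[of W "(0, 0)" "(0, 0)"] by (simp add: isCont_def W_def)
  then have ev1: "\<forall>\<^sub>F p in nhds (0, 0). \<Psi> (\<Phi> (W p)) = W p"
    by (rule eventually_compose_filterlim[OF \<Psi>(2)])
  have ev2: "\<forall>\<^sub>F p in nhds (0, 0). p \<in> ({-\<delta><..<\<delta>} \<times> {-\<delta><..<\<delta>} :: (real \<times> real) set)"
    using \<delta> by (intro eventually_nhds_in_open open_Times) auto
  show ?thesis
  proof (rule that[of "\<lambda>p. E1 (\<Psi> p)"])
    show "smooth_germ (0, 0) (\<lambda>p. E1 (\<Psi> p))"
      using smooth_germ_compose[OF sE(1) diffeo_germ_base[OF \<Psi>(1)] diffeo_germ_smooth[OF \<Psi>(1)]] .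
    show "\<forall>\<^sub>F p in nhds (0, 0). E1 (\<Psi> (fst p, (snd p)\<^sup>2)) = V p"
      using ev1 ev2
    proof eventually_elim
      case (elim p)
      let ?w = "arcsin (snd p / \<delta>)"
      have p: "\<bar>fst p\<bar> < \<delta>" "\<bar>snd p\<bar> < \<delta>" using elim(2) by (auto simp: mem_Times_iff)
      have s: "\<delta> * sin ?w = snd p"
        using p(2) \<delta> by (subst sin_arcsin) (auto simp: field_simps abs_less_iff)
      have "\<Phi> (W p) = (fst p, (snd p)\<^sup>2)"
        using E0s[OF p(1), of ?w] by (simp add: \<Phi>_def W_def s)
      then have "\<Psi> (fst p, (snd p)\<^sup>2) = W p" using elim(1) by simp
      then show ?case
        using E1(2)[of "fst p" ?w] p(1) s by (simp add: W_def \<delta>_def)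
    qed
  qed
qed

section \<open>A planar normal form\<close>

lemma germ_fibre_integration:
  assumes h: "smooth_germ (0, 0) h" and k: "smooth_germ (0, 0) k"
    and dw: "\<forall>\<^sub>F q in nhds (0, 0). dw h q = snd q ^ j * k q"
  shows "\<forall>\<^sub>F p in nhds (0, 0). h p = h (fst p, 0) + snd p ^ Suc j * dil_int j k p"
proof -
  obtain r1 where r1: "r1 > 0" "smooth_on (ball (0, 0) r1) h" using smooth_germ_ball[OF h] .
  obtain r2 where r2: "r2 > 0" "smooth_on (ball (0, 0) r2) k" using smooth_germ_ball[OF k] .
  obtain r3 where r3: "r3 > 0" "\<And>p. p \<in> ball (0, 0) r3 \<Longrightarrow> dw h p = snd p ^ j * k p"
    using dw unfolding eventually_nhds_metric by (auto simp: dist_commute)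
  define r where "r = min r1 (min r2 r3)"
  have r: "r > 0" using r1 r2 r3 by (simp add: r_def)
  have "h p = h (fst p, 0) + snd p ^ Suc j * dil_int j k p" if p: "p \<in> ball (0, 0) r" for p
  proof (rule fibre_integration[OF fibre_star_ball _ _ _ p])
    show "smooth_on (ball (0, 0) r) h" by (rule smooth_on_subset[OF r1(2)]) (auto simp: r_def)
    show "continuous_on (ball (0, 0) r) k"
      by (rule continuous_on_subset[OF smooth_on_continuous[OF r2(2)]]) (auto simp: r_def)
    show "dw h q = snd q ^ j * k q" if "q \<in> ball (0, 0) r" for q
      by (rule r3(2)) (use that in \<open>simp add: r_def\<close>)
  qed
  then show ?thesis
    using eventually_nhds_in_open[of "ball (0, 0) r" "(0, 0)"] r by (auto elim: eventually_mono)
qed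

definition reflect :: "real \<times> real \<Rightarrow> real \<times> real" where "reflect q = (fst q, - snd q)"

lemma smooth_germ_reflect: "smooth_germ q reflect"
  unfolding reflect_def by (intro germ_intros)

lemma reflect_simps [simp]: "reflect (reflect q) = q" "fst (reflect q) = fst q" "snd (reflect q) = - snd q" "reflect (s, 0) = (s, 0)"
  by (simp_all add: reflect_def)

lemma eventually_reflect:
  assumes "\<forall>\<^sub>F q in nhds (0, 0). P q" shows "\<forall>\<^sub>F q in nhds (0, 0). P (reflect q)"
  by (rule eventually_compose_germ[OF assms smooth_germ_reflect]) simp

lemma dw_reflect:
  assumes "smooth_germ (reflect q) g"
  shows "dw (\<lambda>q. g (reflect q)) q = - dw g (reflect q)"
proof -
  have d: "(reflect has_derivative (\<lambda>v. (fst v, - snd v))) (at q)"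
    unfolding reflect_def[abs_def] by (auto intro!: derivative_eq_intros)
  have "((\<lambda>q. g (reflect q)) has_derivative (\<lambda>v. fst v * ds g (reflect q) + snd v * (- dw g (reflect q)))) (at q)"
    using has_derivative_compose[OF d has_derivative_plane[OF smooth_germ_derivative[OF assms]]] by simp
  then show ?thesis by (rule plane_derivativeD)
qed

lemma smooth_germ_compose_reflect: "smooth_germ (0, 0) g \<Longrightarrow> smooth_germ (0, 0) (\<lambda>q. g (reflect q))"
  by (rule smooth_germ_compose[OF _ _ smooth_germ_reflect]) auto

lemma dw_combine:
  assumes "smooth_germ q g" "smooth_germ q h"
  shows "dw (\<lambda>q. (g q - h q) / 2) q = (dw g q - dw h q) / 2"
proof -
  have "((\<lambda>q. (g q - h q) / 2) has_derivative (\<lambda>v. (der g q v - der h q v) / 2)) (at q)"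
    by (intro bounded_linear.has_derivative[OF bounded_linear_divide] has_derivative_diff smooth_germ_derivative assms)
  from frechet_derivative_at[OF this, symmetric] show ?thesis by simp
qed

text \<open>
  The odd part of \<open>B\<close> is \<open>w C\<close> with \<open>C\<close> even, so the odd part of \<open>K\<close> has derivative \<open>2 e w\<^sup>2 C\<close>
  and is \<open>w\<^sup>3\<close> times an even function with value \<open>2 e (\<partial>B/\<partial>w) / 3\<close> at the origin.
\<close>

lemma cubic_odd_part:
  assumes K: "smooth_germ (0, 0) K" and B: "smooth_germ (0, 0) B"
    and dK: "\<forall>\<^sub>F q in nhds (0, 0). dw K q = 2 * e * snd q * B q"
  obtains E U where "smooth_germ (0, 0) E" "smooth_germ (0, 0) U" "U (0, 0) = 2 * e * dw B (0, 0) / 3"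
    "\<forall>\<^sub>F q in nhds (0, 0). K q = E (fst q, (snd q)\<^sup>2) + snd q ^ 3 * U (fst q, (snd q)\<^sup>2)"
proof -
  define Be where "Be q = (dw B q + dw B (reflect q)) / 2" for q
  define Bo where "Bo q = (B q - B (reflect q)) / 2" for q
  define Ke where "Ke q = (K q + K (reflect q)) / 2" for q
  define Ko where "Ko q = (K q - K (reflect q)) / 2" for q
  define C where "C = dil_int 0 Be"
  define V where "V = dil_int 2 (\<lambda>q. 2 * e * C q)"
  note sr = smooth_germ_compose_reflect
  have sm: "smooth_germ (0, 0) Be" "smooth_germ (0, 0) Bo" "smooth_germ (0, 0) Ke" "smooth_germ (0, 0) Ko"
    unfolding Be_def[abs_def] Bo_def[abs_def] Ke_def[abs_def] Ko_def[abs_def]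
    by (intro germ_intros sr B K smooth_germ_frechet sr[OF smooth_germ_frechet[OF B, of "(0, 1)"]]; simp)+
  have sC: "smooth_germ (0, 0) C" unfolding C_def by (intro germ_intros sm)
  have sV: "smooth_germ (0, 0) V" unfolding V_def by (intro germ_intros sC)
  have evB: "\<forall>\<^sub>F q in nhds (0, 0). smooth_germ q B \<and> smooth_germ (reflect q) B"
    using smooth_germ_eventually_smooth[OF B] eventually_reflect[OF smooth_germ_eventually_smooth[OF B]]
    by (rule eventually_conj)
  have evK: "\<forall>\<^sub>F q in nhds (0, 0). smooth_germ q K \<and> smooth_germ (reflect q) K"
    using smooth_germ_eventually_smooth[OF K] eventually_reflect[OF smooth_germ_eventually_smooth[OF K]]
    by (rule eventually_conj)
  have comp: "smooth_germ q (\<lambda>q. g (reflect q))" if "smooth_germ (reflect q) g" for q and g :: "real \<times> real \<Rightarrow> real"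
    by (rule smooth_germ_compose[OF that refl smooth_germ_reflect])
  have "\<forall>\<^sub>F q in nhds (0, 0). dw Bo q = snd q ^ 0 * Be q"
    using evB by eventually_elim (simp add: Bo_def[abs_def] Be_def dw_combine comp dw_reflect)
  from germ_fibre_integration[OF sm(2,1) this]
  have Bo: "\<forall>\<^sub>F q in nhds (0, 0). Bo q = snd q * C q"
    by (rule eventually_mono) (simp add: C_def Bo_def)
  have "\<forall>\<^sub>F q in nhds (0, 0). dw Ko q = snd q ^ 2 * (2 * e * C q)"
    using evK dK eventually_reflect[OF dK] Bo
  proof eventually_elim
    case (elim q)
    have "dw Ko q = (2 * e * snd q * B q - 2 * e * snd q * B (reflect q)) / 2"
      using elim(1-3) by (simp add: Ko_def[abs_def] dw_combine comp dw_reflect)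
    also have "\<dots> = 2 * e * snd q * Bo q" by (simp add: Bo_def algebra_simps)
    finally show ?case using elim(4) by (simp add: power2_eq_square)
  qed
  from germ_fibre_integration[OF sm(4) _ this]
  have Ko: "\<forall>\<^sub>F q in nhds (0, 0). Ko q = snd q ^ 3 * V q"
    using sC by (simp add: Ko_def V_def germ_intros numeral_3_eq_3)
  have "Be (reflect q) = Be q" for q by (simp add: Be_def)
  then have "C (reflect q) = C q" for q
    unfolding C_def dil_int_def reflect_def by (metis (no_types, lifting) fst_conv mult_minus_right snd_conv)
  then have "V (reflect q) = V q" for q
    unfolding V_def dil_int_def reflect_def by (metis (no_types, lifting) fst_conv mult_minus_right snd_conv)
  then have "\<forall>\<^sub>F p in nhds (0, 0). V (fst p, - snd p) = V p" by (simp add: reflect_def)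
  then obtain U where U: "smooth_germ (0, 0) U" "\<forall>\<^sub>F p in nhds (0, 0). U (fst p, (snd p)\<^sup>2) = V p"
    by (rule whitney_even[OF sV])
  have "Ke (reflect q) = Ke q" for q by (simp add: Ke_def)
  then have "\<forall>\<^sub>F p in nhds (0, 0). Ke (fst p, - snd p) = Ke p" by (simp add: reflect_def)
  then obtain E where E: "smooth_germ (0, 0) E" "\<forall>\<^sub>F p in nhds (0, 0). E (fst p, (snd p)\<^sup>2) = Ke p"
    by (rule whitney_even[OF sm(3)])
  show ?thesis
  proof (rule that[OF E(1) U(1)])
    show "U (0, 0) = 2 * e * dw B (0, 0) / 3"
      using eventually_nhds_x_imp_x[OF U(2)] by (simp add: V_def C_def Be_def dil_int_axis)
    show "\<forall>\<^sub>F q in nhds (0, 0). K q = E (fst q, (snd q)\<^sup>2) + snd q ^ 3 * U (fst q, (snd q)\<^sup>2)"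
      using E(2) U(2) Ko
    proof eventually_elim
      case (elim q)
      have "K q = Ke q + Ko q" by (simp add: Ke_def Ko_def field_simps)
      then show ?case using elim by simp
    qed
  qed
qed

text \<open>
  A Morse lemma with parameter: \<open>G2\<close> differs from its restriction to \<open>w = 0\<close> by \<open>w\<^sup>2 Q\<close> with
  \<open>Q \<noteq> 0\<close>, and \<open>w \<surd>\<bar>Q\<bar>\<close> is a new fibre coordinate. In it \<open>G3\<close> has fibre derivative \<open>\<plusminus> 2 w B\<close>, as
  the previous lemma demands.
\<close>

lemma planar_normal_form:
  assumes G2: "smooth_germ (0, 0) G2" and G3: "smooth_germ (0, 0) G3"
    and \<rho>: "smooth_germ (0, 0) \<rho>" "\<rho> (0, 0) \<noteq> 0" and B: "smooth_germ (0, 0) B" "dw B (0, 0) \<noteq> 0"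
    and dG2: "\<forall>\<^sub>F q in nhds (0, 0). dw G2 q = snd q * \<rho> q"
    and dG3: "\<forall>\<^sub>F q in nhds (0, 0). dw G3 q = B q * dw G2 q"
  obtains \<theta> e E U where "diffeo_germ \<theta> (0, 0) (0, 0)" "e\<^sup>2 = 1"
    "smooth_germ (0, 0) E" "smooth_germ (0, 0) U" "U (0, 0) \<noteq> (0::real)"
    "\<forall>\<^sub>F q in nhds (0, 0). fst (\<theta> q) = fst q"
    "\<forall>\<^sub>F q in nhds (0, 0). G2 q = G2 (fst q, 0) + e * (snd (\<theta> q))\<^sup>2"
    "\<forall>\<^sub>F q in nhds (0, 0). G3 q = E (fst q, (snd (\<theta> q))\<^sup>2) + snd (\<theta> q) ^ 3 * U (fst q, (snd (\<theta> q))\<^sup>2)"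
proof -
  define Q where "Q = dil_int 1 \<rho>"
  have sQ: "smooth_germ (0, 0) Q" unfolding Q_def by (intro germ_intros \<rho>)
  have Q0: "Q (0, 0) \<noteq> 0" using \<rho>(2) by (simp add: Q_def dil_int_axis)
  have G2_eq: "\<forall>\<^sub>F q in nhds (0, 0). G2 q = G2 (fst q, 0) + (snd q)\<^sup>2 * Q q"
    using germ_fibre_integration[OF G2 \<rho>(1), of 1] dG2 by (simp add: Q_def numeral_2_eq_2)
  define e where "e = sgn (Q (0, 0))"
  have e: "e\<^sup>2 = 1" "e * Q (0, 0) > 0" using Q0 by (auto simp: e_def sgn_real_def)
  define R where "R q = sqrt (e * Q q)" for q
  have sR: "smooth_germ (0, 0) R" unfolding R_def by (intro germ_intros sQ e)
  have R0: "R (0, 0) > 0" using e by (simp add: R_def)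
  define \<theta> where "\<theta> q = (fst q, snd q * R q)" for q
  have s\<theta>: "smooth_germ (0, 0) \<theta>" unfolding \<theta>_def by (intro germ_intros sR)
  have "((\<lambda>q. snd q * R q) has_derivative (\<lambda>v. snd v * R (0, 0))) (at (0, 0))"
    by (rule has_derivative_snd_mult[OF smooth_germ_isCont[OF sR]])
  then have "(\<theta> has_derivative (\<lambda>v. (fst v, snd v * R (0, 0)))) (at (0, 0))"
    unfolding \<theta>_def[abs_def] by (intro has_derivative_Pair) (auto intro!: derivative_eq_intros)
  from frechet_derivative_at[OF this, symmetric]
  have "inj (der \<theta> (0, 0))"
    using R0 by (auto simp: inj_def)
  from inverse_function_smooth[OF s\<theta> this] have d\<theta>: "diffeo_germ \<theta> (0, 0) (0, 0)"
    by (simp add: \<theta>_def)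
  obtain \<kappa> where \<kappa>: "diffeo_germ \<kappa> (0, 0) (0, 0)" "\<forall>\<^sub>F q in nhds (0, 0). \<kappa> (\<theta> q) = q"
      "\<forall>\<^sub>F q in nhds (0, 0). \<theta> (\<kappa> q) = q"
    using diffeo_germE[OF d\<theta>] .
  note s\<kappa> = diffeo_germ_smooth[OF \<kappa>(1)] and \<kappa>0 = diffeo_germ_base[OF \<kappa>(1)]
  have fst\<kappa>: "\<forall>\<^sub>F q in nhds (0, 0). fst (\<kappa> q) = fst q"
    using \<kappa>(3) by eventually_elim (metis \<theta>_def fst_conv)
  have G2_eq': "\<forall>\<^sub>F q in nhds (0, 0). G2 q = G2 (fst q, 0) + e * (snd (\<theta> q))\<^sup>2"
  proof -
    have "\<forall>\<^sub>F q in nhds (0, 0). e * Q q > 0"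
      using order_tendstoD(1)[OF smooth_germ_tendsto[OF smooth_germ_mult[OF smooth_germ_const sQ]], of 0 e] e by simp
    then show ?thesis using G2_eq
    proof eventually_elim
      case (elim q)
      have "e * (snd (\<theta> q))\<^sup>2 = (snd q)\<^sup>2 * (e\<^sup>2 * Q q)"
        using elim(1) by (simp add: \<theta>_def R_def power_mult_distrib power2_eq_square)
      then show ?case using elim(2) e by simp
    qed
  qed
  define K3 where "K3 q = G3 (\<kappa> q)" for q
  define K2 where "K2 q = G2 (\<kappa> q)" for q
  define B' where "B' q = B (\<kappa> q)" for q
  have sK: "smooth_germ (0, 0) K3" "smooth_germ (0, 0) K2" "smooth_germ (0, 0) B'"
    unfolding K3_def[abs_def] K2_def[abs_def] B'_def[abs_def]
    using smooth_germ_compose[OF _ \<kappa>0 s\<kappa>] G3 G2 B(1) by auto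
  have dcomp: "dw (\<lambda>q. g (\<kappa> q)) q = snd (der \<kappa> q (0, 1)) * dw g (\<kappa> q)"
    if "smooth_germ q \<kappa>" "smooth_germ (\<kappa> q) g" "\<forall>\<^sub>F q in nhds q. fst (\<kappa> q) = fst q"
    for q and g :: "real \<times> real \<Rightarrow> real"
  proof -
    have "fst (der \<kappa> q (0, 1)) = dw (\<lambda>q. fst (\<kappa> q)) q"
      using frechet_derivative_at[OF has_derivative_fst[OF smooth_germ_derivative[OF that(1)]]] by metis
    also have "\<dots> = dw fst q" using frechet_derivative_germ_cong[OF that(3)] by simp
    also have "\<dots> = 0" using fun_cong[OF frechet_derivative_at[OF bounded_linear_imp_has_derivative[OF bounded_linear_fst]], of "(0, 1)" q] by simp
    finally have 0: "fst (der \<kappa> q (0, 1)) = 0" .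
    have "dw (\<lambda>q. g (\<kappa> q)) q = der g (\<kappa> q) (der \<kappa> q (0, 1))"
      by (rule frechet_derivative_compose[OF that(1,2)])
    also have "\<dots> = snd (der \<kappa> q (0, 1)) * dw g (\<kappa> q)"
      using linear_prod_expand[OF frechet_linear[OF that(2)], of "der \<kappa> q (0, 1)"] 0 by simp
    finally show ?thesis .
  qed
  have evf: "\<forall>\<^sub>F q in nhds (0, 0). \<forall>\<^sub>F q in nhds q. fst (\<kappa> q) = fst q"
    using fst\<kappa> by (simp only: eventually_eventually)
  have ev\<kappa>: "\<forall>\<^sub>F q in nhds (0, 0). smooth_germ q \<kappa>" by (rule smooth_germ_eventually_smooth[OF s\<kappa>])
  have K2_eq: "\<forall>\<^sub>F q in nhds (0, 0). K2 q = G2 (fst q, 0) + e * (snd q)\<^sup>2"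
    using eventually_compose_germ[OF G2_eq' s\<kappa> \<kappa>0] \<kappa>(3) fst\<kappa>
    by eventually_elim (simp add: K2_def)
  have dK2: "\<forall>\<^sub>F q in nhds (0, 0). dw K2 q = 2 * e * snd q"
  proof -
    have "\<forall>\<^sub>F q in nhds (0::real, 0::real). smooth_germ (fst q, 0) G2"
      by (rule eventually_compose_germ[where f = "\<lambda>q. (fst q, 0)", OF smooth_germ_eventually_smooth[OF G2]]) (auto intro!: germ_intros)
    then show ?thesis using eventually_frechet_derivative_cong[OF K2_eq]
    proof eventually_elim
      case (elim q)
      have d: "((\<lambda>q. (fst q, 0::real)) has_derivative (\<lambda>v. (fst v, 0))) (at q)"
        by (auto intro!: derivative_eq_intros)
      have "((\<lambda>q. G2 (fst q, 0)) has_derivative (\<lambda>v. fst v * ds G2 (fst q, 0))) (at q)"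
        using has_derivative_compose[OF d has_derivative_plane[OF smooth_germ_derivative[OF elim(1)]]] by simp
      then have "((\<lambda>q. G2 (fst q, 0) + e * (snd q)\<^sup>2) has_derivative (\<lambda>v. fst v * ds G2 (fst q, 0) + snd v * (2 * e * snd q))) (at q)"
        by (auto intro!: derivative_eq_intros)
      from plane_derivativeD(2)[OF this] show ?case using elim(2) by simp
    qed
  qed
  have dK3: "\<forall>\<^sub>F q in nhds (0, 0). dw K3 q = 2 * e * snd q * B' q"
    using dK2 evf ev\<kappa> eventually_compose_germ[OF smooth_germ_eventually_smooth[OF G2] s\<kappa> \<kappa>0]
      eventually_compose_germ[OF smooth_germ_eventually_smooth[OF G3] s\<kappa> \<kappa>0]
      eventually_compose_germ[OF dG3 s\<kappa> \<kappa>0]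
  proof eventually_elim
    case (elim q)
    show ?case
      using dcomp[OF elim(3,4,2)] dcomp[OF elim(3,5,2)] elim(1,6)
      by (simp add: K2_def[abs_def] K3_def[abs_def] B'_def)
  qed
  obtain E U where EU: "smooth_germ (0, 0) E" "smooth_germ (0, 0) U" "U (0, 0) = 2 * e * dw B' (0, 0) / 3"
    "\<forall>\<^sub>F q in nhds (0, 0). K3 q = E (fst q, (snd q)\<^sup>2) + snd q ^ 3 * U (fst q, (snd q)\<^sup>2)"
    using cubic_odd_part[OF sK(1,3) dK3] .
  have "dw B' (0, 0) \<noteq> 0"
  proof -
    have b: "smooth_germ (\<kappa> (0, 0)) B" using B(1) \<kappa>0 by simp
    have 1: "dw B' (0, 0) = snd (der \<kappa> (0, 0) (0, 1)) * dw B (0, 0)"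
      using dcomp[OF s\<kappa> b fst\<kappa>] \<kappa>0 by (simp add: B'_def[abs_def])
    have f: "smooth_germ (\<kappa> (0, 0)) (snd :: real \<times> real \<Rightarrow> real)" by (intro germ_intros)
    have c: "smooth_germ (\<kappa> (0, 0)) \<theta>" using s\<theta> \<kappa>0 by simp
    have "snd (der \<kappa> (0, 0) (0, 1)) \<noteq> 0"
    proof
      assume 0: "snd (der \<kappa> (0, 0) (0, 1)) = 0"
      have sc: "smooth_germ (\<kappa> (0, 0)) (\<lambda>q. snd (\<theta> q))" by (intro germ_intros c)
      have "dw (\<lambda>q. snd (\<theta> (\<kappa> q))) (0, 0) = 0"
        using dcomp[OF s\<kappa> sc fst\<kappa>] 0 by simp
      moreover have "\<forall>\<^sub>F q in nhds (0, 0). snd (\<theta> (\<kappa> q)) = snd q"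
        using \<kappa>(3) by eventually_elim simp
      then have "dw (\<lambda>q. snd (\<theta> (\<kappa> q))) (0, 0) = dw snd (0, 0)"
        using frechet_derivative_germ_cong by metis
      moreover have "dw snd (0, 0) = 1"
        using fun_cong[OF frechet_derivative_at[OF bounded_linear_imp_has_derivative[OF bounded_linear_snd]], of "(0, 1)" "(0, 0)"]
        by simp
      ultimately show False by simp
    qed
    then show ?thesis using 1 B(2) by simp
  qed
  then have U0: "U (0, 0) \<noteq> 0" using EU(3) e by auto
  have fst\<theta>: "\<forall>\<^sub>F q in nhds (0, 0). fst (\<theta> q) = fst q" by (simp add: \<theta>_def)
  have "\<forall>\<^sub>F q in nhds (0, 0). G3 q = E (fst q, (snd (\<theta> q))\<^sup>2) + snd (\<theta> q) ^ 3 * U (fst q, (snd (\<theta> q))\<^sup>2)"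
    using \<kappa>(2) eventually_compose_germ[OF EU(4) s\<theta> diffeo_germ_base[OF d\<theta>]]
  proof eventually_elim
    case (elim q)
    then show ?case by (simp add: K3_def) (simp add: \<theta>_def)
  qed
  then show ?thesis using that d\<theta> e(1) EU(1,2) U0 fst\<theta> G2_eq' by blast
qed

section \<open>The cuspidal edge criterion\<close>

definition cuspidal_edge :: "real^2 \<Rightarrow> real^3" where
  "cuspidal_edge t = vector [t $ 1, (t $ 2)\<^sup>2, (t $ 2) ^ 3]"

definition vec_of_pair :: "real \<times> real \<Rightarrow> real^2" where "vec_of_pair p = vector [fst p, snd p]"

definition pair_of_vec :: "real^2 \<Rightarrow> real \<times> real" where "pair_of_vec t = (t $ 1, t $ 2)"

lemma vec_of_pair_inverse [simp]: "pair_of_vec (vec_of_pair p) = p"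
  and pair_of_vec_inverse [simp]: "vec_of_pair (pair_of_vec t) = t"
  by (simp_all add: vec_of_pair_def pair_of_vec_def vec_eq_iff forall_2)

lemma linear_vec_of_pair: "linear vec_of_pair"
  by (rule linearI) (auto simp: vec_of_pair_def vec_eq_iff forall_2)

lemma linear_pair_of_vec: "linear pair_of_vec"
  by (rule linearI) (auto simp: pair_of_vec_def)

lemma diffeo_vec_of_pair: "diffeo_germ vec_of_pair p (vec_of_pair p)"
  by (rule diffeo_germ_linear[OF linear_vec_of_pair linear_pair_of_vec]) auto

lemma diffeo_pair_of_vec: "diffeo_germ pair_of_vec t (pair_of_vec t)"
  by (rule diffeo_germ_linear[OF linear_pair_of_vec linear_vec_of_pair]) auto

lemma linear_vec2_expand:
  assumes "linear (L :: real^2 \<Rightarrow> 'b::real_vector)"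
  shows "L v = v $ 1 *\<^sub>R L (axis 1 1) + v $ 2 *\<^sub>R L (axis 2 1)"
proof -
  have "v = v $ 1 *\<^sub>R axis 1 1 + v $ 2 *\<^sub>R axis 2 1"
    by (simp add: vec_eq_iff forall_2 axis_def)
  then show ?thesis by (metis linear_add[OF assms] linear_scale[OF assms])
qed

text \<open>
  A vector killed by both differentials is a multiple of \<open>X\<close>, because the kernel of the first one
  is a line containing \<open>X\<close>, and the second differential does not kill \<open>X\<close>.
\<close>

lemma planar_chart:
  fixes f l :: "real^2 \<Rightarrow> real"
  assumes f: "smooth_germ a f" and l: "smooth_germ a l" and X: "der f a X = 0"
    and f1: "der f a v \<noteq> 0" and l1: "der l a X \<noteq> 0"
  shows "diffeo_germ (\<lambda>t. (f t, l t)) a (f a, l a)"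
proof -
  define F where "F p = (f (vec_of_pair p), l (vec_of_pair p))" for p
  let ?b = "pair_of_vec a"
  have va: "vec_of_pair ?b = a" by simp
  note sv = diffeo_germ_smooth[OF diffeo_vec_of_pair]
  have sF: "smooth_germ ?b F"
    unfolding F_def by (intro smooth_germ_Pair smooth_germ_compose[OF f va sv] smooth_germ_compose[OF l va sv])
  have lf: "linear (der f a)" and ll: "linear (der l a)"
    using f l by (auto intro: frechet_linear)
  have dv: "(vec_of_pair has_derivative vec_of_pair) (at ?b)"
    using linear_vec_of_pair by (simp add: linear_imp_has_derivative)
  have "(F has_derivative (\<lambda>w. (der f a (vec_of_pair w), der l a (vec_of_pair w)))) (at ?b)"
    unfolding F_def[abs_def]
    using has_derivative_compose[OF dv, of f "der f a"] has_derivative_compose[OF dv, of l "der l a"]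
      smooth_germ_derivative[OF f] smooth_germ_derivative[OF l]
    by (intro has_derivative_Pair) simp_all
  then have dF: "der F ?b = (\<lambda>w. (der f a (vec_of_pair w), der l a (vec_of_pair w)))"
    by (rule frechet_derivative_at[symmetric])
  have ker: "w = 0" if "der f a w = 0" "der l a w = 0" for w
  proof -
    define p where "p = der f a (axis 1 1)"
    define q where "q = der f a (axis 2 1)"
    define p' where "p' = der l a (axis 1 1)"
    define q' where "q' = der l a (axis 2 1)"
    have ef: "der f a u = u $ 1 * p + u $ 2 * q" for u
      using linear_vec2_expand[OF lf, of u] by (simp add: p_def q_def)
    have el: "der l a u = u $ 1 * p' + u $ 2 * q'" for u
      using linear_vec2_expand[OF ll, of u] by (simp add: p'_def q'_def)
    have pq: "p \<noteq> 0 \<or> q \<noteq> 0" using f1 ef[of v] by auto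
    have X': "X $ 1 * p + X $ 2 * q = 0" "X $ 1 * p' + X $ 2 * q' \<noteq> 0" using X l1 ef el by auto
    have w': "w $ 1 * p + w $ 2 * q = 0" "w $ 1 * p' + w $ 2 * q' = 0" using that ef el by auto
    have "p * (X $ 1 * w $ 2 - X $ 2 * w $ 1) = 0" "q * (X $ 1 * w $ 2 - X $ 2 * w $ 1) = 0"
      using X'(1) w'(1) by algebra+
    then have c: "X $ 1 * w $ 2 = X $ 2 * w $ 1" using pq by auto
    have "w $ 1 * (X $ 1 * p' + X $ 2 * q') = 0" "w $ 2 * (X $ 1 * p' + X $ 2 * q') = 0"
      using c w'(2) by algebra+
    then have "w $ 1 = 0" "w $ 2 = 0" using X'(2) by auto
    then show ?thesis by (simp add: vec_eq_iff forall_2)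
  qed
  have "inj (der F ?b)"
  proof (rule injI)
    fix u w assume eq: "der F ?b u = der F ?b w"
    have "vec_of_pair u - vec_of_pair w = 0"
      by (rule ker) (use eq in \<open>auto simp: dF linear_diff[OF lf] linear_diff[OF ll]\<close>)
    then have "pair_of_vec (vec_of_pair u) = pair_of_vec (vec_of_pair w)" by simp
    then show "u = w" by simp
  qed
  from inverse_function_smooth[OF sF this] have "diffeo_germ F ?b (f a, l a)"
    by (simp add: F_def)
  from diffeo_germ_compose[OF diffeo_pair_of_vec this] show ?thesis
    by (simp add: F_def)
qed

lemma smooth_germ_vf_apply [germ_intros]:
  "smooth_germ a \<eta> \<Longrightarrow> smooth_germ a h \<Longrightarrow> smooth_germ a (vf_apply \<eta> h)"
  unfolding vf_apply_def[abs_def] by (rule smooth_germ_frechet_field)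

text \<open>
  The functions \<open>f1\<close> and \<open>X f2\<close> are coordinates of the source. In these coordinates \<open>X\<close> is a
  multiple of the second coordinate field, with the unit \<open>X (X f2)\<close> as factor, so the hypotheses
  become those of the planar normal form.
\<close>

theorem cuspidal_edge_criterion:
  fixes f1 f2 f3 A :: "real^2 \<Rightarrow> real" and X :: "real^2 \<Rightarrow> real^2"
  assumes f: "smooth_germ a f1" "smooth_germ a f2" "smooth_germ a f3"
    and A: "smooth_germ a A" and X: "smooth_germ a X"
    and Xf1: "\<forall>\<^sub>F t in nhds a. vf_apply X f1 t = 0"
    and Xf3: "\<forall>\<^sub>F t in nhds a. vf_apply X f3 t = A t * vf_apply X f2 t"
    and df1: "der f1 a v \<noteq> 0"
    and Xf2: "vf_apply X f2 a = 0" "vf_apply X (vf_apply X f2) a \<noteq> 0"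
    and XA: "vf_apply X A a \<noteq> 0"
  shows "A_equivalent (\<lambda>t. vector [f1 t, f2 t, f3 t]) a cuspidal_edge 0"
proof -
  define l where "l = vf_apply X f2"
  define c where "c = f1 a"
  have sl: "smooth_germ a l" unfolding l_def by (intro germ_intros X f)
  define \<phi> where "\<phi> t = (f1 t - c, l t)" for t
  have d0: "der (\<lambda>t. f1 t - c) t = der f1 t" if "smooth_germ t f1" for t
    using frechet_derivative_at[OF has_derivative_diff[OF smooth_germ_derivative[OF that] has_derivative_const[of c]]] by simp
  have d\<phi>: "diffeo_germ \<phi> a (0, 0)"
  proof -
    have "der l a (X a) \<noteq> 0"
      using Xf2(2) unfolding l_def[symmetric] vf_apply_def[of X l] .
    then have "diffeo_germ (\<lambda>t. (f1 t - c, l t)) a (f1 a - c, l a)"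
      using eventually_nhds_x_imp_x[OF Xf1] df1
      by (intro planar_chart[where X = "X a" and v = v] germ_intros f sl)
        (simp_all add: d0[OF f(1)] vf_apply_def[of X f1])
    then show ?thesis using Xf2(1) by (simp add: \<phi>_def[abs_def] c_def l_def)
  qed
  note s\<phi> = diffeo_germ_smooth[OF d\<phi>] and \<phi>a = diffeo_germ_base[OF d\<phi>]
  obtain \<psi> where \<psi>: "diffeo_germ \<psi> (0, 0) a" "\<forall>\<^sub>F t in nhds a. \<psi> (\<phi> t) = t" "\<forall>\<^sub>F p in nhds (0, 0). \<phi> (\<psi> p) = p"
    using diffeo_germE[OF d\<phi>] .
  note s\<psi> = diffeo_germ_smooth[OF \<psi>(1)] and \<psi>0 = diffeo_germ_base[OF \<psi>(1)]
  define G2 where "G2 p = f2 (\<psi> p)" for p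
  define G3 where "G3 p = f3 (\<psi> p)" for p
  define B where "B p = A (\<psi> p)" for p
  define m where "m p = vf_apply X l (\<psi> p)" for p
  define \<rho> where "\<rho> p = inverse (m p)" for p
  have sG: "smooth_germ (0, 0) G2" "smooth_germ (0, 0) G3" "smooth_germ (0, 0) B" "smooth_germ (0, 0) m"
    unfolding G2_def[abs_def] G3_def[abs_def] B_def[abs_def] m_def[abs_def]
    by (intro smooth_germ_compose[OF _ \<psi>0 s\<psi>] f A smooth_germ_vf_apply X sl)+
  have m0: "m (0, 0) \<noteq> 0" using Xf2(2) by (simp add: m_def \<psi>0 l_def)
  have s\<rho>: "smooth_germ (0, 0) \<rho>" unfolding \<rho>_def by (intro germ_intros sG m0)
  have m_ev: "\<forall>\<^sub>F p in nhds (0, 0). m p \<noteq> 0"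
    using tendsto_imp_eventually_ne[OF smooth_germ_tendsto[OF sG(4)] m0] .
  \<comment> \<open>The chart \<open>\<phi>\<close> sends \<open>X\<close> to \<open>(0, X l)\<close>, so its inverse sends \<open>(0, 1)\<close> to \<open>X\<close> divided by \<open>m = X l\<close>.\<close>
  have push: "\<forall>\<^sub>F p in nhds (0, 0). m p *\<^sub>R der \<psi> p (0, 1) = X (\<psi> p)"
  proof -
    have 1: "\<forall>\<^sub>F t in nhds a. der \<phi> t (X t) = (0, vf_apply X l t)"
      using Xf1 smooth_germ_eventually_smooth[OF f(1)] smooth_germ_eventually_smooth[OF sl]
    proof eventually_elim
      case (elim t)
      have "(\<phi> has_derivative (\<lambda>w. (der f1 t w - 0, der l t w))) (at t)"
        unfolding \<phi>_def[abs_def]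
        by (intro has_derivative_Pair has_derivative_diff smooth_germ_derivative elim has_derivative_const)
      from frechet_derivative_at[OF this, symmetric] show ?case
        using elim(1) by (simp add: vf_apply_def)
    qed
    have ev: "\<forall>\<^sub>F t in nhds a. der \<psi> (\<phi> t) (der \<phi> t (X t)) = X t"
    proof -
      have "\<forall>\<^sub>F t in nhds a. \<forall>\<^sub>F t in nhds t. \<psi> (\<phi> t) = t" using \<psi>(2) by (simp only: eventually_eventually)
      then show ?thesis
        using smooth_germ_eventually_smooth[OF s\<phi>] eventually_compose_germ[OF smooth_germ_eventually_smooth[OF s\<psi>] s\<phi> \<phi>a]
      proof eventually_elim
        case (elim t)
        have "der (\<lambda>t. \<psi> (\<phi> t)) t = der (\<lambda>t. t) t"
          by (rule frechet_derivative_germ_cong[OF elim(1)])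
        then show ?case using frechet_derivative_compose[OF elim(2,3)] by simp
      qed
    qed
    show ?thesis
      using eventually_compose_germ[OF eventually_conj[OF 1 ev] s\<psi> \<psi>0] \<psi>(3) smooth_germ_eventually_smooth[OF s\<psi>]
    proof eventually_elim
      case (elim p)
      have "der \<psi> p (0, m p) = X (\<psi> p)"
        using conjunct1[OF elim(1)] conjunct2[OF elim(1)] elim(2) by (simp add: m_def)
      then show ?case using linear_scale[OF frechet_linear[OF elim(3)], of "m p" "(0, 1)"] by simp
    qed
  qed
  have dwg: "\<forall>\<^sub>F p in nhds (0, 0). dw (\<lambda>p. g (\<psi> p)) p = \<rho> p * vf_apply X g (\<psi> p)" if g: "smooth_germ a g" for g
    using push m_ev smooth_germ_eventually_smooth[OF s\<psi>] eventually_compose_germ[OF smooth_germ_eventually_smooth[OF g] s\<psi> \<psi>0]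
  proof eventually_elim
    case (elim p)
    have "dw (\<lambda>p. g (\<psi> p)) p = der g (\<psi> p) (der \<psi> p (0, 1))"
      by (rule frechet_derivative_compose[OF elim(3,4)])
    also have "der \<psi> p (0, 1) = \<rho> p *\<^sub>R X (\<psi> p)"
      using elim(1)[symmetric] elim(2) by (simp add: \<rho>_def)
    finally show ?case using linear_scale[OF frechet_linear[OF elim(4)]] by (simp add: vf_apply_def)
  qed
  have dG2: "\<forall>\<^sub>F p in nhds (0, 0). dw G2 p = snd p * \<rho> p"
    using dwg[OF f(2)] \<psi>(3)
  proof eventually_elim
    case (elim p)
    then show ?case unfolding G2_def[abs_def] by (metis \<phi>_def l_def mult.commute snd_conv)
  qed
  have dG3: "\<forall>\<^sub>F p in nhds (0, 0). dw G3 p = B p * dw G2 p"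
    using dwg[OF f(3)] dwg[OF f(2)] eventually_compose_germ[OF Xf3 s\<psi> \<psi>0]
    by eventually_elim (simp add: G2_def[abs_def] G3_def[abs_def] B_def)
  have dB: "dw B (0, 0) \<noteq> 0"
    using eventually_nhds_x_imp_x[OF dwg[OF A]] XA m0 by (simp add: B_def[abs_def] \<psi>0 \<rho>_def)
  have \<rho>0: "\<rho> (0, 0) \<noteq> 0" using m0 by (simp add: \<rho>_def)
  obtain \<theta> e E U where N: "diffeo_germ \<theta> (0, 0) (0, 0)" "e\<^sup>2 = 1"
    "smooth_germ (0, 0) E" "smooth_germ (0, 0) U" "U (0, 0) \<noteq> (0::real)"
    "\<forall>\<^sub>F q in nhds (0, 0). fst (\<theta> q) = fst q"
    "\<forall>\<^sub>F q in nhds (0, 0). G2 q = G2 (fst q, 0) + e * (snd (\<theta> q))\<^sup>2"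
    "\<forall>\<^sub>F q in nhds (0, 0). G3 q = E (fst q, (snd (\<theta> q))\<^sup>2) + snd (\<theta> q) ^ 3 * U (fst q, (snd (\<theta> q))\<^sup>2)"
    using planar_normal_form[OF sG(1,2) s\<rho> \<rho>0 sG(3) dB dG2 dG3] .
  have ee: "e * e = 1" using N(2) by (simp add: power2_eq_square)
  have ee': "e * (e * x) = x" for x using ee by (simp add: mult.assoc[symmetric])
  have \<theta>0: "\<theta> (0, 0) = (0, 0)" using diffeo_germ_base[OF N(1)] .
  have f2a: "f2 a = G2 (0, 0)" "f3 a = E (0, 0)"
    using eventually_nhds_x_imp_x[OF N(8)] by (simp_all add: G2_def G3_def \<psi>0 \<theta>0)
  define k where "k y = G2 (y $ 1 - c, 0)" for y :: "real^3"
  define Y where "Y y = (y $ 1 - c, e * (y $ 2 - k y))" for y :: "real^3"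
  define \<tau> where "\<tau> y = (vector [y $ 1 - c, e * (y $ 2 - k y), (y $ 3 - E (Y y)) / U (Y y)] :: real^3)" for y :: "real^3"
  define \<tau>' where "\<tau>' z = (vector [z $ 1 + c, e * z $ 2 + G2 (z $ 1, 0), z $ 3 * U (z $ 1, z $ 2) + E (z $ 1, z $ 2)] :: real^3)" for z :: "real^3"
  let ?b = "vector [f1 a, f2 a, f3 a] :: real^3"
  have sk: "smooth_germ ?b k"
    unfolding k_def by (rule smooth_germ_compose[OF sG(1)]) (auto intro!: germ_intros simp: c_def)
  have sY: "smooth_germ ?b Y" unfolding Y_def by (intro germ_intros sk)
  have Yb: "Y ?b = (0, 0)" by (simp add: Y_def k_def c_def f2a)
  have s\<tau>: "smooth_germ ?b \<tau>"
    unfolding \<tau>_def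
    by (intro germ_intros sk smooth_germ_compose[OF N(3) Yb sY] smooth_germ_compose[OF N(4) Yb sY]) (simp add: Yb N)
  have z0: "((0::real^3) $ 1, (0::real^3) $ 2) = (0, 0)" by simp
  have s\<tau>': "smooth_germ 0 \<tau>'"
    unfolding \<tau>'_def
    by (intro germ_intros smooth_germ_compose[OF sG(1)] smooth_germ_compose[OF N(3)] smooth_germ_compose[OF N(4)]) auto
  have \<tau>b: "\<tau> ?b = 0"
    using Yb unfolding f2a by (simp add: \<tau>_def vec_eq_iff forall_3 c_def k_def)
  have \<tau>'0: "\<tau>' 0 = ?b"
    using f2a by (simp add: \<tau>'_def vec_eq_iff forall_3 c_def)
  have Une: "\<forall>\<^sub>F q in nhds (0, 0). U q \<noteq> 0"
    using tendsto_imp_eventually_ne[OF smooth_germ_tendsto[OF N(4)] N(5)] .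
  have d\<tau>: "diffeo_germ \<tau> ?b 0"
    unfolding diffeo_germ_def
  proof (intro conjI exI[of _ \<tau>'])
    show "\<forall>\<^sub>F y in nhds ?b. \<tau>' (\<tau> y) = y"
      using eventually_compose_germ[OF Une sY Yb]
    proof eventually_elim
      case (elim y)
      then show ?case
        by (simp add: \<tau>_def \<tau>'_def vec_eq_iff forall_3 Y_def ee') (simp add: k_def)
    qed
    have "smooth_germ (0::real^3) (\<lambda>z. (z $ 1, z $ 2))" by (intro germ_intros)
    from eventually_compose_germ[OF Une this z0] show "\<forall>\<^sub>F z in nhds 0. \<tau> (\<tau>' z) = z"
    proof eventually_elim
      case (elim z)
      have k: "k (\<tau>' z) = G2 (z $ 1, 0)" by (simp add: k_def \<tau>'_def)
      have Y: "Y (\<tau>' z) = (z $ 1, z $ 2)" by (simp add: Y_def k) (simp add: \<tau>'_def ee')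
      show ?case using elim by (simp add: \<tau>_def vec_eq_iff forall_3 k Y) (simp add: \<tau>'_def ee')
    qed
  qed (fact s\<tau> s\<tau>' \<tau>b \<tau>'0)+
  have d\<sigma>: "diffeo_germ (\<lambda>t. vec_of_pair (\<theta> (\<phi> t))) a 0"
  proof -
    have v0: "vec_of_pair (0, 0) = 0" by (simp add: vec_of_pair_def vec_eq_iff forall_2)
    show ?thesis
      using diffeo_germ_compose[OF diffeo_germ_compose[OF d\<phi> N(1)] diffeo_vec_of_pair] by (simp add: v0)
  qed
  have ev: "\<forall>\<^sub>F t in nhds a. \<tau> (vector [f1 t, f2 t, f3 t]) = cuspidal_edge (vec_of_pair (\<theta> (\<phi> t)))"
  proof -
    have "\<forall>\<^sub>F t in nhds a. U (fst (\<phi> t), (snd (\<theta> (\<phi> t)))\<^sup>2) \<noteq> 0"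
    proof -
      have "smooth_germ a (\<lambda>t. \<theta> (\<phi> t))"
        using smooth_germ_compose[OF diffeo_germ_smooth[OF N(1)] \<phi>a s\<phi>] .
      then have s: "smooth_germ a (\<lambda>t. (fst (\<phi> t), (snd (\<theta> (\<phi> t)))\<^sup>2))" by (intro germ_intros s\<phi>)
      show ?thesis by (rule eventually_compose_germ[OF Une s]) (simp add: \<phi>a \<theta>0)
    qed
    then show ?thesis
      using \<psi>(2) eventually_compose_germ[OF N(6) s\<phi> \<phi>a] eventually_compose_germ[OF N(7) s\<phi> \<phi>a]
        eventually_compose_germ[OF N(8) s\<phi> \<phi>a]
    proof eventually_elim
      case (elim t)
      let ?y = "vector [f1 t, f2 t, f3 t] :: real^3" and ?w = "snd (\<theta> (\<phi> t))"
      have s: "fst (\<phi> t) = f1 t - c" by (simp add: \<phi>_def)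
      have f2: "f2 t - k ?y = e * ?w\<^sup>2"
        using elim(2,4) by (simp add: G2_def k_def s)
      then have Y: "Y ?y = (f1 t - c, ?w\<^sup>2)"
        by (simp add: Y_def ee')
      have f3: "f3 t - E (f1 t - c, ?w\<^sup>2) = ?w ^ 3 * U (f1 t - c, ?w\<^sup>2)"
        using elim(2,5) by (simp add: G3_def s)
      show ?case
        using elim(1,3) by (simp add: \<tau>_def cuspidal_edge_def vec_of_pair_def vec_eq_iff forall_3 Y f2 f3 s ee')
    qed
  qed
  have "cuspidal_edge 0 = 0" by (simp add: cuspidal_edge_def vec_eq_iff forall_3)
  with d\<tau> have "diffeo_germ \<tau> ?b (cuspidal_edge 0)" by simp
  with d\<sigma> ev show ?thesis unfolding A_equivalent_def by blast
qed

section \<open>Tangent surfaces of curves of type (1,2,3)\<close>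

lemma A_equivalent_germ_cong:
  fixes f g :: "real^'n \<Rightarrow> real^'m"
  assumes "A_equivalent g a h b" "\<forall>\<^sub>F t in nhds a. f t = g t"
  shows "A_equivalent f a h b"
proof -
  obtain \<sigma> \<tau> where s: "diffeo_germ \<sigma> a b" "diffeo_germ \<tau> (g a) (h b)" "\<forall>\<^sub>F t in nhds a. \<tau> (g t) = h (\<sigma> t)"
    using assms(1) unfolding A_equivalent_def by blast
  have "\<forall>\<^sub>F t in nhds a. \<tau> (f t) = h (\<sigma> t)"
    using s(3) assms(2) by eventually_elim simp
  then show ?thesis
    using s(1,2) eventually_nhds_x_imp_x[OF assms(2)] unfolding A_equivalent_def by auto
qed

lemma A_equivalent_affine:
  fixes f :: "real^'n \<Rightarrow> real^'m" and M :: "real^'m^'m"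
  assumes "invertible M"
  shows "A_equivalent f a (\<lambda>t. M *v (f t - c)) a"
proof -
  obtain N where N: "M ** N = mat 1" "N ** M = mat 1"
    using assms unfolding invertible_def by blast
  have "diffeo_germ ((*v) M) (f a - c) (M *v (f a - c))"
    by (rule diffeo_germ_linear[of _ "(*v) N"])
      (simp_all add: matrix_vector_mul_linear matrix_vector_mul_assoc N)
  from diffeo_germ_compose[OF diffeo_germ_translation this]
  have \<tau>: "diffeo_germ (\<lambda>y. M *v (y - c)) (f a) (M *v (f a - c))" .
  have "diffeo_germ (\<lambda>t. t) a a"
    unfolding diffeo_germ_def by (intro conjI exI[of _ "\<lambda>t. t"] germ_intros) auto
  then show ?thesis
    unfolding A_equivalent_def using \<tau> by (intro exI[of _ "\<lambda>t. t"] exI[of _ "\<lambda>y. M *v (y - c)"]) auto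
qed

abbreviation rd :: "(real \<Rightarrow> real) \<Rightarrow> real \<Rightarrow> real" where
  "rd h t \<equiv> der h t 1"

lemma smooth_germ_rd: "smooth_germ t h \<Longrightarrow> (h has_real_derivative rd h t) (at t)"
proof -
  assume s: "smooth_germ t h"
  have "der h t v = rd h t * v" for v
    using linear_scale[OF frechet_linear[OF s], of v 1] by (simp add: mult.commute)
  then have "der h t = (*) (rd h t)" by (rule ext)
  with smooth_germ_derivative[OF s] show "(h has_real_derivative rd h t) (at t)"
    unfolding has_field_derivative_def by (rule has_derivative_eq_rhs)
qed

lemma rd_eq: "(h has_real_derivative d) (at t) \<Longrightarrow> rd h t = d"
  unfolding has_field_derivative_def by (simp flip: frechet_derivative_at)

text \<open>
  Keeps track of leading terms under differentiation.
\<close>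

lemma leading_derivative:
  assumes u: "smooth_germ 0 u" and h: "\<forall>\<^sub>F t in nhds 0. h t = t ^ Suc n * u t"
  obtains u' where "smooth_germ 0 u'" "u' 0 = real (Suc n) * u 0" "\<forall>\<^sub>F t in nhds 0. rd h t = t ^ n * u' t"
proof (rule that[of "\<lambda>t. real (Suc n) * u t + t * rd u t"])
  show "smooth_germ 0 (\<lambda>t. real (Suc n) * u t + t * rd u t)" by (intro germ_intros u)
  show "\<forall>\<^sub>F t in nhds 0. rd h t = t ^ n * (real (Suc n) * u t + t * rd u t)"
    using eventually_frechet_derivative_cong[OF h] smooth_germ_eventually_smooth[OF u]
  proof eventually_elim
    case (elim t)
    have "((\<lambda>t. t ^ Suc n * u t) has_real_derivative t ^ n * (real (Suc n) * u t + t * rd u t)) (at t)"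
      by (rule DERIV_cong[OF DERIV_mult[OF DERIV_power[OF DERIV_ident] smooth_germ_rd[OF elim(2)]]])
        (simp add: algebra_simps)
    from rd_eq[OF this] show ?case using elim(1) by simp
  qed
qed simp

lemma frechet_linear_mult:
  fixes L k :: "'a::real_normed_vector \<Rightarrow> real"
  assumes L: "bounded_linear L" "L a = 0" and k: "smooth_germ a k"
  shows "der (\<lambda>p. L p * k p) a v = L v * k a"
proof -
  have "((\<lambda>p. L p * k p) has_derivative (\<lambda>v. L a * der k a v + L v * k a)) (at a)"
    by (intro has_derivative_mult bounded_linear_imp_has_derivative[OF L(1)] smooth_germ_derivative[OF k])
  from fun_cong[OF frechet_derivative_at[OF this, symmetric], of v] show ?thesis using L(2) by simp
qed

text \<open>
  The ruled surface \<open>\<beta>(t) + u \<beta>'(t)\<close> is singular along \<open>u = 0\<close>. The field \<open>X\<close> that kills the first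
  component sends the others to \<open>u W(t)\<close> with \<open>W\<close> the Wronskian of \<open>\<beta>1'\<close> and of the derivative of
  that component. The leading powers 1, 2, 3 say that the Wronskian of the second component does
  not vanish at 0, while that of the third vanishes to order exactly one.
\<close>

lemma ruled_surface_cuspidal:
  fixes \<beta>1 \<beta>2 \<beta>3 :: "real \<Rightarrow> real"
  assumes l: "leading_power 1 \<beta>1" "leading_power 2 \<beta>2" "leading_power 3 \<beta>3"
  defines "S \<equiv> (\<lambda>\<beta> (p::real^2). \<beta> (p $ 1) + p $ 2 * rd \<beta> (p $ 1))"
  shows "A_equivalent (\<lambda>p. vector [S \<beta>1 p, S \<beta>2 p, S \<beta>3 p]) 0 cuspidal_edge 0"
proof -
  have lead: "\<exists>u. smooth_germ 0 u \<and> u 0 = 1 \<and> (\<forall>\<^sub>F t in nhds 0. h t = t ^ n * u t)" if lp: "leading_power n h" for n h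
  proof -
    obtain g where g: "smooth_germ 0 g" "\<forall>\<^sub>F t in nhds 0. h t = t ^ n + t ^ (n + 1) * g t"
      using lp unfolding leading_power_def by blast
    have "smooth_germ 0 (\<lambda>t. 1 + t * g t)" by (intro germ_intros g)
    moreover have "\<forall>\<^sub>F t in nhds 0. h t = t ^ n * (1 + t * g t)"
      using g(2) by eventually_elim (simp add: algebra_simps)
    ultimately show ?thesis by (intro exI[of _ "\<lambda>t. 1 + t * g t"]) auto
  qed
  obtain u1 where u1: "smooth_germ 0 u1" "u1 0 = 1" "\<forall>\<^sub>F t in nhds 0. \<beta>1 t = t ^ Suc 0 * u1 t"
    using lead[OF l(1)] by auto
  obtain u2 where u2: "smooth_germ 0 u2" "u2 0 = 1" "\<forall>\<^sub>F t in nhds 0. \<beta>2 t = t ^ Suc 1 * u2 t"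
    using lead[OF l(2)] by (auto simp: numeral_2_eq_2)
  obtain u3 where u3: "smooth_germ 0 u3" "u3 0 = 1" "\<forall>\<^sub>F t in nhds 0. \<beta>3 t = t ^ Suc 2 * u3 t"
    using lead[OF l(3)] by (auto simp: numeral_3_eq_3)
  obtain v1 where v1: "smooth_germ 0 v1" "v1 0 = 1" "\<forall>\<^sub>F t in nhds 0. rd \<beta>1 t = v1 t"
    using leading_derivative[OF u1(1,3)] u1(2) by auto
  obtain v2 where v2: "smooth_germ 0 v2" "v2 0 = 2" "\<forall>\<^sub>F t in nhds 0. rd \<beta>2 t = t ^ Suc 0 * v2 t"
    using leading_derivative[OF u2(1,3)] u2(2) by auto
  obtain v3 where v3: "smooth_germ 0 v3" "v3 0 = 3" "\<forall>\<^sub>F t in nhds 0. rd \<beta>3 t = t ^ Suc 1 * v3 t"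
    using leading_derivative[OF u3(1,3)] u3(2) by (auto simp: numeral_2_eq_2)
  obtain w2 where w2: "smooth_germ 0 w2" "w2 0 = 2" "\<forall>\<^sub>F t in nhds 0. rd (rd \<beta>2) t = w2 t"
    using leading_derivative[OF v2(1,3)] v2(2) by auto
  obtain w3 where w3: "smooth_germ 0 w3" "w3 0 = 6" "\<forall>\<^sub>F t in nhds 0. rd (rd \<beta>3) t = t * w3 t"
    using leading_derivative[OF v3(1,3)] v3(2) by auto
  have s\<beta>: "smooth_germ 0 \<beta>1" "smooth_germ 0 \<beta>2" "smooth_germ 0 \<beta>3"
    by (rule smooth_germ_cong[of _ "\<lambda>t. t ^ Suc 0 * u1 t"], intro germ_intros u1, use u1(3) in \<open>auto elim: eventually_mono\<close>)
      (rule smooth_germ_cong[of _ "\<lambda>t. t ^ Suc 1 * u2 t"], intro germ_intros u2, use u2(3) in \<open>auto elim: eventually_mono\<close>,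
       rule smooth_germ_cong[of _ "\<lambda>t. t ^ Suc 2 * u3 t"], intro germ_intros u3, use u3(3) in \<open>auto elim: eventually_mono\<close>)
  have p1: "smooth_germ (0::real^2) (\<lambda>p. p $ 1)" "(0::real^2) $ 1 = 0" by (auto intro: germ_intros)
  have lift: "smooth_germ 0 (\<lambda>p::real^2. k (p $ 1))" if "smooth_germ 0 k" for k :: "real \<Rightarrow> real"
    by (rule smooth_germ_compose[OF that p1(2,1)])
  have sS: "smooth_germ 0 (S \<beta>)" if "smooth_germ 0 \<beta>" for \<beta>
    unfolding S_def by (intro germ_intros lift that)
  have evp: "\<forall>\<^sub>F p in nhds (0::real^2). P (p $ 1)" if "\<forall>\<^sub>F t in nhds 0. P t" for P
    by (rule eventually_compose_germ[OF that p1])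
  have dS: "\<forall>\<^sub>F p in nhds 0. \<forall>v. der (S \<beta>) p v
      = v $ 1 * (rd \<beta> (p $ 1) + p $ 2 * rd (rd \<beta>) (p $ 1)) + v $ 2 * rd \<beta> (p $ 1)" if s: "smooth_germ 0 \<beta>" for \<beta>
  proof -
    have sr: "smooth_germ 0 (rd \<beta>)" by (intro germ_intros s)
    show ?thesis
      using evp[OF smooth_germ_eventually_smooth[OF s]] evp[OF smooth_germ_eventually_smooth[OF sr]]
    proof eventually_elim
      case (elim p)
      have d: "((\<lambda>p. p $ 1) has_derivative (\<lambda>v. v $ 1)) (at p)" "((\<lambda>p. p $ 2) has_derivative (\<lambda>v. v $ 2)) (at p)"
        by (auto intro!: bounded_linear_imp_has_derivative bounded_linear_vec_nth)
      have h: "((\<lambda>p. h (p $ 1)) has_derivative (\<lambda>v. rd h (p $ 1) * v $ 1)) (at p)" if "smooth_germ (p $ 1) h" for h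
        using has_derivative_compose[OF d(1) smooth_germ_rd[OF that, unfolded has_field_derivative_def]] .
      have "(S \<beta> has_derivative (\<lambda>v. rd \<beta> (p $ 1) * v $ 1 + (p $ 2 * (rd (rd \<beta>) (p $ 1) * v $ 1) + v $ 2 * rd \<beta> (p $ 1)))) (at p)"
        unfolding S_def by (intro has_derivative_add has_derivative_mult h d elim)
      from frechet_derivative_at[OF this, symmetric] show ?case by (simp add: algebra_simps)
    qed
  qed
  define X where "X p = (vector [- rd \<beta>1 (p $ 1), rd \<beta>1 (p $ 1) + p $ 2 * rd (rd \<beta>1) (p $ 1)] :: real^2)" for p :: "real^2"
  have sX: "smooth_germ 0 X" unfolding X_def by (intro germ_intros lift s\<beta>)
  have b0: "rd \<beta>1 0 = 1" "rd \<beta>2 0 = 0" "rd (rd \<beta>2) 0 = 2"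
    using eventually_nhds_x_imp_x[OF v1(3)] eventually_nhds_x_imp_x[OF v2(3)] eventually_nhds_x_imp_x[OF w2(3)] v1(2) w2(2)
    by simp_all
  have X0: "X 0 = vector [- 1, 1]" by (simp add: X_def b0)
  define W where "W \<beta> t = rd (rd \<beta>1) t * rd \<beta> t - rd \<beta>1 t * rd (rd \<beta>) t" for \<beta> t
  have sW: "smooth_germ 0 (W \<beta>)" if "smooth_germ 0 \<beta>" for \<beta>
    unfolding W_def by (intro germ_intros s\<beta> that)
  have W20: "W \<beta>2 0 = - 2" by (simp add: W_def b0)
  have XS: "\<forall>\<^sub>F p in nhds 0. vf_apply X (S \<beta>) p = p $ 2 * W \<beta> (p $ 1)" if "smooth_germ 0 \<beta>" for \<beta>
    using dS[OF that] by eventually_elim (simp add: vf_apply_def X_def W_def algebra_simps)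
  define \<alpha> where "\<alpha> t = (rd (rd \<beta>1) t * (t * v3 t) - rd \<beta>1 t * w3 t) / W \<beta>2 t" for t
  have s\<alpha>: "smooth_germ 0 \<alpha>" unfolding \<alpha>_def using W20 by (intro germ_intros s\<beta> v3 w3 sW) simp
  have \<alpha>0: "\<alpha> 0 = 3" by (simp add: \<alpha>_def b0 w3 W20)
  define A where "A p = p $ 1 * \<alpha> (p $ 1)" for p :: "real^2"
  have "\<forall>\<^sub>F t in nhds 0. W \<beta>2 t \<noteq> 0"
    using tendsto_imp_eventually_ne[OF smooth_germ_tendsto[OF sW[OF s\<beta>(2)]]] W20 by simp
  then have W3: "\<forall>\<^sub>F t in nhds 0. W \<beta>3 t = t * \<alpha> t * W \<beta>2 t"
    using v3(3) w3(3)
    by eventually_elim (simp add: \<alpha>_def W_def[of \<beta>3] power2_eq_square algebra_simps diff_divide_distrib)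
  show ?thesis
  proof (rule cuspidal_edge_criterion[of 0 _ _ _ A X "axis 1 1"])
    show "smooth_germ 0 A" unfolding A_def by (intro germ_intros lift s\<alpha>)
    show "\<forall>\<^sub>F p in nhds 0. vf_apply X (S \<beta>1) p = 0"
      using XS[OF s\<beta>(1)] by eventually_elim (simp add: W_def)
    show "\<forall>\<^sub>F p in nhds 0. vf_apply X (S \<beta>3) p = A p * vf_apply X (S \<beta>2) p"
      using XS[OF s\<beta>(3)] XS[OF s\<beta>(2)] evp[OF W3] by eventually_elim (simp add: A_def)
    show "der (S \<beta>1) 0 (axis 1 1) \<noteq> 0"
      using eventually_nhds_x_imp_x[OF dS[OF s\<beta>(1)]] by (simp add: b0 axis_def)
    show "vf_apply X (S \<beta>2) 0 = 0" using eventually_nhds_x_imp_x[OF XS[OF s\<beta>(2)]] by simp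
    have "vf_apply X (vf_apply X (S \<beta>2)) 0 = der (\<lambda>p. p $ 2 * W \<beta>2 (p $ 1)) 0 (X 0)"
      unfolding vf_apply_def[of X "vf_apply _ _"] frechet_derivative_germ_cong[OF XS[OF s\<beta>(2)]] ..
    also have "\<dots> = - 2"
      using frechet_linear_mult[OF bounded_linear_vec_nth[of 2] _ lift[OF sW[OF s\<beta>(2)]], of "X 0"] by (simp add: X0 W20)
    finally show "vf_apply X (vf_apply X (S \<beta>2)) 0 \<noteq> 0" by simp
    show "vf_apply X A 0 \<noteq> 0"
      using frechet_linear_mult[OF bounded_linear_vec_nth[of 1] _ lift[OF s\<alpha>], of "X 0"]
      by (simp add: vf_apply_def A_def[abs_def] X0 \<alpha>0)
  qed (intro sS s\<beta> sX)+
qed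

text \<open>
  For \<open>l\<^sub>1 = 1\<close> the limit that defines the direction at \<open>0\<close> is \<open>\<gamma>'(0)\<close>, by continuity of \<open>\<gamma>'\<close>.
\<close>

lemma tangent_direction_regular:
  assumes "smooth_germ 0 \<gamma>"
  shows "\<forall>\<^sub>F t in nhds 0. tangent_direction 1 \<gamma> t = der \<gamma> t 1"
proof -
  let ?d = "\<lambda>t. der \<gamma> t 1"
  let ?q = "\<lambda>s. (1 / s ^ (1 - 1)) *\<^sub>R vector_derivative \<gamma> (at s)"
  have q: "\<forall>\<^sub>F t in nhds 0. ?q t = ?d t"
    using smooth_germ_eventually_smooth[OF assms]
  proof eventually_elim
    case (elim t)
    have "der \<gamma> t v = v *\<^sub>R ?d t" for v
      using linear_scale[OF frechet_linear[OF elim], of v 1] by simp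
    then have "der \<gamma> t = (\<lambda>v. v *\<^sub>R ?d t)" by (rule ext)
    with smooth_germ_derivative[OF elim] have "(\<gamma> has_vector_derivative ?d t) (at t)"
      unfolding has_vector_derivative_def by (rule has_derivative_eq_rhs)
    then show ?case using vector_derivative_at by simp
  qed
  have "(?d \<longlongrightarrow> ?d 0) (at 0)"
    using smooth_germ_isCont[OF smooth_germ_frechet[OF assms, of 1]] by (simp add: isCont_def)
  then have "(?q \<longlongrightarrow> ?d 0) (at 0)"
    by (rule Lim_transform_eventually) (use q in \<open>auto simp: eventually_at_filter elim: eventually_mono\<close>)
  then have "Lim (at 0) ?q = ?d 0" by (intro tendsto_Lim) auto
  with q show ?thesis
    by (auto simp: tangent_direction_def Let_def elim: eventually_mono)
qed

theorem tangent_surface_cuspidal_edge: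
  assumes "curve_of_type 1 2 3 \<gamma>"
  shows "A_equivalent (tangent_surface 1 \<gamma>) 0 cuspidal_edge 0" "smooth_germ 0 (tangent_surface 1 \<gamma>)"
proof -
  obtain M :: "real^3^3" where s: "smooth_germ 0 \<gamma>" and M: "invertible M"
    and lp: "leading_power 1 (\<lambda>t. (M *v (\<gamma> t - \<gamma> 0)) $ 1)" "leading_power 2 (\<lambda>t. (M *v (\<gamma> t - \<gamma> 0)) $ 2)"
      "leading_power 3 (\<lambda>t. (M *v (\<gamma> t - \<gamma> 0)) $ 3)"
    using assms unfolding curve_of_type_def by auto
  define \<beta> where "\<beta> i t = (M *v (\<gamma> t - \<gamma> 0)) $ i" for i t
  let ?d = "\<lambda>t. der \<gamma> t 1"
  have p1: "smooth_germ (0::real^2) (\<lambda>p. p $ 1)" "(0::real^2) $ 1 = 0" by (auto intro: germ_intros)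
  have T: "\<forall>\<^sub>F p in nhds 0. tangent_surface 1 \<gamma> p = \<gamma> (p $ 1) + p $ 2 *\<^sub>R ?d (p $ 1)"
    using eventually_compose_germ[OF tangent_direction_regular[OF s] p1] by eventually_elim (simp add: tangent_surface_def)
  have "smooth_germ 0 (\<lambda>p::real^2. \<gamma> (p $ 1) + p $ 2 *\<^sub>R ?d (p $ 1))"
    by (intro germ_intros smooth_germ_compose[OF s p1(2,1)] smooth_germ_compose[OF smooth_germ_frechet[OF s] p1(2,1)])
  then show "smooth_germ 0 (tangent_surface 1 \<gamma>)"
    by (rule smooth_germ_cong) (use T in \<open>auto elim: eventually_mono\<close>)
  have rd: "\<forall>\<^sub>F t in nhds 0. \<forall>i. rd (\<beta> i) t = (M *v ?d t) $ i"
    using smooth_germ_eventually_smooth[OF s]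
  proof eventually_elim
    case (elim t)
    show ?case
    proof
      fix i
      have L: "bounded_linear (\<lambda>y. (M *v y) $ i)"
        by (rule bounded_linear_compose[OF bounded_linear_vec_nth matrix_vector_mul_bounded_linear])
      have "((\<lambda>t. \<gamma> t - \<gamma> 0) has_derivative (\<lambda>v. der \<gamma> t v - 0)) (at t)"
        by (intro has_derivative_diff smooth_germ_derivative elim has_derivative_const)
      from frechet_derivative_at[OF bounded_linear.has_derivative[OF L this], symmetric]
      show "rd (\<beta> i) t = (M *v ?d t) $ i" by (simp add: \<beta>_def[abs_def])
    qed
  qed
  have "A_equivalent (\<lambda>p. M *v (tangent_surface 1 \<gamma> p - \<gamma> 0)) 0 cuspidal_edge 0"
  proof (rule A_equivalent_germ_cong[OF ruled_surface_cuspidal[of "\<beta> 1" "\<beta> 2" "\<beta> 3"]])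
    show "\<forall>\<^sub>F p in nhds 0. M *v (tangent_surface 1 \<gamma> p - \<gamma> 0) =
      vector [\<beta> 1 (p $ 1) + p $ 2 * rd (\<beta> 1) (p $ 1), \<beta> 2 (p $ 1) + p $ 2 * rd (\<beta> 2) (p $ 1),
        \<beta> 3 (p $ 1) + p $ 2 * rd (\<beta> 3) (p $ 1)]"
      using T eventually_compose_germ[OF rd p1]
    proof eventually_elim
      case (elim p)
      have "M *v (tangent_surface 1 \<gamma> p - \<gamma> 0) = M *v (\<gamma> (p $ 1) - \<gamma> 0) + p $ 2 *\<^sub>R (M *v ?d (p $ 1))"
        unfolding elim(1)
        by (simp add: matrix_vector_mult_diff_distrib matrix_vector_right_distrib matrix_vector_mult_scaleR algebra_simps)
      then show ?case using elim(2) by (simp add: vec_eq_iff forall_3 \<beta>_def[abs_def])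
    qed
  qed (use lp in \<open>simp_all add: \<beta>_def[abs_def]\<close>)
  then show "A_equivalent (tangent_surface 1 \<gamma>) 0 cuspidal_edge 0"
    by (rule A_equivalent_trans[OF A_equivalent_affine[OF M]])
qed

lemma moment_curve_type: "curve_of_type 1 2 3 (\<lambda>t. vector [t, t ^ 2, t ^ 3])"
proof -
  have lp: "leading_power n (\<lambda>t. t ^ n)" for n
    unfolding leading_power_def by (intro exI[of _ "\<lambda>t. 0"]) (auto intro: germ_intros)
  show ?thesis
    unfolding curve_of_type_def
    by (intro conjI exI[of _ "mat 1"] germ_intros)
      (use lp[of 1] lp[of 2] lp[of 3] in \<open>simp_all add: invertible_def exI[of _ "mat 1"]\<close>)
qed

section \<open>Mixed derivatives and the Jacobi ideal\<close>

text \<open>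
  Differentiating \<open>h(s, w) = h(s, 0) + w \<integral> (\<partial>h/\<partial>w)(s, t w) dt\<close> in \<open>s\<close>, and then in \<open>w\<close> at \<open>w = 0\<close>,
  gives the mixed derivative in the other order.
\<close>

lemma mixed_partials_origin:
  assumes h: "smooth_germ (0, 0) h"
  shows "dw (ds h) (0, 0) = ds (dw h) (0, 0)"
proof -
  obtain r where r: "r > 0" "smooth_on (ball (0, 0) r) h" using smooth_germ_ball[OF h] .
  let ?U = "ball (0, 0) r :: (real \<times> real) set"
  note fU = fibre_star_ball[of r]
  have oU: "open ?U" by simp
  have ax: "(fst p, 0) \<in> ?U" if "p \<in> ?U" for p using fU that by (auto simp: fibre_star_def)
  let ?I = "dil_int 0 (dw h)" and ?J = "dil_int 0 (ds (dw h))"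
  have h_eq: "h p = h (fst p, 0) + snd p * ?I p" if p: "p \<in> ?U" for p
    using fibre_integration[where j = 0, OF fU r(2) smooth_on_continuous[OF smooth_on_frechet[OF r(2)]] _ p] by simp
  have d: "((\<lambda>p. (fst p, 0::real)) has_derivative (\<lambda>v. (fst v, 0))) (at p)" for p :: "real \<times> real"
    by (auto intro!: derivative_eq_intros)
  have axd: "((\<lambda>p. k (fst p, 0)) has_derivative (\<lambda>v. fst v * ds k (fst p, 0))) (at p)"
    if "smooth_on ?U k" "p \<in> ?U" for k p
    using has_derivative_compose[OF d has_derivative_plane[OF smooth_onD[OF that(1) ax[OF that(2)]]]] by simp
  have ds_eq: "ds h p = ds h (fst p, 0) + snd p * ?J p" if p: "p \<in> ?U" for p
  proof -
    have "((\<lambda>p. h (fst p, 0) + snd p * ?I p) has_derivative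
        (\<lambda>v. fst v * ds h (fst p, 0) + (snd p * (fst v * ?J p + snd v * dil_int 1 (dw (dw h)) p) + snd v * ?I p))) (at p)"
      by (intro has_derivative_add axd[OF r(2) p] has_derivative_mult
          has_derivative_dil_int[OF fU smooth_on_frechet[OF r(2)] p, where j = 0, unfolded One_nat_def[symmetric]]
          bounded_linear_imp_has_derivative bounded_linear_snd)
    then have "(h has_derivative
        (\<lambda>v. fst v * ds h (fst p, 0) + (snd p * (fst v * ?J p + snd v * dil_int 1 (dw (dw h)) p) + snd v * ?I p))) (at p)"
      by (rule has_derivative_transform_within_open[OF _ oU p]) (simp add: h_eq[symmetric])
    from frechet_derivative_at[OF this, symmetric] show ?thesis by simp
  qed
  have z: "(0, 0) \<in> ?U" using r by simp
  have sJ: "isCont ?J (0, 0)"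
    using has_derivative_continuous[OF smooth_onD[OF smooth_on_dil_int[OF fU smooth_on_frechet[OF smooth_on_frechet[OF r(2)]]] z]] .
  have "((\<lambda>p. ds h (fst p, 0) + snd p * ?J p) has_derivative
      (\<lambda>v. fst v * ds (ds h) (fst (0::real, 0::real), 0) + snd v * ?J (0, 0))) (at (0, 0))"
    by (intro has_derivative_add axd[OF smooth_on_frechet[OF r(2)] z] has_derivative_snd_mult sJ)
  then have "(ds h has_derivative
      (\<lambda>v. fst v * ds (ds h) (fst (0::real, 0::real), 0) + snd v * ?J (0, 0))) (at (0, 0))"
    by (rule has_derivative_transform_within_open[OF _ oU z]) (simp add: ds_eq[symmetric])
  from plane_derivativeD(2)[OF this] show ?thesis by (simp add: dil_int_axis)
qed

lemma second_derivative_symmetric: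
  fixes g :: "'a::euclidean_space \<Rightarrow> real"
  assumes g: "smooth_germ a g"
  shows "der (\<lambda>t. der g t v) a w
    = der (\<lambda>t. der g t w) a v"
proof -
  define m where "m p = a + (fst p *\<^sub>R v + snd p *\<^sub>R w)" for p :: "real \<times> real"
  define h where "h p = g (m p)" for p
  have m0: "m (0, 0) = a" by (simp add: m_def)
  have sm: "smooth_germ p m" for p unfolding m_def by (intro germ_intros)
  have dm: "der m p u = fst u *\<^sub>R v + snd u *\<^sub>R w" for p u
  proof -
    have "(m has_derivative (\<lambda>u. 0 + (fst u *\<^sub>R v + snd u *\<^sub>R w))) (at p)"
      unfolding m_def[abs_def]
      by (intro has_derivative_add has_derivative_const bounded_linear.has_derivative[OF bounded_linear_scaleR_left]
        bounded_linear_imp_has_derivative bounded_linear_fst bounded_linear_snd)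
    from frechet_derivative_at[OF this, symmetric] show ?thesis by simp
  qed
  have sh: "smooth_germ (0, 0) h" unfolding h_def by (rule smooth_germ_compose[OF g m0 sm])
  have dh: "\<forall>\<^sub>F p in nhds (0, 0). der h p u = der g (m p) (fst u *\<^sub>R v + snd u *\<^sub>R w)" for u
    using eventually_compose_germ[OF smooth_germ_eventually_smooth[OF g] sm m0]
    by eventually_elim (simp add: h_def[abs_def] frechet_derivative_compose[OF sm] dm)
  have dg: "smooth_germ (m (0, 0)) (\<lambda>t. der g t u)" for u
    unfolding m0 by (intro germ_intros g)
  have "dw (ds h) (0, 0) = der (\<lambda>p. der g (m p) v) (0, 0) (0, 1)"
    using frechet_derivative_germ_cong[OF dh[of "(1, 0)"]] by simp
  also have "\<dots> = der (\<lambda>t. der g t v) a w"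
    using frechet_derivative_compose[OF sm dg[of v], of "(0, 1)"] by (simp add: dm m0)
  finally have 1: "dw (ds h) (0, 0) = der (\<lambda>t. der g t v) a w" .
  have "ds (dw h) (0, 0) = der (\<lambda>p. der g (m p) w) (0, 0) (1, 0)"
    using frechet_derivative_germ_cong[OF dh[of "(0, 1)"]] by simp
  also have "\<dots> = der (\<lambda>t. der g t w) a v"
    using frechet_derivative_compose[OF sm dg[of w], of "(1, 0)"] by (simp add: dm m0)
  finally show ?thesis using 1 mixed_partials_origin[OF sh] by simp
qed

lemma jacobi_minor_eq:
  "jacobi_minor f s t = der f t (axis 1 1) $ s 1 * der f t (axis 2 1) $ s 2
     - der f t (axis 2 1) $ s 1 * der f t (axis 1 1) $ s 2"
  for f :: "real^2 \<Rightarrow> real^3"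
  by (simp add: jacobi_minor_def det_2 matrix_def)

text \<open>
  A kernel vector is a linear relation between the two columns of the Jacobi matrix.
\<close>

lemma jacobi_minor_singular:
  fixes f :: "real^2 \<Rightarrow> real^3"
  assumes f: "smooth_germ a f" and k: "der f a k = 0" "k \<noteq> 0"
  shows "jacobi_minor f s a = 0"
proof -
  let ?D = "der f a"
  have "k $ 1 * ?D (axis 1 1) $ i + k $ 2 * ?D (axis 2 1) $ i = 0" for i
    using arg_cong[OF linear_vec2_expand[OF frechet_linear[OF f], of k], of "\<lambda>x. x $ i"] k(1) by simp
  then have e: "k $ 1 * ?D (axis 1 1) $ s 1 + k $ 2 * ?D (axis 2 1) $ s 1 = 0"
     "k $ 1 * ?D (axis 1 1) $ s 2 + k $ 2 * ?D (axis 2 1) $ s 2 = 0" by blast+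
  have "k $ 1 * jacobi_minor f s a = 0" "k $ 2 * jacobi_minor f s a = 0"
    unfolding jacobi_minor_eq using e by algebra+
  moreover have "k $ 1 \<noteq> 0 \<or> k $ 2 \<noteq> 0" using k(2) by (auto simp: vec_eq_iff forall_2)
  ultimately show ?thesis by auto
qed

text \<open>
  An ideal whose generators are multiples of one function \<open>m\<close> consists of multiples of \<open>m\<close>. This
  is how a Jacobian is compared with a concrete minor, without knowing that the latter generates.
\<close>

lemma germ_ideal_multiple:
  assumes h: "h \<in> germ_ideal a G" and G: "finite G"
    and c: "\<And>g. g \<in> G \<Longrightarrow> \<exists>c. smooth_germ a c \<and> (\<forall>\<^sub>F t in nhds a. g t = c t * m t)"
  obtains c where "smooth_germ a c" "\<forall>\<^sub>F t in nhds a. h t = c t * m t"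
proof -
  obtain d where d: "\<And>g. g \<in> G \<Longrightarrow> smooth_germ a (d g)" "\<forall>\<^sub>F t in nhds a. h t = (\<Sum>g\<in>G. d g t * g t)"
    using h unfolding germ_ideal_def by blast
  obtain c where c: "\<And>g. g \<in> G \<Longrightarrow> smooth_germ a (c g)" "\<And>g. g \<in> G \<Longrightarrow> \<forall>\<^sub>F t in nhds a. g t = c g t * m t"
    using c by metis
  show ?thesis
  proof (rule that[of "\<lambda>t. \<Sum>g\<in>G. d g t * c g t"])
    show "smooth_germ a (\<lambda>t. \<Sum>g\<in>G. d g t * c g t)" by (intro germ_intros c d)
    have "\<forall>\<^sub>F t in nhds a. \<forall>g\<in>G. g t = c g t * m t" using c(2) by (simp add: eventually_ball_finite_distrib[OF G])
    then show "\<forall>\<^sub>F t in nhds a. h t = (\<Sum>g\<in>G. d g t * c g t) * m t"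
      using d(2)
    proof eventually_elim
      case (elim t)
      have "(\<Sum>g\<in>G. d g t * g t) = (\<Sum>g\<in>G. d g t * (c g t * m t))"
        by (rule sum.cong) (use elim(1) in auto)
      then show ?case using elim(2) by (simp add: sum_distrib_right mult.assoc)
    qed
  qed
qed

lemma finite_minors: "finite (jacobi_minor f ` {s :: 'n::finite \<Rightarrow> 'm::finite. inj s})"
  by simp

lemma jacobi_ideal_vanish:
  fixes f :: "real^2 \<Rightarrow> real^3"
  assumes "smooth_germ a f" "der f a k = 0" "k \<noteq> 0" "h \<in> jacobi_ideal a f"
  shows "h a = 0"
proof -
  let ?G = "jacobi_minor f ` {s. inj s}"
  obtain d where d: "\<forall>\<^sub>F t in nhds a. h t = (\<Sum>g\<in>?G. d g t * g t)"
    using assms(4) unfolding jacobi_ideal_def germ_ideal_def by blast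
  have "h a = (\<Sum>g\<in>?G. d g a * g a)" using eventually_nhds_x_imp_x[OF d] .
  also have "\<dots> = 0" by (rule sum.neutral) (auto simp: jacobi_minor_singular[OF assms(1-3)])
  finally show ?thesis .
qed

lemma jacobian_in_ideal: "is_jacobian a f l \<Longrightarrow> l \<in> jacobi_ideal a f"
proof -
  assume "is_jacobian a f l"
  then have "jacobi_ideal a f = germ_ideal a {l}" by (simp add: is_jacobian_def)
  moreover have "l \<in> germ_ideal a {l}"
    unfolding germ_ideal_def by (intro CollectI exI[of _ "\<lambda>g t. 1"]) (auto intro: germ_intros)
  ultimately show ?thesis by simp
qed

lemma frechet_vec_nth:
  assumes "smooth_germ a (f :: 'a::real_normed_vector \<Rightarrow> real^'m)"
  shows "der (\<lambda>t. f t $ i) a v = der f a v $ i"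
  using frechet_derivative_at[OF bounded_linear.has_derivative[OF bounded_linear_vec_nth smooth_germ_derivative[OF assms]], symmetric]
  by simp

lemma dim_one_multiple:
  fixes S :: "(real^'n) set"
  assumes "dim S = 1" "x \<in> S" "x \<noteq> 0" "y \<in> S"
  obtains c where "y = c *\<^sub>R x"
proof -
  have "span {x} = span S"
    by (rule dim_eq_span) (use assms in auto)
  then have "y \<in> span {x}" using assms(4) span_base by blast
  then show ?thesis using that by (auto simp: span_singleton)
qed

section \<open>Fronts with a transverse singular set are cuspidal edges\<close>

text \<open>
  Frames adapted to a plane with a distinguished line. They turn the charts of the Grassmannian
  into pairs of functions.
\<close>

lemma orthonormal_frame:
  fixes W :: "(real^3) set" and r :: "real^3"
  assumes W: "W \<in> Gr 2" and r: "r \<in> W" "r \<noteq> 0"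
  obtains u1 u2 u3 where "r = norm r *\<^sub>R u1" "u1 \<in> W" "u2 \<in> W" "\<And>p. p \<in> W \<Longrightarrow> u3 \<bullet> p = 0"
    "u1 \<bullet> u1 = 1" "u2 \<bullet> u2 = 1" "u3 \<bullet> u3 = 1" "u1 \<bullet> u2 = 0" "u1 \<bullet> u3 = 0" "u2 \<bullet> u3 = 0"
    "\<And>y. y = (u1 \<bullet> y) *\<^sub>R u1 + (u2 \<bullet> y) *\<^sub>R u2 + (u3 \<bullet> y) *\<^sub>R u3"
    "invertible (vector [u1, u2, u3] :: real^3^3)"
proof -
  have sub: "subspace W" and dimW: "dim W = 2" using W by (auto simp: Gr_def)
  define u1 where "u1 = r /\<^sub>R norm r"
  have u1: "u1 \<in> W" "u1 \<bullet> u1 = 1" "r = norm r *\<^sub>R u1"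
    using r sub by (auto simp: u1_def subspace_scale dot_square_norm power2_eq_square)
  have "\<not> W \<subseteq> span {u1}"
  proof
    assume "W \<subseteq> span {u1}"
    then have "dim W \<le> dim {u1}" by (rule dim_subset[of W "span {u1}", unfolded dim_span])
    also have "\<dots> \<le> 1" using dim_le_card'[of "{u1}"] by simp
    finally show False using dimW by simp
  qed
  then obtain x where x: "x \<in> W" "x \<notin> span {u1}" by blast
  define y where "y = x - (u1 \<bullet> x) *\<^sub>R u1"
  have yW: "y \<in> W" unfolding y_def by (intro subspace_diff subspace_scale sub x u1)
  have y0: "y \<noteq> 0"
  proof
    assume "y = 0"
    then have "x = (u1 \<bullet> x) *\<^sub>R u1" by (simp add: y_def)
    then have "x \<in> span {u1}" by (metis span_base span_scale singletonI)
    then show False using x by simp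
  qed
  have u1y: "u1 \<bullet> y = 0" by (simp add: y_def inner_diff_right u1)
  define u2 where "u2 = y /\<^sub>R norm y"
  have u2: "u2 \<in> W" "u2 \<bullet> u2 = 1" "u1 \<bullet> u2 = 0"
    using y0 yW sub u1y by (auto simp: u2_def subspace_scale dot_square_norm power2_eq_square)
  define u3 where "u3 = cross3 u1 u2"
  have u3: "u1 \<bullet> u3 = 0" "u2 \<bullet> u3 = 0" "u3 \<bullet> u3 = 1"
    using u1 u2 by (simp_all add: u3_def dot_cross_self dot_cross inner_commute)
  have "u1 \<noteq> u2" using u1 u2 by auto
  have "independent {u1, u2}"
    by (rule pairwise_orthogonal_independent)
      (use u1 u2 in \<open>auto simp: pairwise_def orthogonal_def inner_commute\<close>)
  then have "dim {u1, u2} = 2" using \<open>u1 \<noteq> u2\<close> by (simp add: dim_eq_card_independent)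
  then have "span {u1, u2} = span W" using dimW u1 u2 by (intro dim_eq_span) auto
  then have spW: "W = span {u1, u2}" using sub by (simp add: span_eq_iff[THEN iffD2])
  have orth: "u3 \<bullet> p = 0" if "p \<in> W" for p
  proof -
    have "p \<in> span {u1, u2}" using that spW by simp
    then obtain b where "p - b *\<^sub>R u1 \<in> span {u2}" using span_breakdown_eq[of p u1 "{u2}"] by blast
    then obtain c where "p - b *\<^sub>R u1 = c *\<^sub>R u2" by (auto simp: span_singleton)
    then have "p = b *\<^sub>R u1 + c *\<^sub>R u2" by (simp add: algebra_simps)
    then show ?thesis using u3 by (simp add: inner_right_distrib inner_commute)
  qed
  define M where "M = (vector [u1, u2, u3] :: real^3^3)"
  have MT: "M ** transpose M = mat 1"
    using u1 u2 u3
    by (simp add: vec_eq_iff forall_3 matrix_matrix_mult_def transpose_def mat_def M_def inner_vec_def sum_3 mult.commute)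
  then have TM: "transpose M ** M = mat 1" by (simp add: matrix_left_right_inverse)
  have exp: "z = (u1 \<bullet> z) *\<^sub>R u1 + (u2 \<bullet> z) *\<^sub>R u2 + (u3 \<bullet> z) *\<^sub>R u3" for z
  proof -
    have "z = transpose M *v (M *v z)" by (simp add: matrix_vector_mul_assoc TM)
    also have "\<dots> = (u1 \<bullet> z) *\<^sub>R u1 + (u2 \<bullet> z) *\<^sub>R u2 + (u3 \<bullet> z) *\<^sub>R u3"
      by (simp add: vec_eq_iff matrix_vector_mult_def transpose_def M_def inner_vec_def sum_3 mult.commute)
    finally show ?thesis .
  qed
  have "invertible M" unfolding invertible_def using MT TM by blast
  then show ?thesis using that[of u1 u2 u3] u1 u2 u3 orth exp unfolding M_def by blast
qed

lemma bounded_linear_matrix_entry: "bounded_linear (\<lambda>A::real^'m^'m. u \<bullet> (A *v x))"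
proof -
  have "linear (\<lambda>A::real^'m^'m. u \<bullet> (A *v x))"
    by (rule linearI) (simp_all add: matrix_vector_mult_add_rdistrib inner_right_distrib scaleR_matrix_vector_assoc[symmetric])
  then show ?thesis by (simp add: linear_conv_bounded_linear)
qed

lemma gr_chart_base:
  assumes "gr_chart W W A" "x \<in> W" "subspace W"
  shows "A *v x = 0"
proof -
  have "x + A *v x \<in> W" "A *v x \<in> orthogonal_comp W" using assms(1,2) unfolding gr_chart_def by blast+
  then have "(x + A *v x) - x \<in> W" using assms(2,3) by (intro subspace_diff)
  then have "orthogonal (A *v x) (A *v x)" using \<open>A *v x \<in> orthogonal_comp W\<close> by (simp add: orthogonal_comp_def)
  then show ?thesis by (simp add: orthogonal_def)
qed

text \<open>
  The chart matrix has rank at most one: it kills the normal \<open>u3\<close> and takes values in its span. A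
  plane in the chart is therefore the graph of a linear form with coefficients \<open>u3 \<bullet> (A *v u1)\<close>
  and \<open>u3 \<bullet> (A *v u2)\<close>.
\<close>

lemma gr_chart_frame:
  fixes A :: "real^3^3"
  assumes u: "u1 \<in> W" "u2 \<in> W" "\<forall>p\<in>W. u3 \<bullet> p = 0" "u1 \<bullet> u3 = 0" "u2 \<bullet> u3 = 0" "u3 \<bullet> u3 = 1"
    and u_exp: "\<And>y. y = (u1 \<bullet> y) *\<^sub>R u1 + (u2 \<bullet> y) *\<^sub>R u2 + (u3 \<bullet> y) *\<^sub>R u3"
    and A: "gr_chart W W' A"
  shows "A *v x = ((u3 \<bullet> (A *v u1)) * (u1 \<bullet> x) + (u3 \<bullet> (A *v u2)) * (u2 \<bullet> x)) *\<^sub>R u3"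
    and "y \<in> W' \<Longrightarrow> y = (u1 \<bullet> y) *\<^sub>R (u1 + A *v u1) + (u2 \<bullet> y) *\<^sub>R (u2 + A *v u2)"
    and "y \<in> W' \<Longrightarrow> u3 \<bullet> y = (u3 \<bullet> (A *v u1)) * (u1 \<bullet> y) + (u3 \<bullet> (A *v u2)) * (u2 \<bullet> y)"
proof -
  have o: "u3 \<in> orthogonal_comp W"
    using u(3) by (auto simp: orthogonal_comp_def orthogonal_def inner_commute)
  have A3: "A *v u3 = 0" using A o unfolding gr_chart_def by blast
  have Ap: "A *v p = (u3 \<bullet> (A *v p)) *\<^sub>R u3" if "p \<in> W" for p
  proof -
    have "A *v p \<in> orthogonal_comp W" using A that unfolding gr_chart_def by blast
    then have "u1 \<bullet> (A *v p) = 0" "u2 \<bullet> (A *v p) = 0"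
      using u(1,2) by (auto simp: orthogonal_comp_def orthogonal_def)
    then show ?thesis using u_exp[of "A *v p"] by simp
  qed
  have Ax: "A *v x = (u1 \<bullet> x) *\<^sub>R (A *v u1) + (u2 \<bullet> x) *\<^sub>R (A *v u2)" for x
  proof -
    have "A *v x = A *v ((u1 \<bullet> x) *\<^sub>R u1 + (u2 \<bullet> x) *\<^sub>R u2 + (u3 \<bullet> x) *\<^sub>R u3)"
      using u_exp[of x] by simp
    also have "\<dots> = (u1 \<bullet> x) *\<^sub>R (A *v u1) + (u2 \<bullet> x) *\<^sub>R (A *v u2)"
      by (simp add: matrix_vector_right_distrib matrix_vector_mult_scaleR A3)
    finally show ?thesis .
  qed
  show A_exp: "A *v x = ((u3 \<bullet> (A *v u1)) * (u1 \<bullet> x) + (u3 \<bullet> (A *v u2)) * (u2 \<bullet> x)) *\<^sub>R u3" for x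
  proof -
    have "(u1 \<bullet> x) *\<^sub>R (A *v u1) + (u2 \<bullet> x) *\<^sub>R (A *v u2)
        = (u1 \<bullet> x) *\<^sub>R ((u3 \<bullet> (A *v u1)) *\<^sub>R u3) + (u2 \<bullet> x) *\<^sub>R ((u3 \<bullet> (A *v u2)) *\<^sub>R u3)"
      using Ap[OF u(1)] Ap[OF u(2)] by simp
    also have "\<dots> = ((u3 \<bullet> (A *v u1)) * (u1 \<bullet> x) + (u3 \<bullet> (A *v u2)) * (u2 \<bullet> x)) *\<^sub>R u3"
      by (simp add: algebra_simps)
    finally show ?thesis by (rule trans[OF Ax])
  qed
  show y_exp: "y = (u1 \<bullet> y) *\<^sub>R (u1 + A *v u1) + (u2 \<bullet> y) *\<^sub>R (u2 + A *v u2)"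
    and "u3 \<bullet> y = (u3 \<bullet> (A *v u1)) * (u1 \<bullet> y) + (u3 \<bullet> (A *v u2)) * (u2 \<bullet> y)" if y: "y \<in> W'"
  proof -
    obtain p where p: "y = p + A *v p" "p \<in> W" using A y unfolding gr_chart_def by auto
    define r where "r = (u3 \<bullet> (A *v u1)) * (u1 \<bullet> p) + (u3 \<bullet> (A *v u2)) * (u2 \<bullet> p)"
    have yr: "y = p + r *\<^sub>R u3" unfolding p(1) r_def using A_exp[of p] by simp
    have uy: "u1 \<bullet> y = u1 \<bullet> p" "u2 \<bullet> y = u2 \<bullet> p" "u3 \<bullet> y = r"
      unfolding yr using bspec[OF u(3) p(2)] u(4,5,6) by (simp_all add: inner_right_distrib)
    have pe: "p = (u1 \<bullet> p) *\<^sub>R u1 + (u2 \<bullet> p) *\<^sub>R u2"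
      using u_exp[of p] bspec[OF u(3) p(2)] by simp
    have "p + A *v p = ((u1 \<bullet> p) *\<^sub>R u1 + (u2 \<bullet> p) *\<^sub>R u2) + ((u1 \<bullet> p) *\<^sub>R (A *v u1) + (u2 \<bullet> p) *\<^sub>R (A *v u2))"
      by (rule arg_cong2[OF pe Ax])
    then show "y = (u1 \<bullet> y) *\<^sub>R (u1 + A *v u1) + (u2 \<bullet> y) *\<^sub>R (u2 + A *v u2)"
      unfolding uy(1,2) p(1)[symmetric] by (simp add: algebra_simps)
    show "u3 \<bullet> y = (u3 \<bullet> (A *v u1)) * (u1 \<bullet> y) + (u3 \<bullet> (A *v u2)) * (u2 \<bullet> y)"
      unfolding uy r_def ..
  qed
qed

lemma corank_one_image:
  fixes f :: "real^2 \<Rightarrow> real^3"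
  assumes f: "smooth_germ a f" and cr: "corank a f = 1"
    and k: "der f a k = 0" "k \<noteq> 0"
  obtains w where "der f a w \<noteq> 0"
    "\<And>v. \<exists>c. der f a v = c *\<^sub>R der f a w"
proof -
  let ?D = "der f a"
  note lin = frechet_linear[OF f]
  define w :: "real^2" where "w = vector [- k $ 2, k $ 1]"
  have kk: "k \<bullet> k \<noteq> 0" using k(2) by simp
  have kk': "k \<bullet> k = k $ 1 * k $ 1 + k $ 2 * k $ 2" by (simp add: inner_vec_def sum_2)
  have v_eq: "(k \<bullet> k) *\<^sub>R v = (k \<bullet> v) *\<^sub>R k + (w \<bullet> v) *\<^sub>R w" for v
    by (simp add: vec_eq_iff forall_2 w_def inner_vec_def sum_2 algebra_simps)
  have "?D w \<noteq> 0"
  proof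
    assume "?D w = 0"
    then obtain c where "w = c *\<^sub>R k"
      using dim_one_multiple[of "{v. ?D v = 0}" k w] cr k by (auto simp: corank_def)
    then have "- k $ 2 = c * k $ 1" "k $ 1 = c * k $ 2" by (auto simp: w_def vec_eq_iff forall_2)
    then have "k $ 1 * k $ 1 + k $ 2 * k $ 2 = 0" by algebra
    then show False using kk kk' by simp
  qed
  moreover have "\<exists>c. ?D v = c *\<^sub>R ?D w" for v
  proof
    have "(k \<bullet> k) *\<^sub>R ?D v = (w \<bullet> v) *\<^sub>R ?D w"
      using arg_cong[OF v_eq[of v], of ?D] k(1) by (simp add: linear_scale[OF lin] linear_add[OF lin])
    then show "?D v = ((w \<bullet> v) / (k \<bullet> k)) *\<^sub>R ?D w"
      using kk by (metis (no_types) divide_inverse inverse_eq_divide mult.commute scaleR_scaleR scaleR_one right_inverse)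
  qed
  ultimately show ?thesis using that by blast
qed

lemma frechet_mult_zero:
  assumes "smooth_germ a g" "smooth_germ a h" "g a = (0::real)"
  shows "der (\<lambda>t. g t * h t) a v = der g a v * h a"
  using fun_cong[OF frechet_derivative_at[OF has_derivative_mult[OF smooth_germ_derivative[OF assms(1)] smooth_germ_derivative[OF assms(2)]]], of v] assms(3)
  by simp

lemma frechet_add:
  assumes "smooth_germ a g" "smooth_germ a h"
  shows "der (\<lambda>t. g t + h t) a v = der g a v + der h a v"
  using frechet_derivative_at[OF has_derivative_add[OF smooth_germ_derivative[OF assms(1)] smooth_germ_derivative[OF assms(2)]], symmetric]
  by simp

text \<open>
  In the frame given by the plane \<open>P a\<close> and the image line of the differential, the lift is the
  pair \<open>A1\<close>, \<open>A2\<close>. The two derivative conditions of the criterion come from the Jacobian and from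
  the immersivity of the lift.
\<close>

theorem front_cuspidal_edge:
  fixes f :: "real^2 \<Rightarrow> real^3"
  assumes "front a f" and cr: "corank a f = 1" and jac: "is_jacobian a f l"
    and \<eta>: "der f a (\<eta> a) = 0" "vf_apply \<eta> l a \<noteq> 0"
  shows "A_equivalent f a cuspidal_edge 0"
proof -
  obtain P where f: "smooth_germ a f" and P: "legendre_lift a f P" "immersive_lift a f P"
    using assms(1) unfolding front_def by blast
  obtain A where A: "smooth_germ a A" "\<forall>\<^sub>F t in nhds a. gr_chart (P a) (P t) (A t)"
    and imm: "inj (der (\<lambda>t. (f t, A t)) a)"
    using P(2) unfolding immersive_lift_def smooth_gr_expr_def by blast
  have Pa: "P a \<in> Gr 2" and range: "\<forall>\<^sub>F t in nhds a. range (der f t) \<subseteq> P t"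
    using P(1) eventually_nhds_x_imp_x[of "\<lambda>t. P t \<in> Gr 2" a] unfolding legendre_lift_def by auto
  have subP: "subspace (P a)" using Pa by (simp add: Gr_def)
  let ?D = "\<lambda>t. der f t"
  have sl: "smooth_germ a l" using jac by (simp add: is_jacobian_def)
  have \<eta>0: "\<eta> a \<noteq> 0" using \<eta>(2) linear_0[OF frechet_linear[OF sl]] by (auto simp: vf_apply_def)
  obtain w where w: "?D a w \<noteq> 0" "\<And>v. \<exists>c. ?D a v = c *\<^sub>R ?D a w"
    by (rule corank_one_image[OF f cr \<eta>(1) \<eta>0]) blast
  have wP: "?D a w \<in> P a" using eventually_nhds_x_imp_x[OF range] by blast
  obtain u1 u2 u3 where u: "?D a w = norm (?D a w) *\<^sub>R u1" "u1 \<in> P a" "u2 \<in> P a" "\<And>p. p \<in> P a \<Longrightarrow> u3 \<bullet> p = 0"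
    "u1 \<bullet> u1 = 1" "u2 \<bullet> u2 = 1" "u3 \<bullet> u3 = 1" "u1 \<bullet> u2 = 0" "u1 \<bullet> u3 = 0" "u2 \<bullet> u3 = 0"
    and u_exp: "\<And>y. y = (u1 \<bullet> y) *\<^sub>R u1 + (u2 \<bullet> y) *\<^sub>R u2 + (u3 \<bullet> y) *\<^sub>R u3"
    and inv: "invertible (vector [u1, u2, u3] :: real^3^3)"
    by (rule orthonormal_frame[OF Pa wP w(1)]) (rule that)
  define F where "F u t = u \<bullet> f t" for u t
  define A1 where "A1 t = u3 \<bullet> (A t *v u1)" for t
  define A2 where "A2 t = u3 \<bullet> (A t *v u2)" for t
  have sA: "smooth_germ a A1" "smooth_germ a A2"
    unfolding A1_def A2_def by (intro smooth_germ_linear_comp[OF bounded_linear_matrix_entry] A)+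
  have sF: "smooth_germ a (F u)" for u unfolding F_def by (intro germ_intros f)
  have dF: "\<forall>\<^sub>F t in nhds a. \<forall>u v. der (F u) t v = u \<bullet> ?D t v"
    using smooth_germ_eventually_smooth[OF f]
  proof eventually_elim
    case (elim t)
    show ?case
    proof (intro allI)
      fix u v
      show "der (F u) t v = u \<bullet> ?D t v"
        unfolding F_def[abs_def]
        using frechet_derivative_at[OF bounded_linear.has_derivative[OF bounded_linear_inner_right smooth_germ_derivative[OF elim]], symmetric]
        by simp
    qed
  qed
  have dFa: "der (F u) a v = u \<bullet> ?D a v" for u v
    using eventually_nhds_x_imp_x[OF dF] by blast
  have Aa: "A1 a = 0" "A2 a = 0"
    using gr_chart_base[OF eventually_nhds_x_imp_x[OF A(2)] _ subP] u(2,3) by (auto simp: A1_def A2_def)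
  have u4: "\<forall>p\<in>P a. u3 \<bullet> p = 0" using u(4) by blast
  note frame = gr_chart_frame[OF u(2,3) u4 u(9,10,7) u_exp]
  have A_exp: "\<forall>\<^sub>F t in nhds a. \<forall>x. A t *v x = (A1 t * (u1 \<bullet> x) + A2 t * (u2 \<bullet> x)) *\<^sub>R u3"
    using A(2) unfolding A1_def A2_def by (rule eventually_mono) (intro allI frame(1))
  have pfaff: "\<forall>\<^sub>F t in nhds a. \<forall>v. u3 \<bullet> ?D t v = A1 t * (u1 \<bullet> ?D t v) + A2 t * (u2 \<bullet> ?D t v)"
    using A(2) range
  proof eventually_elim
    case (elim t)
    show ?case unfolding A1_def A2_def by (intro allI frame(3)[OF elim(1)]) (use elim(2) in blast)
  qed
  define X where "X t = (vector [- der (F u1) t (axis 2 1), der (F u1) t (axis 1 1)] :: real^2)" for t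
  have sX: "smooth_germ a X" unfolding X_def by (intro germ_intros sF)
  have DX: "\<forall>\<^sub>F t in nhds a. \<forall>u. vf_apply X (F u) t =
      (u1 \<bullet> ?D t (axis 1 1)) * (u \<bullet> ?D t (axis 2 1)) - (u1 \<bullet> ?D t (axis 2 1)) * (u \<bullet> ?D t (axis 1 1))"
    using dF smooth_germ_eventually_smooth[OF f]
  proof eventually_elim
    case (elim t)
    show ?case
      using linear_vec2_expand[OF frechet_linear[OF elim(2)], of "X t"] elim(1)
      by (simp add: vf_apply_def inner_right_distrib) (simp add: X_def elim(1))
  qed
  have XF1: "\<forall>\<^sub>F t in nhds a. vf_apply X (F u1) t = 0"
    using DX by eventually_elim simp
  have XF3: "\<forall>\<^sub>F t in nhds a. vf_apply X (F u3) t = A2 t * vf_apply X (F u2) t"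
    using DX pfaff
  proof eventually_elim
    case (elim t)
    show ?case
      unfolding elim(1)[rule_format] elim(2)[rule_format] by (simp add: algebra_simps)
  qed
  have df1: "der (F u1) a w \<noteq> 0"
    using w(1) u(5) by (subst dFa, subst u(1)) simp
  have u2D: "u2 \<bullet> ?D a v = 0" "u3 \<bullet> ?D a v = 0" for v
  proof -
    obtain c where "?D a v = (c * norm (?D a w)) *\<^sub>R u1" using w(2)[of v] u(1) by (metis scaleR_scaleR)
    then show "u2 \<bullet> ?D a v = 0" "u3 \<bullet> ?D a v = 0" using u(8,9) by (simp_all add: inner_commute)
  qed
  have DXa: "?D a (X a) = 0"
    using u_exp[of "?D a (X a)"] u2D eventually_nhds_x_imp_x[OF XF1] by (simp add: vf_apply_def dFa)
  have X0: "X a \<noteq> 0"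
  proof
    assume "X a = 0"
    then have "der (F u1) a (axis 1 1) = 0" "der (F u1) a (axis 2 1) = 0"
      by (auto simp: X_def vec_eq_iff forall_2)
    then show False using df1 linear_vec2_expand[OF frechet_linear[OF sF[of u1]], of w] by simp
  qed
  obtain c where c: "\<eta> a = c *\<^sub>R X a"
    using dim_one_multiple[of "{v. ?D a v = 0}" "X a" "\<eta> a"] cr DXa X0 \<eta>(1) by (auto simp: corank_def)
  have F2a: "vf_apply X (F u2) a = 0" by (simp add: vf_apply_def dFa DXa)
  \<comment> \<open>The differential factors through \<open>dF1\<close> and \<open>dF2\<close>, so every minor is a multiple of \<open>dF1 \<and> dF2 = X F2\<close>.\<close>
  have "\<exists>k. smooth_germ a k \<and> (\<forall>\<^sub>F t in nhds a. g t = k t * vf_apply X (F u2) t)"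
    if g: "g \<in> jacobi_minor f ` {s. inj s}" for g
  proof -
    obtain s where s: "g = jacobi_minor f s" using g by blast
    define z1 where "z1 i t = u1 $ i + A1 t * u3 $ i" for i t
    define z2 where "z2 i t = u2 $ i + A2 t * u3 $ i" for i t
    have "smooth_germ a (\<lambda>t. z1 (s 1) t * z2 (s 2) t - z1 (s 2) t * z2 (s 1) t)"
      unfolding z1_def z2_def by (intro germ_intros sA)
    moreover have "\<forall>\<^sub>F t in nhds a. g t = (z1 (s 1) t * z2 (s 2) t - z1 (s 2) t * z2 (s 1) t) * vf_apply X (F u2) t"
      using DX pfaff
    proof eventually_elim
      case (elim t)
      have D: "?D t v $ i = (u1 \<bullet> ?D t v) * z1 i t + (u2 \<bullet> ?D t v) * z2 i t" for v i
        using arg_cong[OF u_exp[of "?D t v"], of "\<lambda>y. y $ i"] elim(2)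
        by (simp add: z1_def z2_def algebra_simps)
      show ?case
        unfolding s jacobi_minor_eq elim(1)[rule_format] D by (simp add: algebra_simps)
    qed
    ultimately show ?thesis by blast
  qed
  from germ_ideal_multiple[OF jacobian_in_ideal[OF jac, unfolded jacobi_ideal_def] finite_minors this]
  obtain k where k: "smooth_germ a k" "\<forall>\<^sub>F t in nhds a. l t = k t * vf_apply X (F u2) t" by blast
  have smu: "smooth_germ a (vf_apply X (F u2))" by (intro germ_intros sX sF)
  have "vf_apply \<eta> l a = der (\<lambda>t. vf_apply X (F u2) t * k t) a (\<eta> a)"
    unfolding vf_apply_def[of \<eta>] frechet_derivative_germ_cong[OF k(2)] by (simp add: mult.commute)
  also have "\<dots> = der (vf_apply X (F u2)) a (\<eta> a) * k a"
    by (rule frechet_mult_zero[OF smu k(1) F2a])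
  also have "der (vf_apply X (F u2)) a (\<eta> a) = c * vf_apply X (vf_apply X (F u2)) a"
    unfolding c vf_apply_def[of X "vf_apply _ _"] using linear_scale[OF frechet_linear[OF smu]] by simp
  finally have XX: "vf_apply X (vf_apply X (F u2)) a \<noteq> 0" using \<eta>(2) by auto
  \<comment> \<open>Symmetry of the second derivative of \<open>F3\<close> at \<open>a\<close> in the directions \<open>w\<close> and \<open>X a\<close>:
    one side is \<open>(X A1)(a)\<close> times \<open>dF1(w) \<noteq> 0\<close>, the other vanishes since \<open>df(X a) = 0\<close>.\<close>
  have D2: "der (\<lambda>t. der (F u3) t v) a x
      = der A1 a x * (u1 \<bullet> ?D a v)" for v x
  proof -
    have "\<forall>\<^sub>F t in nhds a. der (F u3) t v
        = A1 t * der (F u1) t v + A2 t * der (F u2) t v"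
      using dF pfaff by eventually_elim simp
    from frechet_derivative_germ_cong[OF this]
    have "der (\<lambda>t. der (F u3) t v) a x
      = der (\<lambda>t. A1 t * der (F u1) t v + A2 t * der (F u2) t v) a x"
      by simp
    also have "\<dots> = der (\<lambda>t. A1 t * der (F u1) t v) a x
        + der (\<lambda>t. A2 t * der (F u2) t v) a x"
      by (intro frechet_add germ_intros sA sF)
    finally show ?thesis
      using sA sF by (simp add: frechet_mult_zero[OF _ smooth_germ_frechet] Aa dFa u2D)
  qed
  have XA1: "der A1 a (X a) = 0"
    using second_derivative_symmetric[OF sF[of u3], of w "X a"] df1 by (simp add: D2 DXa dFa)
  have XA2: "vf_apply X A2 a \<noteq> 0"
  proof
    assume "vf_apply X A2 a = 0"
    then have XA2: "der A2 a (X a) = 0" by (simp add: vf_apply_def)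
    have "der A a (X a) *v x = 0" for x
    proof -
      have "y \<bullet> (der A a (X a) *v x) = 0" for y
      proof -
        have 1: "der (\<lambda>t. y \<bullet> (A t *v x)) a (X a) = y \<bullet> (der A a (X a) *v x)"
          using frechet_derivative_at[OF bounded_linear.has_derivative[OF bounded_linear_matrix_entry smooth_germ_derivative[OF A(1)]], symmetric]
          by simp
        have "\<forall>\<^sub>F t in nhds a. y \<bullet> (A t *v x) = (A1 t * (u1 \<bullet> x) + A2 t * (u2 \<bullet> x)) * (y \<bullet> u3)"
          using A_exp by eventually_elim simp
        from frechet_derivative_germ_cong[OF this]
        have "der (\<lambda>t. y \<bullet> (A t *v x)) a (X a) =
          der (\<lambda>t. (A1 t * (u1 \<bullet> x) + A2 t * (u2 \<bullet> x)) * (y \<bullet> u3)) a (X a)" by simp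
        also have "\<dots> = (der A1 a (X a) * (u1 \<bullet> x) + der A2 a (X a) * (u2 \<bullet> x)) * (y \<bullet> u3)"
        proof -
          have "((\<lambda>t. (A1 t * (u1 \<bullet> x) + A2 t * (u2 \<bullet> x)) * (y \<bullet> u3)) has_derivative
              (\<lambda>v. (der A1 a v * (u1 \<bullet> x) + der A2 a v * (u2 \<bullet> x)) * (y \<bullet> u3))) (at a)"
            by (intro has_derivative_mult_left has_derivative_add smooth_germ_derivative sA)
          from frechet_derivative_at[OF this, symmetric] show ?thesis by simp
        qed
        finally show ?thesis using 1 XA1 XA2 by simp
      qed
      then show ?thesis by (metis inner_eq_zero_iff)
    qed
    then have "der A a (X a) = 0" by (simp add: matrix_eq)
    then have "der (\<lambda>t. (f t, A t)) a (X a) = der (\<lambda>t. (f t, A t)) a 0"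
      using frechet_derivative_at[OF has_derivative_Pair[OF smooth_germ_derivative[OF f] smooth_germ_derivative[OF A(1)]], symmetric] DXa
      by (simp add: linear_0[OF frechet_linear[OF f]] linear_0[OF frechet_linear[OF A(1)]])
    then show False using imm X0 by (auto dest: injD)
  qed
  have "A_equivalent (\<lambda>t. vector [F u1 t, F u2 t, F u3 t]) a cuspidal_edge 0"
    by (rule cuspidal_edge_criterion[OF sF sF sF sA(2) sX XF1 XF3 df1 F2a XX XA2])
  moreover have "(\<lambda>t. vector [F u1 t, F u2 t, F u3 t]) = (\<lambda>t. (vector [u1, u2, u3] :: real^3^3) *v (f t - 0))"
    by (simp add: fun_eq_iff vec_eq_iff forall_3 F_def matrix_vector_mult_def inner_vec_def)
  ultimately show ?thesis
    using A_equivalent_trans[OF A_equivalent_affine[OF inv, of f a 0]] by simp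
qed

section \<open>Order three in adapted coordinates\<close>

text \<open>
  The second part is the product rule with one vanishing term: along a direction in the kernel of
  \<open>f\<close> the base point \<open>f t\<close> does not move to first order.
\<close>

lemma smooth_germ_frechet_along:
  fixes g :: "'b::euclidean_space \<Rightarrow> 'c::real_normed_vector" and f :: "'a::real_normed_vector \<Rightarrow> 'b"
  assumes g: "smooth_germ (f a) g" and f: "smooth_germ a f" and z: "smooth_germ a z"
  shows "smooth_germ a (\<lambda>t. der g (f t) (z t))"
    and "der f a k = 0 \<Longrightarrow>
      der (\<lambda>t. der g (f t) (z t)) a k
        = der g (f a) (der z a k)"
proof -
  let ?S = "\<lambda>t. \<Sum>b\<in>Basis. (z t \<bullet> b) *\<^sub>R der g (f t) b"
  have expand: "(\<Sum>b\<in>Basis. (y \<bullet> b) *\<^sub>R L b) = L y" if "linear L" for L :: "'b \<Rightarrow> 'c" and y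
    by (subst (2) euclidean_representation[of y, symmetric]) (simp add: linear_sum[OF that] linear_scale[OF that] del: euclidean_representation)
  have eq: "\<forall>\<^sub>F t in nhds a. ?S t = der g (f t) (z t)"
    using eventually_compose_germ[OF smooth_germ_eventually_smooth[OF g] f refl]
    by eventually_elim (rule expand[OF frechet_linear])
  have sG: "smooth_germ a (\<lambda>t. der g (f t) b)" for b
    by (rule smooth_germ_compose[OF smooth_germ_frechet[OF g] refl f])
  have "smooth_germ a ?S" by (intro germ_intros z sG)
  then show "smooth_germ a (\<lambda>t. der g (f t) (z t))"
    using eq by (rule smooth_germ_cong)
  assume k: "der f a k = 0"
  have G0: "der (\<lambda>t. der g (f t) b) a k = 0" for b
    using frechet_derivative_compose[OF f smooth_germ_frechet[OF g], of b k] k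
      linear_0[OF frechet_linear[OF smooth_germ_frechet[OF g]]] by simp
  have "(?S has_derivative (\<lambda>v. \<Sum>b\<in>Basis. (z a \<bullet> b) *\<^sub>R der (\<lambda>t. der g (f t) b) a v
      + (der z a v \<bullet> b) *\<^sub>R der g (f a) b)) (at a)"
    by (intro has_derivative_sum has_derivative_scaleR smooth_germ_derivative sG
      bounded_linear.has_derivative[OF bounded_linear_inner_left] z)
  from fun_cong[OF frechet_derivative_at[OF this, symmetric], of k]
  have "der ?S a k = (\<Sum>b\<in>Basis. (der z a k \<bullet> b) *\<^sub>R der g (f a) b)"
    by (simp add: G0)
  also have "\<dots> = der g (f a) (der z a k)"
    by (rule expand[OF frechet_linear[OF g]])
  finally show "der (\<lambda>t. der g (f t) (z t)) a k
        = der g (f a) (der z a k)"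
    using frechet_derivative_germ_cong[OF eq] by simp
qed

lemma vf_apply_cong:
  assumes "\<forall>\<^sub>F t in nhds a. g t = h t"
  shows "\<forall>\<^sub>F t in nhds a. vf_apply \<eta> g t = vf_apply \<eta> h t"
  using eventually_frechet_derivative_cong[OF assms] by eventually_elim (simp add: vf_apply_def)

lemma vf_apply_mult:
  assumes "smooth_germ a g" "smooth_germ a h"
  shows "\<forall>\<^sub>F t in nhds a. vf_apply \<eta> (\<lambda>t. g t * h t) t = g t * vf_apply \<eta> h t + vf_apply \<eta> g t * h t"
  using smooth_germ_eventually_smooth[OF assms(1)] smooth_germ_eventually_smooth[OF assms(2)]
proof eventually_elim
  case (elim t)
  from frechet_derivative_at[OF has_derivative_mult[OF smooth_germ_derivative[OF elim(1)] smooth_germ_derivative[OF elim(2)]], symmetric]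
  show ?case by (simp add: vf_apply_def)
qed

lemma vf_apply_add:
  assumes "smooth_germ a g" "smooth_germ a h"
  shows "\<forall>\<^sub>F t in nhds a. vf_apply \<eta> (\<lambda>t. g t + h t) t = vf_apply \<eta> g t + vf_apply \<eta> h t"
  using smooth_germ_eventually_smooth[OF assms(1)] smooth_germ_eventually_smooth[OF assms(2)]
  by eventually_elim (simp add: vf_apply_def frechet_add)

lemma vf_apply_at:
  assumes "\<forall>\<^sub>F t in nhds a. g t = h t" shows "vf_apply \<eta> g a = vf_apply \<eta> h a"
  using eventually_nhds_x_imp_x[OF vf_apply_cong[OF assms]] .

lemma vf_ord_eq:
  assumes "\<And>i. i < n \<Longrightarrow> (vf_apply \<eta> ^^ i) h a = 0" "(vf_apply \<eta> ^^ n) h a \<noteq> 0"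
  shows "vf_ord a \<eta> h = enat n"
  unfolding vf_ord_def
proof (rule antisym)
  show "(INF i\<in>{i. (vf_apply \<eta> ^^ i) h a \<noteq> 0}. enat i) \<le> enat n"
    by (rule INF_lower) (use assms(2) in simp)
  show "enat n \<le> (INF i\<in>{i. (vf_apply \<eta> ^^ i) h a \<noteq> 0}. enat i)"
  proof (rule INF_greatest)
    fix i assume "i \<in> {i. (vf_apply \<eta> ^^ i) h a \<noteq> 0}"
    then have "\<not> i < n" using assms(1) by blast
    then show "enat n \<le> enat i" by simp
  qed
qed

lemma vf_ordD:
  assumes "vf_ord a \<eta> h = enat n" shows "(vf_apply \<eta> ^^ n) h a \<noteq> 0"
proof -
  let ?S = "enat ` {i. (vf_apply \<eta> ^^ i) h a \<noteq> 0}"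
  have I: "Inf ?S = enat n" using assms by (simp add: vf_ord_def)
  have "?S \<noteq> {}"
  proof
    assume "?S = {}"
    then have "Inf ?S = Inf {}" by (rule arg_cong)
    then show False using I by (simp add: top_enat_def)
  qed
  then obtain e where e: "e \<in> ?S" by blast
  with \<open>?S \<noteq> {}\<close> have "Inf ?S = (LEAST x. x \<in> ?S)" by (simp only: Inf_enat_def if_False)
  also have "\<dots> \<in> ?S" using e by (rule LeastI)
  finally have "Inf ?S \<in> ?S" .
  then show ?thesis using I by auto
qed

lemma corank_one_kernel:
  assumes "corank a f = 1" obtains k where "der f a k = 0" "k \<noteq> 0"
proof -
  have "\<not> {v. der f a v = 0} \<subseteq> {0}"
  proof
    assume "{v. der f a v = 0} \<subseteq> {0}"
    then have "dim {v. der f a v = 0} = 0" by (simp add: dim_eq_0)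
    then show False using assms unfolding corank_def by linarith
  qed
  then show ?thesis using that by blast
qed

lemma kernel_module_at:
  fixes f :: "real^2 \<Rightarrow> real^3"
  assumes f: "smooth_germ a f" and cr: "corank a f = 1" and \<eta>: "\<eta> \<in> kernel_module a f"
  shows "der f a (\<eta> a) = 0"
proof -
  obtain k where k: "der f a k = 0" "k \<noteq> 0" using corank_one_kernel[OF cr] .
  have "vf_apply \<eta> (\<lambda>t. f t $ i) a = 0" for i
    using \<eta> by (intro jacobi_ideal_vanish[OF f k]) (simp add: kernel_module_def)
  then show ?thesis by (simp add: vf_apply_def frechet_vec_nth[OF f] vec_eq_iff)
qed

lemma jacobian_at:
  fixes f :: "real^2 \<Rightarrow> real^3"
  assumes "smooth_germ a f" "corank a f = 1" "is_jacobian a f l"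
  shows "l a = 0"
  by (rule corank_one_kernel[OF assms(2)]) (rule jacobi_ideal_vanish[OF assms(1) _ _ jacobian_in_ideal[OF assms(3)]])

lemma inverse_derivative_inv:
  assumes "diffeo_germ x b c"
  shows "inv (der x b) (der x b v) = v"
    and "der x b (inv (der x b) w) = w"
  using diffeo_germ_derivative_bij[OF assms] by (simp_all add: bij_is_inj bij_is_surj surj_f_inv_f)

lemma coord_vector_derivative:
  assumes "diffeo_germ x b c"
  shows "der x b (coord_vector x b i) = axis i 1"
  unfolding coord_vector_def by (rule inverse_derivative_inv(2)[OF assms])

text \<open>
  In the Leibniz formula for the second derivative of \<open>y g\<close> every term contains one of the three
  vanishing factors.
\<close>

lemma third_derivative_vanishes:
  fixes y g :: "real^2 \<Rightarrow> real"
  assumes s: "smooth_germ a y" "smooth_germ a g" "smooth_germ a \<eta>" and z: "y a = 0" "g a = 0" "vf_apply \<eta> g a = 0"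
  shows "vf_apply \<eta> (vf_apply \<eta> (\<lambda>t. y t * g t)) a = 0"
proof -
  have sv: "smooth_germ a (vf_apply \<eta> y)" "smooth_germ a (vf_apply \<eta> g)" by (intro germ_intros s)+
  have 1: "vf_apply \<eta> (vf_apply \<eta> (\<lambda>t. y t * g t)) a = vf_apply \<eta> (\<lambda>t. y t * vf_apply \<eta> g t + vf_apply \<eta> y t * g t) a"
    by (rule vf_apply_at[OF vf_apply_mult[OF s(1,2)]])
  also have "\<dots> = vf_apply \<eta> (\<lambda>t. y t * vf_apply \<eta> g t) a + vf_apply \<eta> (\<lambda>t. vf_apply \<eta> y t * g t) a"
    by (rule eventually_nhds_x_imp_x[OF vf_apply_add]) (intro germ_intros s sv)+
  also have "\<dots> = 0"
    using eventually_nhds_x_imp_x[OF vf_apply_mult[OF s(1) sv(2), of \<eta>]] eventually_nhds_x_imp_x[OF vf_apply_mult[OF sv(1) s(2), of \<eta>]] z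
    by simp
  finally show ?thesis .
qed

text \<open>
  Suppose that a vector killed by \<open>df\<close> is also killed by the differential of the lift \<open>A\<close>; it is
  then proportional to \<open>\<eta> a\<close>. Since \<open>df(\<eta>)\<close> lies in the lifted plane, \<open>\<eta> f3\<close> is the sum over the
  frame of products of a coordinate \<open>y\<close> of \<open>df(\<eta>)\<close> and the value \<open>\<omega>\<close> of \<open>dx3\<close> on the lifted frame
  vector. Both factors vanish at \<open>a\<close>, and \<open>\<eta> \<omega>\<close> vanishes there because neither the base point nor
  the plane moves along \<open>\<eta>\<close>.
\<close>

theorem adapted_order_three_front:
  fixes f :: "real^2 \<Rightarrow> real^3"
  assumes f: "smooth_germ a f" and cr: "corank a f = 1"
    and \<eta>: "smooth_germ a \<eta>" "der f a (\<eta> a) = 0" "\<eta> a \<noteq> 0"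
    and x: "adapted_coordinates a f x" and ord: "vf_ord a \<eta> (\<lambda>t. x (f t) $ 3) = 3"
  shows "front a f"
proof -
  obtain P where dx: "diffeo_germ x (f a) 0" and P: "legendre_lift a f P"
    and Pa: "P a = span {coord_vector x (f a) 1, coord_vector x (f a) 2}"
    using x unfolding adapted_coordinates_def by blast
  obtain A where A: "smooth_germ a A" "\<forall>\<^sub>F t in nhds a. gr_chart (P a) (P t) (A t)" and expr: "smooth_gr_expr a P A"
    using P unfolding legendre_lift_def smooth_gr_expr_def by blast
  have PG: "P a \<in> Gr 2" and range: "\<forall>\<^sub>F t in nhds a. range (der f t) \<subseteq> P t"
    using P eventually_nhds_x_imp_x[of "\<lambda>t. P t \<in> Gr 2" a] unfolding legendre_lift_def by auto
  have subP: "subspace (P a)" using PG by (simp add: Gr_def)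
  let ?D = "\<lambda>t. der f t" and ?k = "\<eta> a"
  have sx: "smooth_germ (f a) x" by (rule diffeo_germ_smooth[OF dx])
  let ?Dx = "der x (f a)"
  have lx: "linear ?Dx" by (rule frechet_linear[OF sx])
  have c1: "coord_vector x (f a) 1 \<in> P a" unfolding Pa by (intro span_base) simp
  have c10: "coord_vector x (f a) 1 \<noteq> 0"
  proof
    assume "coord_vector x (f a) 1 = 0"
    then have "axis 1 1 = (0 :: real^3)" using coord_vector_derivative[OF dx, of 1] linear_0[OF lx] by simp
    then show False by (simp add: axis_eq_0_iff)
  qed
  have Dx3: "?Dx p $ 3 = 0" if p: "p \<in> P a" for p
    using p unfolding Pa
  proof (induction rule: span_induct_alt)
    case base then show ?case using linear_0[OF lx] by simp
  next
    case (step c v y)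
    then show ?case
      by (auto simp: linear_add[OF lx] linear_scale[OF lx] coord_vector_derivative[OF dx] axis_def)
  qed
  obtain u1 u2 u3 where u: "u1 \<in> P a" "u2 \<in> P a" "\<And>p. p \<in> P a \<Longrightarrow> u3 \<bullet> p = 0"
    "u1 \<bullet> u3 = 0" "u2 \<bullet> u3 = 0" "u3 \<bullet> u3 = 1"
    and u_exp: "\<And>y. y = (u1 \<bullet> y) *\<^sub>R u1 + (u2 \<bullet> y) *\<^sub>R u2 + (u3 \<bullet> y) *\<^sub>R u3"
    by (rule orthonormal_frame[OF PG c1 c10]) (rule that)
  have u3: "\<forall>p\<in>P a. u3 \<bullet> p = 0" using u(3) by blast
  note frame = gr_chart_frame[OF u(1,2) u3 u(4,5,6) u_exp]
  define y where "y u t = u \<bullet> ?D t (\<eta> t)" for u t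
  define \<omega> where "\<omega> u t = der x (f t) (u + A t *v u) $ 3" for u t
  have sy: "smooth_germ a (y u)" for u unfolding y_def by (intro germ_intros f \<eta>)
  have ya: "y u a = 0" for u by (simp add: y_def \<eta>)
  have blA: "bounded_linear (\<lambda>A::real^3^3. A *v u)" for u :: "real^3"
  proof -
    have "linear (\<lambda>A::real^3^3. A *v u)"
      by (rule linearI) (simp_all add: matrix_vector_mult_add_rdistrib scaleR_matrix_vector_assoc[symmetric])
    then show ?thesis by (simp add: linear_conv_bounded_linear)
  qed
  have sz: "smooth_germ a (\<lambda>t. u + A t *v u)" for u
    by (intro germ_intros smooth_germ_linear_comp[OF blA] A)
  have s\<omega>: "smooth_germ a (\<omega> u)" for u
    unfolding \<omega>_def by (intro smooth_germ_vec_nth smooth_germ_frechet_along(1) sx f sz)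
  have Aa: "A a *v u = 0" if "u \<in> P a" for u
    using gr_chart_base[OF eventually_nhds_x_imp_x[OF A(2)] that subP] .
  have \<omega>a: "\<omega> u a = 0" if "u \<in> P a" for u
    using Dx3[OF that] Aa[OF that] by (simp add: \<omega>_def)
  have h1: "\<forall>\<^sub>F t in nhds a. vf_apply \<eta> (\<lambda>t. x (f t) $ 3) t = y u1 t * \<omega> u1 t + y u2 t * \<omega> u2 t"
    using A(2) range smooth_germ_eventually_smooth[OF f] eventually_compose_germ[OF smooth_germ_eventually_smooth[OF sx] f refl]
  proof eventually_elim
    case (elim t)
    let ?Y = "?D t (\<eta> t)" and ?L = "der x (f t)"
    have Y: "?Y = (u1 \<bullet> ?Y) *\<^sub>R (u1 + A t *v u1) + (u2 \<bullet> ?Y) *\<^sub>R (u2 + A t *v u2)"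
      by (rule frame(2)[OF elim(1)]) (use elim(2) in blast)
    note l = frechet_linear[OF elim(4)]
    have sxf: "smooth_germ t (\<lambda>t. x (f t))" by (rule smooth_germ_compose[OF elim(4) refl elim(3)])
    have "vf_apply \<eta> (\<lambda>t. x (f t) $ 3) t = ?L ?Y $ 3"
      by (simp add: vf_apply_def frechet_vec_nth[OF sxf] frechet_derivative_compose[OF elim(3,4)])
    also have "?L ?Y = (u1 \<bullet> ?Y) *\<^sub>R ?L (u1 + A t *v u1) + (u2 \<bullet> ?Y) *\<^sub>R ?L (u2 + A t *v u2)"
      by (rule trans[OF arg_cong[OF Y]]) (simp only: linear_add[OF l, of "_ *\<^sub>R _"] linear_scale[OF l])
    finally show ?case by (simp add: y_def \<omega>_def)
  qed
  have inj: "inj (der (\<lambda>t. (f t, A t)) a)"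
  proof -
    have D: "der (\<lambda>t. (f t, A t)) a = (\<lambda>v. (?D a v, der A a v))"
      by (rule frechet_derivative_at[symmetric]) (intro has_derivative_Pair smooth_germ_derivative f A)
    have "v = 0" if v: "?D a v = 0" "der A a v = 0" for v
    proof (rule ccontr)
      assume "v \<noteq> 0"
      then obtain c where c: "?k = c *\<^sub>R v"
        using dim_one_multiple[of "{v. ?D a v = 0}" v ?k] cr v(1) \<eta>(2) by (auto simp: corank_def)
      have DAk: "der A a ?k = 0"
        unfolding c using v(2) linear_scale[OF frechet_linear[OF A(1)]] by simp
      have \<eta>\<omega>: "vf_apply \<eta> (\<omega> u) a = 0" for u
      proof -
        have "((\<lambda>t. u + A t *v u) has_derivative (\<lambda>v. 0 + der A a v *v u)) (at a)"
          by (intro has_derivative_add has_derivative_const bounded_linear.has_derivative[OF blA] smooth_germ_derivative A)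
        from frechet_derivative_at[OF this, symmetric]
        have "der (\<lambda>t. u + A t *v u) a ?k = 0" by (simp add: DAk)
        then have "der (\<lambda>t. der x (f t) (u + A t *v u)) a ?k = 0"
          using smooth_germ_frechet_along(2)[OF sx f sz \<eta>(2)] linear_0[OF lx] by simp
        then show ?thesis
          unfolding vf_apply_def \<omega>_def[abs_def] by (simp add: frechet_vec_nth[OF smooth_germ_frechet_along(1)[OF sx f sz]])
      qed
      have "(vf_apply \<eta> ^^ 3) (\<lambda>t. x (f t) $ 3) a = vf_apply \<eta> (vf_apply \<eta> (vf_apply \<eta> (\<lambda>t. x (f t) $ 3))) a"
        by (simp add: numeral_3_eq_3)
      also have "\<dots> = vf_apply \<eta> (vf_apply \<eta> (\<lambda>t. y u1 t * \<omega> u1 t + y u2 t * \<omega> u2 t)) a"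
        by (rule vf_apply_at[OF vf_apply_cong[OF h1]])
      also have "\<dots> = vf_apply \<eta> (\<lambda>t. vf_apply \<eta> (\<lambda>t. y u1 t * \<omega> u1 t) t + vf_apply \<eta> (\<lambda>t. y u2 t * \<omega> u2 t) t) a"
        by (rule vf_apply_at[OF vf_apply_add]) (intro germ_intros sy s\<omega>)+
      also have "\<dots> = vf_apply \<eta> (vf_apply \<eta> (\<lambda>t. y u1 t * \<omega> u1 t)) a + vf_apply \<eta> (vf_apply \<eta> (\<lambda>t. y u2 t * \<omega> u2 t)) a"
        by (rule eventually_nhds_x_imp_x[OF vf_apply_add]) (intro germ_intros sy s\<omega> \<eta>)+
      also have "\<dots> = 0"
        using third_derivative_vanishes[OF sy s\<omega> \<eta>(1) ya \<omega>a \<eta>\<omega>] u(1,2) by simp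
      finally have "(vf_apply \<eta> ^^ 3) (\<lambda>t. x (f t) $ 3) a = 0" .
      moreover have "(vf_apply \<eta> ^^ 3) (\<lambda>t. x (f t) $ 3) a \<noteq> 0"
        by (rule vf_ordD) (use ord in \<open>simp add: numeral_eq_enat\<close>)
      ultimately show False by simp
    qed
    note ker = this
    show ?thesis
    proof (rule injI)
      fix v w assume "der (\<lambda>t. (f t, A t)) a v = der (\<lambda>t. (f t, A t)) a w"
      then have "v - w = 0"
        by (intro ker) (simp_all add: D linear_diff[OF frechet_linear[OF f]] linear_diff[OF frechet_linear[OF A(1)]])
      then show "v = w" by simp
    qed
  qed
  show ?thesis
    unfolding front_def immersive_lift_def using f P expr inj by blast
qed

section \<open>Invariants of the cuspidal edge\<close>

lemma germ_ideal_gen: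
  assumes "finite G" "g \<in> G" "smooth_germ a c" "\<forall>\<^sub>F t in nhds a. h t = c t * g t"
  shows "h \<in> germ_ideal a G"
  unfolding germ_ideal_def
proof (intro CollectI exI[of _ "\<lambda>g'. if g' = g then c else (\<lambda>t. 0)"] conjI ballI)
  fix g' show "smooth_germ a (if g' = g then c else (\<lambda>t. 0))" using assms(3) by (simp add: germ_intros)
next
  have "(\<Sum>g'\<in>G. (if g' = g then c else (\<lambda>t. 0)) t * g' t) = c t * g t" for t
  proof -
    have "(\<Sum>g'\<in>G. (if g' = g then c else (\<lambda>t. 0)) t * g' t) = (\<Sum>g'\<in>G. if g' = g then c t * g' t else 0)"
      by (rule sum.cong) auto
    then show ?thesis using assms(1,2) by simp
  qed
  then show "\<forall>\<^sub>F t in nhds a. h t = (\<Sum>g'\<in>G. (if g' = g then c else (\<lambda>t. 0)) t * g' t)"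
    using assms(4) by simp
qed

lemma germ_ideal_add:
  assumes "h1 \<in> germ_ideal a G" "h2 \<in> germ_ideal a G"
  shows "(\<lambda>t. h1 t + h2 t) \<in> germ_ideal a G"
proof -
  obtain c where c: "\<forall>g\<in>G. smooth_germ a (c g)" "\<forall>\<^sub>F t in nhds a. h1 t = (\<Sum>g\<in>G. c g t * g t)"
    using assms(1) unfolding germ_ideal_def by blast
  obtain d where d: "\<forall>g\<in>G. smooth_germ a (d g)" "\<forall>\<^sub>F t in nhds a. h2 t = (\<Sum>g\<in>G. d g t * g t)"
    using assms(2) unfolding germ_ideal_def by blast
  have "\<forall>\<^sub>F t in nhds a. h1 t + h2 t = (\<Sum>g\<in>G. (c g t + d g t) * g t)"
    using c(2) d(2) by eventually_elim (simp add: sum.distrib distrib_right)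
  then show ?thesis
    unfolding germ_ideal_def using c(1) d(1)
    by (intro CollectI exI[of _ "\<lambda>g t. c g t + d g t"]) (auto intro: germ_intros)
qed

lemma germ_ideal_mult:
  assumes "h \<in> germ_ideal a G" "smooth_germ a m" "\<forall>\<^sub>F t in nhds a. k t = m t * h t"
  shows "k \<in> germ_ideal a G"
proof -
  obtain c where c: "\<forall>g\<in>G. smooth_germ a (c g)" "\<forall>\<^sub>F t in nhds a. h t = (\<Sum>g\<in>G. c g t * g t)"
    using assms(1) unfolding germ_ideal_def by blast
  have "\<forall>\<^sub>F t in nhds a. k t = (\<Sum>g\<in>G. (m t * c g t) * g t)"
    using c(2) assms(3) by eventually_elim (simp add: sum_distrib_left mult.assoc)
  then show ?thesis
    unfolding germ_ideal_def using c(1) assms(2)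
    by (intro CollectI exI[of _ "\<lambda>g t. m t * c g t"]) (auto intro: germ_intros)
qed

text \<open>
  The choice of rows \<open>k\<close>, \<open>l\<close> for a \<open>2\<times>2\<close> minor of a \<open>3\<times>2\<close> matrix.
\<close>

definition pick :: "3 \<Rightarrow> 3 \<Rightarrow> 2 \<Rightarrow> 3" where "pick k l i = (if i = 1 then k else l)"

lemma pick_simps [simp]: "pick k l 1 = k" "pick k l 2 = l"
  by (simp_all add: pick_def)

lemma minor_combination:
  fixes f :: "real^2 \<Rightarrow> real^3"
  assumes c: "smooth_germ a c12" "smooth_germ a c13" "smooth_germ a c23"
    and h: "\<forall>\<^sub>F t in nhds a. h t = c12 t * jacobi_minor f (pick 1 2) t
      + (c13 t * jacobi_minor f (pick 1 3) t + c23 t * jacobi_minor f (pick 2 3) t)"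
  shows "h \<in> jacobi_ideal a f"
proof -
  have inj: "inj (pick k l)" if "k \<noteq> l" for k l
    using that by (auto simp: inj_def pick_def split: if_splits) (metis exhaust_2)+
  have ne: "(1::3) \<noteq> 2" "(1::3) \<noteq> 3" "(2::3) \<noteq> 3" by simp_all
  have gen: "(\<lambda>t. k t * jacobi_minor f s t) \<in> jacobi_ideal a f" if "smooth_germ a k" "inj s" for k s
    unfolding jacobi_ideal_def
    by (rule germ_ideal_gen[OF finite_minors _ that(1)]) (use that(2) in auto)
  have "(\<lambda>t. c12 t * jacobi_minor f (pick 1 2) t
      + (c13 t * jacobi_minor f (pick 1 3) t + c23 t * jacobi_minor f (pick 2 3) t)) \<in> jacobi_ideal a f"
    unfolding jacobi_ideal_def
    by (intro germ_ideal_add gen[unfolded jacobi_ideal_def] c inj ne)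
  then show ?thesis
    unfolding jacobi_ideal_def by (rule germ_ideal_mult[OF _ smooth_germ_const[of a 1]]) (use h in simp)
qed

text \<open>
  Write \<open>\<tau> \<circ> f = (s1, s2\<^sup>2, s2\<^sup>3)\<close>. The minor of the first two components is \<open>2 s2\<close> times a unit,
  hence \<open>s2\<close> lies in the Jacobi ideal. The Hamiltonian field \<open>\<xi>\<close> of \<open>s1\<close> satisfies
  \<open>df(\<xi>) = s2 j y\<close> with \<open>y\<close> smooth; so it is in the kernel module, which makes \<open>\<eta> a\<close> a nonzero
  multiple of \<open>\<xi> a\<close>, and \<open>y(a)\<close> is a limit of tangent directions, which identifies the limiting
  tangent plane.
\<close>

theorem cuspidal_edge_invariants:
  fixes f :: "real^2 \<Rightarrow> real^3"
  assumes fr: "frontal a f" and cr: "corank a f = 1" and jac: "is_jacobian a f l" and ker: "kernel_field a f l \<eta>"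
    and eq: "A_equivalent f a cuspidal_edge 0"
  shows "vf_apply \<eta> l a \<noteq> 0" and "\<exists>x. adapted_coordinates a f x \<and> vf_ord a \<eta> (\<lambda>t. x (f t) $ 3) = 3"
proof -
  have f: "smooth_germ a f" using fr by (simp add: frontal_def)
  have ce0: "cuspidal_edge 0 = 0" by (simp add: cuspidal_edge_def vec_eq_iff forall_3)
  obtain \<sigma> \<tau> where d\<sigma>: "diffeo_germ \<sigma> a 0" and d\<tau>: "diffeo_germ \<tau> (f a) 0"
    and st: "\<forall>\<^sub>F t in nhds a. \<tau> (f t) = cuspidal_edge (\<sigma> t)"
    using eq unfolding A_equivalent_def ce0 by blast
  obtain \<rho> where d\<rho>: "diffeo_germ \<rho> 0 (f a)" and \<rho>\<tau>: "\<forall>\<^sub>F y in nhds (f a). \<rho> (\<tau> y) = y"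
    using diffeo_germE[OF d\<tau>] by blast
  note s\<sigma> = diffeo_germ_smooth[OF d\<sigma>] and \<sigma>a = diffeo_germ_base[OF d\<sigma>]
  note s\<tau> = diffeo_germ_smooth[OF d\<tau>] and \<tau>a = diffeo_germ_base[OF d\<tau>] and s\<rho> = diffeo_germ_smooth[OF d\<rho>]
  define s1 where "s1 t = \<sigma> t $ 1" for t
  define s2 where "s2 t = \<sigma> t $ 2" for t
  have ss: "smooth_germ a s1" "smooth_germ a s2" unfolding s1_def s2_def by (intro germ_intros s\<sigma>)+
  have s2a: "s2 a = 0" by (simp add: s2_def \<sigma>a)
  let ?D = "\<lambda>t. der f t" and ?D1 = "\<lambda>t. der s1 t" and ?D2 = "\<lambda>t. der s2 t"
  have D\<sigma>: "der \<sigma> a v = vector [?D1 a v, ?D2 a v]" for v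
    by (simp add: vec_eq_iff forall_2 s1_def[abs_def] s2_def[abs_def] frechet_vec_nth[OF s\<sigma>])
  have D\<sigma>_surj: "\<exists>v. der \<sigma> a v = w" for w
    using diffeo_germ_derivative_bij[OF d\<sigma>] by (metis bij_pointE)
  have D\<tau>: "\<forall>\<^sub>F t in nhds a. \<forall>v. der \<tau> (f t) (?D t v)
      = vector [?D1 t v, s2 t * (2 * ?D2 t v), s2 t * (3 * s2 t * ?D2 t v)]"
  proof -
    have "\<forall>\<^sub>F t in nhds a. \<tau> (f t) = vector [s1 t, (s2 t)\<^sup>2, s2 t ^ 3]"
      using st by eventually_elim (simp add: cuspidal_edge_def s1_def s2_def)
    from eventually_frechet_derivative_cong[OF this] show ?thesis
      using smooth_germ_eventually_smooth[OF ss(1)] smooth_germ_eventually_smooth[OF ss(2)]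
        smooth_germ_eventually_smooth[OF f] eventually_compose_germ[OF smooth_germ_eventually_smooth[OF s\<tau>] f refl]
    proof eventually_elim
      case (elim t)
      have sF: "smooth_germ t (\<lambda>t. vector [s1 t, (s2 t)\<^sup>2, s2 t ^ 3] :: real^3)" by (intro germ_intros elim)
      have d2: "der (\<lambda>t. (s2 t)\<^sup>2) t v = s2 t * (2 * ?D2 t v)"
        "der (\<lambda>t. s2 t ^ 3) t v = s2 t * (3 * s2 t * ?D2 t v)" for v
        using frechet_derivative_at[OF has_derivative_power[OF smooth_germ_derivative[OF elim(3)], of 2], symmetric]
          frechet_derivative_at[OF has_derivative_power[OF smooth_germ_derivative[OF elim(3)], of 3], symmetric]
        by (simp_all add: power2_eq_square)
      show ?case
      proof
        fix v
        have "der \<tau> (f t) (?D t v) = der (\<lambda>t. vector [s1 t, (s2 t)\<^sup>2, s2 t ^ 3]) t v"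
          using frechet_derivative_compose[OF elim(4,5)] elim(1) by metis
        also have "\<dots> = vector [?D1 t v, s2 t * (2 * ?D2 t v), s2 t * (3 * s2 t * ?D2 t v)]"
          using frechet_vec_nth[OF sF, symmetric] d2 by (simp add: vec_eq_iff forall_3)
        finally show "der \<tau> (f t) (?D t v) = vector [?D1 t v, s2 t * (2 * ?D2 t v), s2 t * (3 * s2 t * ?D2 t v)]" .
      qed
    qed
  qed
  have D\<rho>: "\<forall>\<^sub>F t in nhds a. \<forall>w. der \<rho> (\<tau> (f t)) (der \<tau> (f t) w) = w"
  proof -
    have "\<forall>\<^sub>F y in nhds (f a). \<forall>\<^sub>F y in nhds y. \<rho> (\<tau> y) = y" using \<rho>\<tau> by (simp only: eventually_eventually)
    then have "\<forall>\<^sub>F y in nhds (f a). \<forall>w. der \<rho> (\<tau> y) (der \<tau> y w) = w"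
      using smooth_germ_eventually_smooth[OF s\<tau>] eventually_compose_germ[OF smooth_germ_eventually_smooth[OF s\<rho>] s\<tau> \<tau>a]
    proof eventually_elim
      case (elim y)
      have "der (\<lambda>y. \<rho> (\<tau> y)) y = der (\<lambda>y. y) y"
        by (rule frechet_derivative_germ_cong[OF elim(1)])
      then show ?case using frechet_derivative_compose[OF elim(2,3)] by simp
    qed
    from eventually_compose_germ[OF this f refl] show ?thesis .
  qed
  define \<xi> where "\<xi> t = (vector [- ?D1 t (axis 2 1), ?D1 t (axis 1 1)] :: real^2)" for t
  define j where "j t = ?D2 t (\<xi> t)" for t
  have s\<xi>: "smooth_germ a \<xi>" unfolding \<xi>_def by (intro germ_intros ss)
  have sj: "smooth_germ a j" unfolding j_def by (intro germ_intros ss s\<xi>)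
  have \<xi>_eq: "\<forall>\<^sub>F t in nhds a. ?D1 t (\<xi> t) = 0 \<and>
      j t = ?D1 t (axis 1 1) * ?D2 t (axis 2 1) - ?D1 t (axis 2 1) * ?D2 t (axis 1 1)"
    using smooth_germ_eventually_smooth[OF ss(1)] smooth_germ_eventually_smooth[OF ss(2)]
  proof eventually_elim
    case (elim t)
    show ?case
      using linear_vec2_expand[OF frechet_linear[OF elim(1)], of "\<xi> t"] linear_vec2_expand[OF frechet_linear[OF elim(2)], of "\<xi> t"]
      by (simp add: \<xi>_def j_def)
  qed
  have \<xi>a: "\<xi> a \<noteq> 0"
  proof
    assume "\<xi> a = 0"
    then have "?D1 a (axis 1 1) = 0" "?D1 a (axis 2 1) = 0" by (auto simp: \<xi>_def vec_eq_iff forall_2)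
    then have "?D1 a v = 0" for v using linear_vec2_expand[OF frechet_linear[OF ss(1)], of v] by simp
    moreover obtain v where "der \<sigma> a v = axis 1 1" using D\<sigma>_surj by blast
    then have "?D1 a v = 1" using D\<sigma>[of v] by (simp add: vec_eq_iff forall_2 axis_def)
    ultimately show False by simp
  qed
  have D\<sigma>_ker: "v = 0" if "?D1 a v = 0" "?D2 a v = 0" for v
  proof -
    have "der \<sigma> a v = der \<sigma> a 0"
      using that by (simp add: D\<sigma> vec_eq_iff forall_2 linear_0[OF frechet_linear] ss)
    then show ?thesis using diffeo_germ_derivative_bij[OF d\<sigma>] by (metis bij_pointE)
  qed
  have ja: "j a \<noteq> 0" using D\<sigma>_ker[of "\<xi> a"] \<xi>a eventually_nhds_x_imp_x[OF \<xi>_eq] by (auto simp: j_def)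
  have j_ev: "\<forall>\<^sub>F t in nhds a. j t \<noteq> 0" using tendsto_imp_eventually_ne[OF smooth_germ_tendsto[OF sj] ja] .
  define y where "y t = der \<rho> (\<tau> (f t)) (vector [0, 2, 3 * s2 t] :: real^3)" for t
  have s\<tau>f: "smooth_germ a (\<lambda>t. \<tau> (f t))" by (rule smooth_germ_compose[OF s\<tau> refl f])
  have s\<rho>': "smooth_germ (\<tau> (f a)) \<rho>" using s\<rho> \<tau>a by simp
  have sy: "smooth_germ a y" unfolding y_def by (intro smooth_germ_frechet_along(1)[where f = "\<lambda>t. \<tau> (f t)"] s\<rho>' s\<tau>f germ_intros ss)
  have D\<xi>: "\<forall>\<^sub>F t in nhds a. ?D t (\<xi> t) = (s2 t * j t) *\<^sub>R y t"
    using D\<tau> D\<rho> \<xi>_eq eventually_compose_germ[OF smooth_germ_eventually_smooth[OF s\<rho>'] s\<tau>f refl]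
  proof eventually_elim
    case (elim t)
    have "der \<tau> (f t) (?D t (\<xi> t)) = (s2 t * j t) *\<^sub>R vector [0, 2, 3 * s2 t]"
      using elim(1,3) by (simp add: vec_eq_iff forall_3 j_def)
    then show ?case
      using elim(2)[rule_format, of "?D t (\<xi> t)"] linear_scale[OF frechet_linear[OF elim(4)]] by (simp add: y_def)
  qed
  \<comment> \<open>The minor of \<open>\<tau> \<circ> f\<close> in the first two rows is \<open>2 j s2\<close>; by Cauchy-Binet it is a combination
    of the minors of \<open>f\<close> whose coefficients are minors of \<open>d\<tau>\<close>.\<close>
  define T where "T k i t = der \<tau> (f t) (axis k 1) $ i" for k i t
  have sT: "smooth_germ a (T k i)" for k i
    unfolding T_def by (intro smooth_germ_vec_nth smooth_germ_frechet_along(1) s\<tau> f germ_intros)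
  define cc where "cc k m t = (T k 1 t * T m 2 t - T m 1 t * T k 2 t) / (2 * j t)" for k m t
  have scc: "smooth_germ a (cc k m)" for k m unfolding cc_def using ja by (intro germ_intros sT sj) simp
  have s2J: "s2 \<in> jacobi_ideal a f"
  proof (rule minor_combination[OF scc[of 1 2] scc[of 1 3] scc[of 2 3]])
    show "\<forall>\<^sub>F t in nhds a. s2 t = cc 1 2 t * jacobi_minor f (pick 1 2) t
      + (cc 1 3 t * jacobi_minor f (pick 1 3) t + cc 2 3 t * jacobi_minor f (pick 2 3) t)"
      using D\<tau> \<xi>_eq j_ev eventually_compose_germ[OF smooth_germ_eventually_smooth[OF s\<tau>] f refl]
    proof eventually_elim
      case (elim t)
      let ?a = "?D t (axis 1 1)" and ?b = "?D t (axis 2 1)"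
      have exp: "der \<tau> (f t) w $ i = w $ 1 * T 1 i t + w $ 2 * T 2 i t + w $ 3 * T 3 i t" for w i
      proof -
        have "w = w $ 1 *\<^sub>R axis 1 1 + w $ 2 *\<^sub>R axis 2 1 + w $ 3 *\<^sub>R axis 3 1"
          by (simp add: vec_eq_iff forall_3 axis_def)
        then have "der \<tau> (f t) w
            = w $ 1 *\<^sub>R der \<tau> (f t) (axis 1 1) + w $ 2 *\<^sub>R der \<tau> (f t) (axis 2 1)
              + w $ 3 *\<^sub>R der \<tau> (f t) (axis 3 1)"
          by (metis linear_add[OF frechet_linear[OF elim(4)]] linear_scale[OF frechet_linear[OF elim(4)]])
        then show ?thesis by (simp add: T_def)
      qed
      have "der \<tau> (f t) ?a $ 1 * der \<tau> (f t) ?b $ 2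
          - der \<tau> (f t) ?b $ 1 * der \<tau> (f t) ?a $ 2 = 2 * j t * s2 t"
        using conjunct2[OF elim(2)] unfolding elim(1)[rule_format] vector_3 by algebra
      then have E: "2 * j t * s2 t = (T 1 1 t * T 2 2 t - T 2 1 t * T 1 2 t) * jacobi_minor f (pick 1 2) t
         + ((T 1 1 t * T 3 2 t - T 3 1 t * T 1 2 t) * jacobi_minor f (pick 1 3) t
         + (T 2 1 t * T 3 2 t - T 3 1 t * T 2 2 t) * jacobi_minor f (pick 2 3) t)"
        unfolding exp jacobi_minor_eq pick_simps by algebra
      have div: "s = p / x * a + (q / x * b + r / x * c)" if "x * s = p * a + (q * b + r * c)" "x \<noteq> 0"
        for x s p q r a b c :: real
      proof -
        have "s = (x * s) / x" using that(2) by simp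
        also have "\<dots> = p / x * a + (q / x * b + r / x * c)" unfolding that(1) by (simp add: add_divide_distrib)
        finally show ?thesis .
      qed
      show ?case unfolding cc_def by (rule div[OF E]) (use elim(3) in simp)
    qed
  qed
  have "\<xi> \<in> kernel_module a f"
    unfolding kernel_module_def
  proof (intro CollectI conjI allI s\<xi>)
    fix i
    have "\<forall>\<^sub>F t in nhds a. vf_apply \<xi> (\<lambda>t. f t $ i) t = (j t * y t $ i) * s2 t"
      using D\<xi> smooth_germ_eventually_smooth[OF f] by eventually_elim (simp add: vf_apply_def frechet_vec_nth)
    then show "vf_apply \<xi> (\<lambda>t. f t $ i) \<in> jacobi_ideal a f"
      unfolding jacobi_ideal_def
      by (intro germ_ideal_mult[OF s2J[unfolded jacobi_ideal_def], of "\<lambda>t. j t * y t $ i"] germ_intros sj sy)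
  qed
  then obtain c \<zeta> where "\<forall>\<^sub>F t in nhds a. \<xi> t = c t *\<^sub>R \<eta> t + l t *\<^sub>R \<zeta> t"
    using ker unfolding kernel_field_def by blast
  from eventually_nhds_x_imp_x[OF this] have "\<eta> a \<noteq> 0" using \<xi>a jacobian_at[OF f cr jac] by auto
  have \<eta>m: "\<eta> \<in> kernel_module a f" using ker by (simp add: kernel_field_def)
  then have s\<eta>: "smooth_germ a \<eta>" by (simp add: kernel_module_def)
  have D\<eta>: "?D a (\<eta> a) = 0" by (rule kernel_module_at[OF f cr \<eta>m])
  have "?D1 a (\<eta> a) = 0"
    using eventually_nhds_x_imp_x[OF D\<tau>, rule_format, of "\<eta> a"] D\<eta> linear_0[OF frechet_linear[OF s\<tau>]]
    by (simp add: vec_eq_iff forall_3)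
  then have \<eta>s2: "?D2 a (\<eta> a) \<noteq> 0" using D\<sigma>_ker[of "\<eta> a"] \<open>\<eta> a \<noteq> 0\<close> by blast
  show "vf_apply \<eta> l a \<noteq> 0"
  proof
    assume 0: "vf_apply \<eta> l a = 0"
    have sl: "smooth_germ a l" using jac by (simp add: is_jacobian_def)
    obtain d where d: "smooth_germ a d" "\<forall>\<^sub>F t in nhds a. s2 t = l t * d t"
      using s2J jac unfolding is_jacobian_def germ_ideal_def by (auto simp: mult.commute)
    have "?D2 a (\<eta> a) = der l a (\<eta> a) * d a"
      unfolding frechet_derivative_germ_cong[OF d(2)] by (rule frechet_mult_zero[OF sl d(1) jacobian_at[OF f cr jac]])
    then show False using \<eta>s2 0 by (simp add: vf_apply_def)
  qed
  \<comment> \<open>Each derivative of \<open>s2\<^sup>3\<close> along \<open>\<eta>\<close> removes one factor \<open>s2\<close>; the third leaves \<open>6 (\<eta> s2)\<^sup>3\<close>.\<close>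
  have ord: "vf_ord a \<eta> (\<lambda>t. \<tau> (f t) $ 3) = 3"
  proof -
    let ?h = "\<lambda>t. \<tau> (f t) $ 3"
    define e where "e = vf_apply \<eta> s2"
    have se: "smooth_germ a e" unfolding e_def by (intro germ_intros s\<eta> ss)
    define k1 where "k1 t = 3 * e t" for t
    have sk1: "smooth_germ a k1" unfolding k1_def by (intro germ_intros se)
    define k2 where "k2 t = 2 * e t * k1 t + s2 t * vf_apply \<eta> k1 t" for t
    have sk2: "smooth_germ a k2" unfolding k2_def by (intro germ_intros se sk1 ss s\<eta>)
    have h: "\<forall>\<^sub>F t in nhds a. ?h t = s2 t ^ 3"
      using st by eventually_elim (simp add: cuspidal_edge_def s2_def)
    have v1: "\<forall>\<^sub>F t in nhds a. vf_apply \<eta> ?h t = s2 t * (s2 t * k1 t)"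
    proof -
      have "\<forall>\<^sub>F t in nhds a. vf_apply \<eta> (\<lambda>t. s2 t ^ 3) t = s2 t * (s2 t * k1 t)"
        using smooth_germ_eventually_smooth[OF ss(2)]
      proof eventually_elim
        case (elim t)
        show ?case
          using frechet_derivative_at[OF has_derivative_power[OF smooth_germ_derivative[OF elim], of 3], symmetric]
          by (simp add: vf_apply_def k1_def e_def power2_eq_square)
      qed
      then show ?thesis using vf_apply_cong[OF h, of \<eta>] by eventually_elim simp
    qed
    have s2k1: "smooth_germ a (\<lambda>t. s2 t * k1 t)" by (intro germ_intros ss sk1)
    have v2: "\<forall>\<^sub>F t in nhds a. vf_apply \<eta> (vf_apply \<eta> ?h) t = s2 t * k2 t"
      using vf_apply_cong[OF v1, of \<eta>] vf_apply_mult[OF ss(2) s2k1, of \<eta>] vf_apply_mult[OF ss(2) sk1, of \<eta>]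
      by eventually_elim (simp add: k2_def e_def algebra_simps)
    have v3: "vf_apply \<eta> (vf_apply \<eta> (vf_apply \<eta> ?h)) a = e a * k2 a"
    proof -
      have "vf_apply \<eta> (\<lambda>t. s2 t * k2 t) a = e a * k2 a"
        using frechet_mult_zero[OF ss(2) sk2 s2a, of "\<eta> a"] by (simp add: vf_apply_def e_def)
      then show ?thesis using vf_apply_at[OF v2, of \<eta>] by (rule trans[rotated])
    qed
    have ea: "e a \<noteq> 0" using \<eta>s2 by (simp add: e_def vf_apply_def)
    have "vf_ord a \<eta> ?h = enat 3"
    proof (rule vf_ord_eq)
      show "(vf_apply \<eta> ^^ 3) ?h a \<noteq> 0"
        using v3 ea s2a by (simp add: numeral_3_eq_3 k2_def k1_def)
      fix i :: nat assume "i < 3"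
      then consider "i = 0" | "i = 1" | "i = 2" by linarith
      then show "(vf_apply \<eta> ^^ i) ?h a = 0"
      proof cases
        case 1 then show ?thesis using eventually_nhds_x_imp_x[OF h] s2a by simp
      next
        case 2 then show ?thesis using eventually_nhds_x_imp_x[OF v1] s2a by simp
      next
        case 3 then show ?thesis using eventually_nhds_x_imp_x[OF v2] s2a by (simp add: numeral_2_eq_2)
      qed
    qed
    then show ?thesis by (simp add: numeral_eq_enat)
  qed
  \<comment> \<open>\<open>G\<close> is the equation of the lifted plane evaluated at \<open>y\<close>. It vanishes after multiplication by
    \<open>s2 j\<close>; differentiating along \<open>\<xi>\<close>, which is transverse to \<open>s2 = 0\<close>, gives \<open>G a = 0\<close>.\<close>
  obtain P where P: "legendre_lift a f P" using fr by (auto simp: frontal_def)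
  obtain A where A: "smooth_germ a A" "\<forall>\<^sub>F t in nhds a. gr_chart (P a) (P t) (A t)"
    using P unfolding legendre_lift_def smooth_gr_expr_def by blast
  have PG: "P a \<in> Gr 2" and range: "\<forall>\<^sub>F t in nhds a. range (?D t) \<subseteq> P t"
    using P eventually_nhds_x_imp_x[of "\<lambda>t. P t \<in> Gr 2" a] unfolding legendre_lift_def by auto
  have subP: "subspace (P a)" and dimP: "dim (P a) = 2" using PG by (auto simp: Gr_def)
  let ?R = "der \<rho> 0"
  have R\<tau>: "?R (der \<tau> (f a) w) = w" for w
    using eventually_nhds_x_imp_x[OF D\<rho>] \<tau>a by simp
  define cv where "cv i = coord_vector \<tau> (f a) i" for i
  have cv: "cv i = ?R (axis i 1)" for i
    using R\<tau>[of "cv i"] coord_vector_derivative[OF d\<tau>, of i] by (simp add: cv_def)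
  have lR: "linear ?R" by (rule frechet_linear[OF s\<rho>])
  have bR: "bij ?R" by (rule diffeo_germ_derivative_bij[OF d\<rho>])
  have cv1P: "cv 1 \<in> P a"
  proof -
    obtain v where v: "der \<sigma> a v = axis 1 1" using D\<sigma>_surj by blast
    then have "?D1 a v = 1" using D\<sigma>[of v] by (simp add: vec_eq_iff forall_2 axis_def)
    then have "der \<tau> (f a) (?D a v) = axis 1 1"
      using eventually_nhds_x_imp_x[OF D\<tau>, rule_format, of v] s2a by (simp add: vec_eq_iff forall_3 axis_def)
    then have "?D a v = cv 1" using R\<tau>[of "?D a v"] cv by simp
    moreover have "?D a v \<in> P a" using eventually_nhds_x_imp_x[OF range] by blast
    ultimately show ?thesis by simp
  qed
  have ne: "cv 1 \<noteq> 0"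
  proof
    assume "cv 1 = 0"
    then have "der \<tau> (f a) (cv 1) = 0" using linear_0[OF frechet_linear[OF s\<tau>]] by simp
    then show False using coord_vector_derivative[OF d\<tau>, of 1] by (simp add: cv_def axis_eq_0_iff)
  qed
  obtain u1 u2 u3 where u: "u1 \<in> P a" "u2 \<in> P a" "\<And>p. p \<in> P a \<Longrightarrow> u3 \<bullet> p = 0"
    "u1 \<bullet> u3 = 0" "u2 \<bullet> u3 = 0" "u3 \<bullet> u3 = 1"
    and u_exp: "\<And>y. y = (u1 \<bullet> y) *\<^sub>R u1 + (u2 \<bullet> y) *\<^sub>R u2 + (u3 \<bullet> y) *\<^sub>R u3"
    by (rule orthonormal_frame[OF PG cv1P ne]) (rule that)
  have u3: "\<forall>p\<in>P a. u3 \<bullet> p = 0" using u(3) by blast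
  note frame = gr_chart_frame[OF u(1,2) u3 u(4,5,6) u_exp]
  define G where "G t = u3 \<bullet> y t - (u3 \<bullet> (A t *v u1)) * (u1 \<bullet> y t) - (u3 \<bullet> (A t *v u2)) * (u2 \<bullet> y t)" for t
  have sG: "smooth_germ a G"
    unfolding G_def by (intro germ_intros smooth_germ_linear_comp[OF bounded_linear_matrix_entry] A sy)
  have "\<forall>\<^sub>F t in nhds a. s2 t * (j t * G t) = 0"
    using A(2) range D\<xi>
  proof eventually_elim
    case (elim t)
    have "?D t (\<xi> t) \<in> P t" using elim(2) by blast
    from frame(3)[OF elim(1) this] show ?case
      unfolding elim(3) by (simp add: G_def algebra_simps)
  qed
  from frechet_derivative_germ_cong[OF this]
  have "der (\<lambda>t. s2 t * (j t * G t)) a (\<xi> a) = 0" by simp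
  moreover have "der (\<lambda>t. s2 t * (j t * G t)) a (\<xi> a) = j a * (j a * G a)"
    using frechet_mult_zero[OF ss(2) smooth_germ_mult[OF sj sG] s2a, of "\<xi> a"] by (simp only: j_def[of a])
  ultimately have "G a = 0" using ja by simp
  moreover have "A a *v u1 = 0" "A a *v u2 = 0"
    using gr_chart_base[OF eventually_nhds_x_imp_x[OF A(2)] _ subP] u(1,2) by auto
  moreover have "y a = 2 *\<^sub>R cv 2"
  proof -
    have "vector [0, 2, 3 * s2 a] = 2 *\<^sub>R (axis 2 1 :: real^3)" by (simp add: s2a vec_eq_iff forall_3 axis_def)
    then show ?thesis using linear_scale[OF lR, of 2 "axis 2 1"] by (simp add: y_def \<tau>a cv)
  qed
  ultimately have "u3 \<bullet> cv 2 = 0" by (simp add: G_def)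
  then have "cv 2 = (u1 \<bullet> cv 2) *\<^sub>R u1 + (u2 \<bullet> cv 2) *\<^sub>R u2" using u_exp[of "cv 2"] by simp
  then have cv2P: "cv 2 \<in> P a" using u(1,2) subP by (metis subspace_add subspace_scale)
  have "dim {cv 1, cv 2} = 2"
  proof -
    have a12: "axis 1 1 \<noteq> (axis 2 1 :: real^3)" by (simp add: axis_eq_axis)
    have "dim (?R ` {axis 1 1, axis 2 1}) = dim {axis 1 1, axis 2 1 :: real^3}"
      by (rule dim_image_eq[OF lR]) (use bR in \<open>auto intro: inj_on_subset simp: bij_def\<close>)
    moreover have "independent {axis 1 1, axis 2 1 :: real^3}"
      by (rule independent_mono[OF independent_Basis]) (auto simp: axis_in_Basis_iff)
    ultimately show ?thesis using a12 by (simp add: cv dim_eq_card_independent)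
  qed
  then have "span {cv 1, cv 2} = span (P a)" using cv1P cv2P dimP by (intro dim_eq_span) auto
  then have "P a = span {cv 1, cv 2}" using subP by (simp add: span_eq_iff[THEN iffD2])
  then have "adapted_coordinates a f \<tau>"
    unfolding adapted_coordinates_def using d\<tau> P by (auto simp: cv_def)
  with ord show "\<exists>x. adapted_coordinates a f x \<and> vf_ord a \<eta> (\<lambda>t. x (f t) $ 3) = 3" by blast
qed

theorem theorem3p9:
  fixes f :: "real^2 \<Rightarrow> real^3" and a :: "real^2" and b :: "real^3"
    and l :: "real^2 \<Rightarrow> real" and \<eta> :: "real^2 \<Rightarrow> real^2"
  assumes "f a = b"
    and "frontal a f"
    and "corank a f = 1"
    and "is_jacobian a f l"
    and "kernel_field a f l \<eta>"
  shows
    "((\<exists>\<gamma>. curve_of_type 1 2 3 \<gamma> \<and> A_equivalent f a (tangent_surface 1 \<gamma>) 0) \<longleftrightarrow>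
      A_equivalent f a (\<lambda>t. vector [t $ 1, (t $ 2)^2, (t $ 2)^3]) 0) \<and>
     (A_equivalent f a (\<lambda>t. vector [t $ 1, (t $ 2)^2, (t $ 2)^3]) 0 \<longleftrightarrow>
      front a f \<and> vf_apply \<eta> l a \<noteq> 0) \<and>
     (front a f \<and> vf_apply \<eta> l a \<noteq> 0 \<longleftrightarrow>
      vf_apply \<eta> l a \<noteq> 0 \<and>
        (\<exists>x. adapted_coordinates a f x \<and> vf_ord a \<eta> (\<lambda>t. x (f t) $ 3) = 3))"
proof -
  let ?ord = "\<exists>x. adapted_coordinates a f x \<and> vf_ord a \<eta> (\<lambda>t. x (f t) $ 3) = 3"
  have ce: "(\<lambda>t. vector [t $ 1, (t $ 2)^2, (t $ 2)^3]) = cuspidal_edge"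
    by (simp add: cuspidal_edge_def fun_eq_iff)
  have f: "smooth_germ a f" using assms(2) by (simp add: frontal_def)
  have \<eta>m: "\<eta> \<in> kernel_module a f" using assms(5) by (simp add: kernel_field_def)
  then have s\<eta>: "smooth_germ a \<eta>" by (simp add: kernel_module_def)
  have D\<eta>: "der f a (\<eta> a) = 0" by (rule kernel_module_at[OF f assms(3) \<eta>m])
  have sl: "smooth_germ a l" using assms(4) by (simp add: is_jacobian_def)
  have \<eta>0: "\<eta> a \<noteq> 0" if "vf_apply \<eta> l a \<noteq> 0"
    using that linear_0[OF frechet_linear[OF sl]] by (auto simp: vf_apply_def)
  have tangent: "(\<exists>\<gamma>. curve_of_type 1 2 3 \<gamma> \<and> A_equivalent f a (tangent_surface 1 \<gamma>) 0) \<longleftrightarrow> A_equivalent f a cuspidal_edge 0"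
  proof
    assume "\<exists>\<gamma>. curve_of_type 1 2 3 \<gamma> \<and> A_equivalent f a (tangent_surface 1 \<gamma>) 0"
    then show "A_equivalent f a cuspidal_edge 0"
      using A_equivalent_trans tangent_surface_cuspidal_edge(1) by blast
  next
    assume c: "A_equivalent f a cuspidal_edge 0"
    note T = tangent_surface_cuspidal_edge[OF moment_curve_type]
    have "A_equivalent f a (tangent_surface 1 (\<lambda>t. vector [t, t ^ 2, t ^ 3])) 0"
      by (rule A_equivalent_trans[OF c A_equivalent_sym[OF T]])
    then show "\<exists>\<gamma>. curve_of_type 1 2 3 \<gamma> \<and> A_equivalent f a (tangent_surface 1 \<gamma>) 0"
      using moment_curve_type by blast
  qed
  have 1: "A_equivalent f a cuspidal_edge 0 \<Longrightarrow> vf_apply \<eta> l a \<noteq> 0 \<and> ?ord"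
    using cuspidal_edge_invariants[OF assms(2-5)] by blast
  have 2: "vf_apply \<eta> l a \<noteq> 0 \<Longrightarrow> ?ord \<Longrightarrow> front a f"
    using adapted_order_three_front[OF f assms(3) s\<eta> D\<eta> \<eta>0] by blast
  have 3: "front a f \<Longrightarrow> vf_apply \<eta> l a \<noteq> 0 \<Longrightarrow> A_equivalent f a cuspidal_edge 0"
    using front_cuspidal_edge[OF _ assms(3,4)] D\<eta> by blast
  show ?thesis
    unfolding ce tangent using 1 2 3 by blast
qed

end
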